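(* Let $G=(\mathbb{C}^* )^n$ with Lie algebra $\mathfrak{g}$ of invariant vector fields. There is a constant $C_G$ depending only on $G$ such that the following holds. Let $\xi\in\mathfrak{g}$, let $\Sigma\subset G$ be a finite subset containing $0$, let $P\in\mathbb{C}[x_1,\ldots,x_n]$ be a polynomial of degree $d$, and let $T\in\mathbb{N}$. Suppose that for every proper algebraic subgroup $H\subset G$ we have $$\#(\Sigma+H)/H>d^{\operatorname{codim}_GH}\cdot C_G/T.$$ If $P$ vanishes at every point of $\Sigma^{(n)}$ with multiplicity at least $T$ in the direction of $\xi$, then there exists $\gamma\in\Sigma^{(n)}$ such that $P$ vanishes identically at $\gamma$ in the direction of $\xi$.
   Context: The group law of $G=(\mathbb{C}^* )^n$ (coordinatewise multiplication) is written additively, and its identity element is denoted $0$. For $\Sigma\subset G$ put $\Sigma^{(0)}=\{0\}$ and $\Sigma^{(p)}=\{\gamma_1+\cdots+\gamma_p:\gamma_i\in\Sigma\}$. For a subgroup $H$ of $G$, $\#(\Sigma+H)/H$ is the number of cosets of $H$ meeting $\Sigma$. The invariant vector fields are $\xi=\sum_i a_ix_i\frac{\partial}{\partial x_i}$, $a_i\in\mathbb{C}$. $P$ vanishes at $p$ with multiplicity at least $T\ge1$ in the direction of $\xi$ if $P=\xi P=\cdots=\xi^{T-1}P=0$ at $p$; $P$ vanishes identically at $p$ in the direction of $\xi$ if $P$ vanishes identically on the trajectory of $\xi$ through $p$ (equivalently $\xi^iP(p)=0$ for all $i\ge0$). *)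

theory Defs
  imports
    "HOL-Analysis.Analysis"
    "HOL-Library.Poly_Mapping"
    "HOL-Algebra.Coset"
begin

text \<open>The index type \<open>'n\<close> stands for \<open>{1..n}\<close>. The group is written multiplicatively here: the
  element called \<open>0\<close> in additive notation is the vector \<open>1 = (1, \<dots>, 1)\<close>.\<close>

definition torus :: "(complex ^ 'n) monoid" where
  "torus = \<lparr>carrier = {x. \<forall>i. x $ i \<noteq> 0}, mult = (*), one = 1\<rparr>"

lemma comm_group_torus: "comm_group (torus :: (complex ^ 'n) monoid)"
proof (rule comm_groupI)
  fix x :: "complex ^ 'n" assume x: "x \<in> carrier torus"
  have "(\<chi> i. inverse (x $ i)) \<otimes>\<^bsub>torus\<^esub> x = \<one>\<^bsub>torus\<^esub>"
    using x by (simp add: torus_def vec_eq_iff)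
  moreover have "(\<chi> i. inverse (x $ i)) \<in> carrier torus"
    using x by (simp add: torus_def)
  ultimately show "\<exists>y\<in>carrier torus. y \<otimes>\<^bsub>torus\<^esub> x = \<one>\<^bsub>torus\<^esub>" by blast
qed (auto simp: torus_def vec_eq_iff)

primrec iterated_product :: "(complex ^ 'n) set \<Rightarrow> nat \<Rightarrow> (complex ^ 'n) set" where
  "iterated_product S 0 = {\<one>\<^bsub>torus\<^esub>}"
| "iterated_product S (Suc p) = iterated_product S p <#>\<^bsub>torus\<^esub> S"

definition number_of_cosets :: "(complex ^ 'n) set \<Rightarrow> (complex ^ 'n) set \<Rightarrow> nat" where
  "number_of_cosets S H = card ((\<lambda>\<sigma>. H #>\<^bsub>torus\<^esub> \<sigma>) ` S)"

text \<open>A polynomial maps each exponent vector to its coefficient; the ring structure is the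
  convolution product of \<^theory>\<open>HOL-Library.Poly_Mapping\<close>.\<close>

type_synonym 'n mpoly = "('n \<Rightarrow>\<^sub>0 nat) \<Rightarrow>\<^sub>0 complex"

definition mconst :: "complex \<Rightarrow> 'n mpoly" where
  "mconst c = Poly_Mapping.single 0 c"

definition mvar :: "'n \<Rightarrow> 'n mpoly" where
  "mvar i = Poly_Mapping.single (Poly_Mapping.single i 1) 1"

definition meval :: "('n::finite) mpoly \<Rightarrow> complex ^ 'n \<Rightarrow> complex" where
  "meval P x = (\<Sum>m\<in>Poly_Mapping.keys P.
     Poly_Mapping.lookup P m * (\<Prod>i\<in>UNIV. (x $ i) ^ Poly_Mapping.lookup m i))"

text \<open>Total degree, with the convention that the zero polynomial has degree \<open>0\<close>.\<close>

definition total_degree :: "('n::finite) mpoly \<Rightarrow> nat" where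
  "total_degree P =
     Max (insert 0 ((\<lambda>m. \<Sum>i\<in>UNIV. Poly_Mapping.lookup m i) ` Poly_Mapping.keys P))"

text \<open>If the exponent of the variable \<open>i\<close> in \<open>m\<close> is \<open>0\<close>, the truncated subtraction below is harmless
  because the coefficient vanishes.\<close>

definition mpderiv :: "'n \<Rightarrow> 'n mpoly \<Rightarrow> 'n mpoly" where
  "mpderiv i P = (\<Sum>m\<in>Poly_Mapping.keys P.
     Poly_Mapping.single (m - Poly_Mapping.single i 1)
       (of_nat (Poly_Mapping.lookup m i) * Poly_Mapping.lookup P m))"

text \<open>The invariant vector field \<open>\<Sum>\<^sub>i a\<^sub>i x\<^sub>i \<partial>/\<partial>x\<^sub>i\<close> is represented by its coefficient vector \<open>a\<close>.\<close>

definition invariant_field :: "complex ^ 'n \<Rightarrow> ('n::finite) mpoly \<Rightarrow> 'n mpoly" where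
  "invariant_field a P = (\<Sum>i\<in>UNIV. mconst (a $ i) * mvar i * mpderiv i P)"

definition vanishes_to_order ::
  "('n::finite) mpoly \<Rightarrow> complex ^ 'n \<Rightarrow> complex ^ 'n \<Rightarrow> nat \<Rightarrow> bool" where
  "vanishes_to_order P a p T \<longleftrightarrow> (\<forall>k<T. meval ((invariant_field a ^^ k) P) p = 0)"

text \<open>The integral curve of the field through \<open>p\<close>, with complex time.\<close>

definition trajectory :: "complex ^ 'n \<Rightarrow> complex ^ 'n \<Rightarrow> complex \<Rightarrow> complex ^ 'n" where
  "trajectory a p t = (\<chi> i. exp (t * a $ i) * p $ i)"

lemma trajectory_0: "trajectory a p 0 = p"
  by (simp add: trajectory_def vec_eq_iff)

lemma trajectory_has_field_derivative:
  "((\<lambda>t. trajectory a p t $ i) has_field_derivative a $ i * trajectory a p t $ i) (at t)"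
  unfolding trajectory_def by (auto intro!: derivative_eq_intros)

definition vanishes_identically ::
  "('n::finite) mpoly \<Rightarrow> complex ^ 'n \<Rightarrow> complex ^ 'n \<Rightarrow> bool" where
  "vanishes_identically P a p \<longleftrightarrow> (\<forall>t. meval P (trajectory a p t) = 0)"

text \<open>Closed sets for the Zariski topology of the torus. Ordinary polynomials suffice: a Laurent
  polynomial becomes one after multiplication by a monomial, which is a unit on the torus.\<close>

definition zariski_closed :: "(complex ^ 'n::finite) set \<Rightarrow> bool" where
  "zariski_closed Z \<longleftrightarrow>
     (\<exists>F :: 'n mpoly set. Z = {x \<in> carrier torus. \<forall>f\<in>F. meval f x = 0})"

definition algebraic_subgroup :: "(complex ^ 'n::finite) set \<Rightarrow> bool" where
  "algebraic_subgroup H \<longleftrightarrow> subgroup H torus \<and> zariski_closed H"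

definition irreducible_closed :: "(complex ^ 'n::finite) set \<Rightarrow> bool" where
  "irreducible_closed Z \<longleftrightarrow> zariski_closed Z \<and> Z \<noteq> {} \<and>
     (\<forall>A B. zariski_closed A \<longrightarrow> zariski_closed B \<longrightarrow> Z = A \<union> B \<longrightarrow> Z = A \<or> Z = B)"

text \<open>Krull dimension: the maximal length \<open>k\<close> of a chain \<open>c 0 \<subset> \<dots> \<subset> c k\<close> of irreducible closed
  subsets. It is only used for nonempty \<open>Z\<close>; the lengths are then bounded by \<open>CARD('n)\<close>.\<close>

definition zariski_dim :: "(complex ^ 'n::finite) set \<Rightarrow> nat" where
  "zariski_dim Z = Sup {k. \<exists>c :: nat \<Rightarrow> (complex ^ 'n) set.
     (\<forall>i\<le>k. irreducible_closed (c i) \<and> c i \<subseteq> Z) \<and> (\<forall>i<k. c i \<subset> c (Suc i))}"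

definition codim :: "(complex ^ 'n::finite) set \<Rightarrow> nat" where
  "codim H = zariski_dim (carrier torus :: (complex ^ 'n) set) - zariski_dim H"

end

theory Submission
  imports Defs "HOL-Library.Set_Algebras"
begin

text \<open>Write \<open>T\<^sub>1 = \<lceil>T/n\<rceil>\<close> and let \<open>I\<^sub>r\<close> be the ideal generated by the translates by
  \<open>\<Sigma>\<^sup>(\<^sup>r\<^sup>)\<close> of the \<open>\<xi>\<^sup>k P\<close> with \<open>k \<le> r (T\<^sub>1 - 1)\<close>. Invariant fields and translations do not raise
  degrees. Let \<open>\<rho> r\<close> be the maximal dimension of a prime \<open>Q \<supseteq> I\<^sub>r\<close> whose zero set meets
  \<open>\<Sigma>\<^sup>(\<^sup>n\<^sup>-\<^sup>r\<^sup>)\<close>. Since \<open>n > \<rho> 0 \<ge> \<dots> \<ge> \<rho> n \<ge> 0\<close>, two consecutive values agree. If \<open>Q\<close> attains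
  \<open>\<rho> (r + 1) = \<rho> r\<close>, then every translate of \<open>Q\<close> by an element of \<open>\<Sigma>\<close> is minimal over \<open>I\<^sub>r\<close>, and
  the elements of \<open>I\<^sub>r\<close> vanish along it to order \<open>T\<^sub>1\<close> in the direction \<open>\<xi>\<close>. If \<open>\<xi>\<close> is tangent to the zero
  set of \<open>Q\<close>, then \<open>P\<close> vanishes identically at a point of \<open>\<Sigma>\<^sup>(\<^sup>n\<^sup>)\<close>. Otherwise a Bezout inequality
  bounds the number of translates times \<open>T\<^sub>1\<close> by a multiple of \<open>d\<^sup>c\<close>, where \<open>c\<close> is the codimension of \<open>Q\<close>;
  the number of translates is the number of cosets of the stabilizer of \<open>Q\<close>, whose codimension is at
  least \<open>c\<close>.

  The Bezout inequality needs neither regular sequences nor Hilbert polynomials. Let \<open>K\<close> be the field of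
  rational functions in a transcendence basis of coordinates modulo \<open>Q\<close>. The ring modulo the \<open>s\<close>-th symbolic
  power of \<open>I\<^sub>r\<close> at the translates is finite-dimensional over \<open>K\<close> and is spanned by products of at most \<open>s\<close>
  generators with finitely many fixed polynomials, so its dimension is at most that of a space of
  polynomials of degree \<open>d s + O(1)\<close> in \<open>c\<close> variables. On the other hand the vanishing to order \<open>T\<^sub>1\<close>
  produces about \<open>T\<^sub>1 s\<^sup>c\<close> independent elements at each translate. Now let \<open>s \<longrightarrow> \<infinity>\<close>.\<close>

section \<open>Ideals and prime ideals\<close>

definition ideal :: "'a::comm_ring_1 set \<Rightarrow> bool" where
  "ideal I \<longleftrightarrow> 0 \<in> I \<and> (\<forall>x\<in>I. \<forall>y\<in>I. x + y \<in> I) \<and> (\<forall>r. \<forall>x\<in>I. r * x \<in> I)"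

definition prime_ideal :: "'a::comm_ring_1 set \<Rightarrow> bool" where
  "prime_ideal P \<longleftrightarrow> ideal P \<and> 1 \<notin> P \<and> (\<forall>x y. x * y \<in> P \<longrightarrow> x \<in> P \<or> y \<in> P)"

lemma ideal_zero: "ideal I \<Longrightarrow> 0 \<in> I"
  and ideal_add: "ideal I \<Longrightarrow> x \<in> I \<Longrightarrow> y \<in> I \<Longrightarrow> x + y \<in> I"
  and ideal_mult: "ideal I \<Longrightarrow> x \<in> I \<Longrightarrow> r * x \<in> I"
  and ideal_mult_right: "ideal I \<Longrightarrow> x \<in> I \<Longrightarrow> x * r \<in> I"
  by (auto simp: ideal_def mult.commute)

lemma ideal_minus: "ideal I \<Longrightarrow> x \<in> I \<Longrightarrow> - x \<in> I"
  using ideal_mult[of I x "-1"] by simp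

lemma ideal_diff: "ideal I \<Longrightarrow> x \<in> I \<Longrightarrow> y \<in> I \<Longrightarrow> x - y \<in> I"
  using ideal_add[of I x "-y"] ideal_minus by fastforce

lemma ideal_sum: "ideal I \<Longrightarrow> (\<And>i. i \<in> A \<Longrightarrow> f i \<in> I) \<Longrightarrow> sum f A \<in> I"
  by (induction A rule: infinite_finite_induct) (auto simp: ideal_zero ideal_add)

lemma ideal_add_cancel: "ideal I \<Longrightarrow> x \<in> I \<Longrightarrow> x + y \<in> I \<longleftrightarrow> y \<in> I"
  using ideal_add ideal_diff by (metis add_diff_cancel_left')

lemma prime_ideal_ideal: "prime_ideal P \<Longrightarrow> ideal P"
  and prime_ideal_one: "prime_ideal P \<Longrightarrow> 1 \<notin> P"
  by (auto simp: prime_ideal_def)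

lemma prime_ideal_mult_iff: "prime_ideal P \<Longrightarrow> x * y \<in> P \<longleftrightarrow> x \<in> P \<or> y \<in> P"
  by (meson prime_ideal_def ideal_mult ideal_mult_right)

lemma prime_ideal_power_iff: "prime_ideal P \<Longrightarrow> x ^ n \<in> P \<longleftrightarrow> x \<in> P \<and> n > 0"
  by (induction n) (auto simp: prime_ideal_mult_iff prime_ideal_one)

lemma prime_ideal_prod_iff:
  "prime_ideal P \<Longrightarrow> finite A \<Longrightarrow> prod f A \<in> P \<longleftrightarrow> (\<exists>i\<in>A. f i \<in> P)"
  by (induction A rule: infinite_finite_induct) (auto simp: prime_ideal_mult_iff prime_ideal_one)

text \<open>Incomparability gives for each \<open>P\<close> a product \<open>\<theta> P\<close> that
  avoids \<open>P\<close> but lies in every other member. Modulo \<open>P\<close>, the sum of the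
  \<open>\<theta> P * a P\<close> keeps just the summand of \<open>P\<close>.\<close>

lemma prime_avoidance:
  assumes fin: "finite \<P>" and pr: "\<And>P. P \<in> \<P> \<Longrightarrow> prime_ideal P"
    and inc: "\<And>P Q. P \<in> \<P> \<Longrightarrow> Q \<in> \<P> \<Longrightarrow> P \<subseteq> Q \<Longrightarrow> P = Q"
    and A: "ideal A" and nsub: "\<And>P. P \<in> \<P> \<Longrightarrow> \<not> A \<subseteq> P"
  obtains h where "h \<in> A" "\<And>P. P \<in> \<P> \<Longrightarrow> h \<notin> P"
proof -
  have "\<exists>t. \<forall>P\<in>\<P>. \<forall>Q\<in>\<P>. P \<noteq> Q \<longrightarrow> t P Q \<in> Q \<and> t P Q \<notin> P"
    using inc by (intro exI[of _ "\<lambda>P Q. SOME x. x \<in> Q \<and> x \<notin> P"]) (metis (mono_tags, lifting) someI_ex subsetI)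
  then obtain t where t: "\<And>P Q. P \<in> \<P> \<Longrightarrow> Q \<in> \<P> \<Longrightarrow> P \<noteq> Q \<Longrightarrow> t P Q \<in> Q \<and> t P Q \<notin> P" by blast
  obtain a where a: "\<And>P. P \<in> \<P> \<Longrightarrow> a P \<in> A \<and> a P \<notin> P" using nsub by (metis subsetI)
  define \<theta> where "\<theta> P = (\<Prod>Q\<in>\<P>-{P}. t P Q)" for P
  have \<theta>1: "\<theta> P \<notin> P" if "P \<in> \<P>" for P
    unfolding \<theta>_def using that t fin by (subst prime_ideal_prod_iff) (auto simp: pr)
  have \<theta>2: "\<theta> P \<in> Q" if "P \<in> \<P>" "Q \<in> \<P>" "P \<noteq> Q" for P Q
    unfolding \<theta>_def using that t fin by (subst prime_ideal_prod_iff) (auto simp: pr)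
  define h where "h = (\<Sum>P\<in>\<P>. \<theta> P * a P)"
  have "h \<in> A" unfolding h_def using a by (auto intro!: ideal_sum A ideal_mult)
  moreover have "h \<notin> P" if P: "P \<in> \<P>" for P
  proof -
    have "h = \<theta> P * a P + (\<Sum>Q\<in>\<P>-{P}. \<theta> Q * a Q)" unfolding h_def using P fin by (simp add: sum.remove)
    moreover have "(\<Sum>Q\<in>\<P>-{P}. \<theta> Q * a Q) \<in> P"
      using \<theta>2 P by (intro ideal_sum prime_ideal_ideal pr ideal_mult_right) auto
    moreover have "\<theta> P * a P \<notin> P" using \<theta>1 a P by (simp add: prime_ideal_mult_iff pr)
    ultimately show ?thesis using ideal_add_cancel[OF prime_ideal_ideal[OF pr[OF P]]] by (metis add.commute)
  qed
  ultimately show ?thesis using that by blast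
qed

text \<open>Sums suffice in the powers below: ring coefficients are absorbed by the previous power,
  and the zeroth power is the whole ring.\<close>

inductive_set additive_span :: "'a::comm_ring_1 set \<Rightarrow> 'a set" for X where
  zero: "0 \<in> additive_span X"
| add: "x \<in> X \<Longrightarrow> a \<in> additive_span X \<Longrightarrow> x + a \<in> additive_span X"

text \<open>The \<open>t\<close>-th power of the ideal generated by \<open>F\<close>.\<close>

primrec gen_power :: "'a::comm_ring_1 set \<Rightarrow> nat \<Rightarrow> 'a set" where
  "gen_power F 0 = UNIV"
| "gen_power F (Suc t) = additive_span {f * g | f g. f \<in> F \<and> g \<in> gen_power F t}"

lemma additive_span_add: "x \<in> additive_span X \<Longrightarrow> y \<in> additive_span X \<Longrightarrow> x + y \<in> additive_span X"
  by (induction rule: additive_span.induct) (auto simp: add.assoc intro: additive_span.intros)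

lemma additive_span_mult:
  assumes "x \<in> additive_span X" "\<And>x. x \<in> X \<Longrightarrow> r * x \<in> Y"
  shows "r * x \<in> additive_span Y"
  using assms(1) by (induction rule: additive_span.induct) (auto simp: distrib_left intro: additive_span.intros assms(2))

lemma ideal_gen_power: "ideal (gen_power F t)"
proof (induction t)
  case 0 show ?case by (simp add: ideal_def)
next
  case (Suc t)
  show ?case unfolding ideal_def
  proof (intro conjI ballI allI)
    fix r x assume "x \<in> gen_power F (Suc t)"
    moreover have "r * y \<in> {f * g | f g. f \<in> F \<and> g \<in> gen_power F t}"
      if y: "y \<in> {f * g | f g. f \<in> F \<and> g \<in> gen_power F t}" for y
    proof -
      obtain f g where y: "y = f * g" "f \<in> F" "g \<in> gen_power F t" using y by blast
      then have "r * y = f * (r * g)" "r * g \<in> gen_power F t" using Suc by (auto simp: ideal_mult mult.left_commute)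
      then show ?thesis using y by blast
    qed
    ultimately show "r * x \<in> gen_power F (Suc t)"
      unfolding gen_power.simps using additive_span_mult by blast
  next
    show "0 \<in> gen_power F (Suc t)" by (simp add: additive_span.zero)
  next
    fix x y assume "x \<in> gen_power F (Suc t)" "y \<in> gen_power F (Suc t)"
    then show "x + y \<in> gen_power F (Suc t)" by (simp add: additive_span_add)
  qed
qed

lemma gen_power_SucI: "f \<in> F \<Longrightarrow> g \<in> gen_power F t \<Longrightarrow> f * g \<in> gen_power F (Suc t)"
  using additive_span.add[OF _ additive_span.zero, of "f * g" "{f * g | f g. f \<in> F \<and> g \<in> gen_power F t}"] by auto

lemma gen_power_mult: "x \<in> gen_power F s \<Longrightarrow> y \<in> gen_power F t \<Longrightarrow> x * y \<in> gen_power F (s + t)"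
proof (induction s arbitrary: x)
  case 0 then show ?case by (simp add: ideal_gen_power ideal_mult)
next
  case (Suc s)
  from Suc.prems(1)[simplified] show ?case
  proof (induction rule: additive_span.induct)
    case zero show ?case using ideal_gen_power[of F "Suc s + t"] by (simp only: mult_zero_left ideal_zero)
  next
    case (add u a)
    then obtain f g where u: "u = f * g" "f \<in> F" "g \<in> gen_power F s" by auto
    have "f * (g * y) \<in> gen_power F (Suc (s + t))"
      by (intro gen_power_SucI Suc.IH Suc.prems u)
    then show ?case using add.IH u ideal_add[OF ideal_gen_power[of F "Suc s + t"]]
      by (simp only: distrib_right mult.assoc add_Suc)
  qed
qed

lemma gen_power_power: "x \<in> gen_power F 1 \<Longrightarrow> x ^ s \<in> gen_power F s"
  using gen_power_mult[of x F 1] by (induction s) auto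

text \<open>In the local ring at \<open>P\<close>, the radical of the ideal of \<open>F\<close> is
  the maximal ideal; here this is said without localizing. An ideal maximal among those containing
  \<open>F\<close> and missing the multiplicative set \<open>M\<close> is prime and lies in
  \<open>P\<close>, hence equals \<open>P\<close>, although \<open>g\<close> belongs to both
  \<open>P\<close> and \<open>M\<close>.\<close>

lemma minimal_prime:
  assumes P: "prime_ideal P" and F: "F \<subseteq> P"
    and min: "\<And>Q. prime_ideal Q \<Longrightarrow> F \<subseteq> Q \<Longrightarrow> Q \<subseteq> P \<Longrightarrow> Q = P" and g: "g \<in> P"
  obtains h m where "h \<notin> P" "h * g ^ m \<in> gen_power F 1"
proof (rule ccontr)
  note goal = that
  assume nt: "\<not> thesis"
  have no: "h * g ^ m \<notin> gen_power F 1" if "h \<notin> P" for h m using that nt goal by blast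
  define M where "M = {h * g ^ m | h m. h \<notin> P}"
  have Mmult: "x * y \<in> M" if "x \<in> M" "y \<in> M" for x y
  proof -
    obtain h m h' m' where "x = h * g ^ m" "y = h' * g ^ m'" "h \<notin> P" "h' \<notin> P" using \<open>x \<in> M\<close> \<open>y \<in> M\<close> unfolding M_def by blast
    then have "x * y = (h * h') * g ^ (m + m')" "h * h' \<notin> P"
      by (auto simp: power_add prime_ideal_mult_iff[OF P])
    then show ?thesis unfolding M_def by blast
  qed
  have M1: "h \<in> M" if "h \<notin> P" for h unfolding M_def using that by (intro CollectI exI[of _ h] exI[of _ 0]) simp
  have Mg: "g \<in> M" unfolding M_def using P by (intro CollectI exI[of _ 1]) (simp add: prime_ideal_one)
  define \<A> where "\<A> = {I. ideal I \<and> F \<subseteq> I \<and> I \<inter> M = {}}"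
  have Fin: "F \<subseteq> gen_power F 1" using gen_power_SucI[of _ F 1 0] by fastforce
  have "gen_power F 1 \<in> \<A>" unfolding \<A>_def using Fin no by (auto simp: M_def ideal_gen_power simp del: gen_power.simps)
  then have ne: "\<A> \<noteq> {}" by blast
  have "\<exists>I\<in>\<A>. \<forall>X\<in>\<A>. I \<subseteq> X \<longrightarrow> X = I"
  proof (rule subset_Zorn_nonempty[OF ne])
    fix C assume C: "C \<noteq> {}" "subset.chain \<A> C"
    then have sub: "C \<subseteq> \<A>" and ch: "\<And>x y. x \<in> C \<Longrightarrow> y \<in> C \<Longrightarrow> x \<subseteq> y \<or> y \<subseteq> x"
      by (auto simp: subset.chain_def)
    have "ideal (\<Union>C)" unfolding ideal_def
    proof (intro conjI ballI allI)
      show "0 \<in> \<Union>C" using C(1) sub ideal_zero by (fastforce simp: \<A>_def)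
    next
      fix x y assume "x \<in> \<Union>C" "y \<in> \<Union>C"
      then obtain X Y where XY: "X \<in> C" "Y \<in> C" "x \<in> X" "y \<in> Y" by blast
      then obtain Z where "Z \<in> C" "x \<in> Z" "y \<in> Z" using ch[of X Y] by blast
      then show "x + y \<in> \<Union>C" using sub by (auto simp: \<A>_def intro: ideal_add)
    next
      fix r x assume "x \<in> \<Union>C" then show "r * x \<in> \<Union>C" using sub by (auto simp: \<A>_def intro: ideal_mult)
    qed
    then show "\<Union>C \<in> \<A>" using sub C(1) by (auto simp: \<A>_def)
  qed
  then obtain Q where Q: "Q \<in> \<A>" and Qmax: "\<And>X. X \<in> \<A> \<Longrightarrow> Q \<subseteq> X \<Longrightarrow> X = Q" by blast
  have Qi: "ideal Q" and FQ: "F \<subseteq> Q" and QM: "Q \<inter> M = {}" using Q by (auto simp: \<A>_def)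
  \<comment> \<open>By maximality, adjoining an outside element to \<open>Q\<close> reaches
    \<open>M\<close>. Multiplying two such elements of \<open>M\<close> shows that \<open>Q\<close>
    is prime.\<close>
  have ext: "\<exists>r. \<exists>q\<in>Q. q + r * x \<in> M" if "x \<notin> Q" for x
  proof (rule ccontr)
    assume nM: "\<not> ?thesis"
    define X where "X = {q + r * x | q r. q \<in> Q}"
    have Xi: "ideal X" unfolding ideal_def
    proof (intro conjI ballI allI)
      show "0 \<in> X" unfolding X_def using ideal_zero[OF Qi] by (intro CollectI exI[of _ 0]) simp
    next
      fix u v assume "u \<in> X" "v \<in> X"
      then obtain q r q' r' where "u = q + r * x" "v = q' + r' * x" "q \<in> Q" "q' \<in> Q" unfolding X_def by blast
      then have "u + v = (q + q') + (r + r') * x" "q + q' \<in> Q" by (auto simp: algebra_simps Qi ideal_add)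
      then show "u + v \<in> X" unfolding X_def by blast
    next
      fix s u assume "u \<in> X"
      then obtain q r where "u = q + r * x" "q \<in> Q" unfolding X_def by blast
      then have "s * u = s * q + (s * r) * x" "s * q \<in> Q" by (auto simp: distrib_left mult.assoc Qi ideal_mult)
      then show "s * u \<in> X" unfolding X_def by blast
    qed
    have "q + r * x \<in> X" if "q \<in> Q" for q r unfolding X_def using that by blast
    from this[of _ 0] this[of 0 1] have QX: "Q \<subseteq> X" and xX: "x \<in> X" using ideal_zero[OF Qi] by auto
    have "X \<inter> M = {}" using nM unfolding X_def by blast
    then have "X \<in> \<A>" using Xi QX FQ by (auto simp: \<A>_def)
    then show False using Qmax QX xX that by blast
  qed
  have "prime_ideal Q" unfolding prime_ideal_def
  proof (intro conjI allI impI Qi)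
    show "1 \<notin> Q" using M1 prime_ideal_one[OF P] QM by blast
  next
    fix x y assume xy: "x * y \<in> Q"
    show "x \<in> Q \<or> y \<in> Q"
    proof (rule ccontr)
      assume "\<not> ?thesis"
      then obtain r q s p where *: "q \<in> Q" "q + r * x \<in> M" "p \<in> Q" "p + s * y \<in> M"
        using ext[of x] ext[of y] by blast
      have "(q + r * x) * (p + s * y) = q * (p + s * y) + (r * x * p + (r * s) * (x * y))"
        by (simp add: algebra_simps)
      also have "\<dots> \<in> Q" using * xy by (intro ideal_add Qi) (auto simp: Qi ideal_mult ideal_mult_right)
      finally show False using Mmult[OF *(2) *(4)] QM by blast
    qed
  qed
  moreover have "Q \<subseteq> P" using M1 QM by blast
  ultimately have "Q = P" using min FQ by blast
  then show False using g Mg QM by blast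
qed

section \<open>Rank over a subdomain\<close>

text \<open>Linear algebra over the fraction field of \<open>S\<close>, with all denominators
  cleared. The ambient ring stays a general commutative ring; \<open>S\<close> will be the
  polynomial ring in independent coordinates.\<close>

locale subdomain =
  fixes S :: "'a::comm_ring_1 set"
  assumes zero_S: "0 \<in> S" and one_S: "1 \<in> S"
    and add_S: "x \<in> S \<Longrightarrow> y \<in> S \<Longrightarrow> x + y \<in> S"
    and uminus_S: "x \<in> S \<Longrightarrow> - x \<in> S"
    and mult_S: "x \<in> S \<Longrightarrow> y \<in> S \<Longrightarrow> x * y \<in> S"
    and no_zero_div_S: "x \<in> S \<Longrightarrow> y \<in> S \<Longrightarrow> x * y = 0 \<Longrightarrow> x = 0 \<or> y = 0"
begin

lemma diff_S: "x \<in> S \<Longrightarrow> y \<in> S \<Longrightarrow> x - y \<in> S"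
  using add_S[of x "- y"] uminus_S by simp

lemma sum_S: "(\<And>i. i \<in> A \<Longrightarrow> f i \<in> S) \<Longrightarrow> sum f A \<in> S"
  by (induction A rule: infinite_finite_induct) (auto simp: zero_S add_S)

lemma prod_S: "finite A \<Longrightarrow> (\<And>i. i \<in> A \<Longrightarrow> f i \<in> S \<and> f i \<noteq> 0) \<Longrightarrow> prod f A \<in> S \<and> prod f A \<noteq> 0"
  by (induction A rule: finite_induct) (auto simp: one_S mult_S dest: no_zero_div_S)

section \<open>Submodules, saturation and linear dependence\<close>

definition submod :: "'a set \<Rightarrow> bool" where
  "submod N \<longleftrightarrow> 0 \<in> N \<and> (\<forall>x\<in>N. \<forall>y\<in>N. x + y \<in> N) \<and> (\<forall>r\<in>S. \<forall>x\<in>N. r * x \<in> N)"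

text \<open>For a submodule \<open>N\<close> this is the preimage of \<open>N\<close> after
  inverting the nonzero scalars, so it stands for the span over the fraction field.\<close>

definition sat :: "'a set \<Rightarrow> 'a set" where
  "sat N = {g. \<exists>b\<in>S. b \<noteq> 0 \<and> b * g \<in> N}"

definition sspan :: "'a set \<Rightarrow> 'a set" where
  "sspan X = {\<Sum>x\<in>X. r x * x | r. \<forall>x\<in>X. r x \<in> S}"

lemma submod_sum: "submod N \<Longrightarrow> (\<And>i. i \<in> A \<Longrightarrow> f i \<in> N) \<Longrightarrow> sum f A \<in> N"
  by (induction A rule: infinite_finite_induct) (auto simp: submod_def)

lemma submod_ideal: "ideal I \<Longrightarrow> submod I"
  by (auto simp: submod_def ideal_def)

lemma submod_plus: assumes "submod M" "submod N" shows "submod (M + N)"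
  unfolding submod_def
proof (intro conjI ballI)
  show "0 \<in> M + N" using set_plus_intro[of 0 M 0 N] assms by (auto simp: submod_def)
next
  fix x y assume "x \<in> M + N" "y \<in> M + N"
  then obtain a b a' b' where *: "x = a + b" "y = a' + b'" "a \<in> M" "a' \<in> M" "b \<in> N" "b' \<in> N"
    by (auto elim!: set_plus_elim)
  then have "x + y = (a + a') + (b + b')" by simp
  moreover have "a + a' \<in> M" "b + b' \<in> N" using * assms by (auto simp: submod_def)
  ultimately show "x + y \<in> M + N" by (auto intro: set_plus_intro)
next
  fix r x assume "r \<in> S" "x \<in> M + N"
  then show "r * x \<in> M + N" using assms by (auto simp: submod_def distrib_left elim!: set_plus_elim intro!: set_plus_intro)
qed

lemma submod_sat: assumes "submod N" shows "submod (sat N)"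
  unfolding submod_def
proof (intro conjI ballI)
  show "0 \<in> sat N" using assms one_S by (auto simp: sat_def submod_def intro!: bexI[of _ 1])
next
  fix x y assume "x \<in> sat N" "y \<in> sat N"
  then obtain b c where *: "b \<in> S" "b \<noteq> 0" "b * x \<in> N" "c \<in> S" "c \<noteq> 0" "c * y \<in> N" by (auto simp: sat_def)
  have "(b * c) * (x + y) = c * (b * x) + b * (c * y)" by (simp add: algebra_simps)
  moreover have "c * (b * x) + b * (c * y) \<in> N" using assms * by (auto simp: submod_def)
  ultimately show "x + y \<in> sat N" unfolding sat_def using * no_zero_div_S mult_S
    by (auto intro!: bexI[of _ "b * c"])
next
  fix r x assume r: "r \<in> S" and "x \<in> sat N"
  then obtain b where "b \<in> S" "b \<noteq> 0" "b * x \<in> N" by (auto simp: sat_def)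
  moreover have "b * (r * x) \<in> N" using assms r \<open>b * x \<in> N\<close> by (simp add: submod_def mult.left_commute[of b])
  ultimately show "r * x \<in> sat N" unfolding sat_def by blast
qed

lemma sat_superset: "N \<subseteq> sat N"
  using one_S by (auto simp: sat_def intro!: bexI[of _ 1])

lemma sat_mono: "M \<subseteq> N \<Longrightarrow> sat M \<subseteq> sat N"
  by (auto simp: sat_def)

lemma sat_sat: "sat (sat N) \<subseteq> sat N"
proof
  fix x assume "x \<in> sat (sat N)"
  then obtain b c where *: "b \<in> S" "b \<noteq> 0" "c \<in> S" "c \<noteq> 0" "c * (b * x) \<in> N" by (auto simp: sat_def)
  then show "x \<in> sat N" unfolding sat_def using no_zero_div_S mult_S
    by (auto intro!: bexI[of _ "c * b"] simp: mult.assoc)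
qed

lemma satI: "b \<in> S \<Longrightarrow> b \<noteq> 0 \<Longrightarrow> b * x \<in> N \<Longrightarrow> x \<in> sat N"
  by (auto simp: sat_def)

lemma sat_cancel: "b \<in> S \<Longrightarrow> b \<noteq> 0 \<Longrightarrow> b * x \<in> sat N \<Longrightarrow> x \<in> sat N"
  using sat_sat satI by blast

text \<open>Gaussian elimination without division: the unknown \<open>k\<close> is eliminated by
  cross-multiplication with its coefficient in equation \<open>x\<close>, and \<open>u\<close>
  recovers its value after scaling the other unknowns.\<close>

lemma homogeneous_system:
  assumes "finite X" "finite A" "card X < card A" "\<And>i x. i \<in> A \<Longrightarrow> x \<in> X \<Longrightarrow> c i x \<in> S"
  shows "\<exists>t. (\<forall>i\<in>A. t i \<in> S) \<and> (\<exists>i\<in>A. t i \<noteq> 0) \<and> (\<forall>x\<in>X. (\<Sum>i\<in>A. t i * c i x) = 0)"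
  using assms
proof (induction X arbitrary: A c rule: finite_induct)
  case empty
  then obtain i where "i \<in> A" by fastforce
  then show ?case using one_S zero_S by (intro exI[of _ "\<lambda>_. 1"]) auto
next
  case (insert x X)
  show ?case
  proof (cases "\<forall>i\<in>A. c i x = 0")
    case True
    have "\<exists>t. (\<forall>i\<in>A. t i \<in> S) \<and> (\<exists>i\<in>A. t i \<noteq> 0) \<and> (\<forall>x\<in>X. (\<Sum>i\<in>A. t i * c i x) = 0)"
      using insert by (intro insert.IH) auto
    then show ?thesis using True by auto
  next
    case False
    then obtain k where k: "k \<in> A" "c k x \<noteq> 0" by blast
    define c' where "c' i y = c k x * c i y - c i x * c k y" for i y
    have "\<exists>t. (\<forall>i\<in>A-{k}. t i \<in> S) \<and> (\<exists>i\<in>A-{k}. t i \<noteq> 0) \<and> (\<forall>y\<in>X. (\<Sum>i\<in>A-{k}. t i * c' i y) = 0)"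
      using insert k by (intro insert.IH) (auto simp: c'_def intro!: diff_S mult_S)
    then obtain t where t: "\<And>i. i \<in> A - {k} \<Longrightarrow> t i \<in> S" "\<exists>i\<in>A-{k}. t i \<noteq> 0"
      "\<And>y. y \<in> X \<Longrightarrow> (\<Sum>i\<in>A-{k}. t i * c' i y) = 0" by blast
    define u where "u i = (if i = k then - (\<Sum>i\<in>A-{k}. t i * c i x) else t i * c k x)" for i
    have uS: "u i \<in> S" if "i \<in> A" for i
      using that t insert.prems k by (auto simp: u_def intro!: uminus_S sum_S mult_S)
    have ex: "\<exists>i\<in>A. u i \<noteq> 0"
    proof -
      obtain i where i: "i \<in> A - {k}" "t i \<noteq> 0" using t by blast
      then have "u i \<noteq> 0" unfolding u_def using t(1)[of i] k insert.prems no_zero_div_S[of "t i" "c k x"] by auto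
      then show ?thesis using i by blast
    qed
    have "(\<Sum>i\<in>A. u i * c i y) = 0" if "y \<in> insert x X" for y
    proof -
      have "(\<Sum>i\<in>A. u i * c i y) = u k * c k y + (\<Sum>i\<in>A-{k}. u i * c i y)"
        using k insert.prems by (simp add: sum.remove)
      also have "(\<Sum>i\<in>A-{k}. u i * c i y) = (\<Sum>i\<in>A-{k}. t i * c k x * c i y)"
        by (intro sum.cong) (auto simp: u_def)
      also have "u k * c k y + \<dots> = (\<Sum>i\<in>A-{k}. t i * c' i y)"
        by (simp add: u_def c'_def sum_distrib_left sum_subtractf right_diff_distrib mult_ac)
      also have "\<dots> = 0"
      proof (cases "y = x")
        case True then show ?thesis by (simp add: c'_def mult.commute)
      next
        case False then show ?thesis using that t by auto
      qed
      finally show ?thesis .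
    qed
    then show ?thesis using uS ex by blast
  qed
qed

text \<open>Steinitz bound modulo \<open>B\<close>: a solution \<open>t\<close> of the homogeneous
  system for the coordinates of the \<open>v i\<close>, multiplied by the denominators
  \<open>b i\<close>, is the desired relation.\<close>

lemma rank_le:
  assumes X: "finite X" and A: "finite A" "card X < card A" and B: "submod B"
    and v: "\<And>i. i \<in> A \<Longrightarrow> v i \<in> sat (sspan X + B)"
  shows "\<exists>r. (\<forall>i\<in>A. r i \<in> S) \<and> (\<exists>i\<in>A. r i \<noteq> 0) \<and> (\<Sum>i\<in>A. r i * v i) \<in> B"
proof -
  define R where "R i b c w \<longleftrightarrow> b \<in> S \<and> b \<noteq> 0 \<and> (\<forall>x\<in>X. c x \<in> S) \<and> w \<in> B \<and> b * v i = (\<Sum>x\<in>X. c x * x) + w"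
    for i b c w
  have "\<exists>b c w. R i b c w" if "i \<in> A" for i
  proof -
    obtain b where b: "b \<in> S" "b \<noteq> 0" "b * v i \<in> sspan X + B" using v[OF \<open>i \<in> A\<close>] by (auto simp: sat_def)
    from b(3) obtain u w where "b * v i = u + w" "u \<in> sspan X" "w \<in> B" by (rule set_plus_elim)
    then show ?thesis using b unfolding sspan_def R_def by blast
  qed
  then obtain b c w where R: "\<And>i. i \<in> A \<Longrightarrow> R i (b i) (c i) (w i)" by metis
  note * = R[unfolded R_def]
  have cS: "c i x \<in> S" if "i \<in> A" "x \<in> X" for i x using * that by simp
  obtain t where t: "\<And>i. i \<in> A \<Longrightarrow> t i \<in> S" "\<exists>i\<in>A. t i \<noteq> 0" "\<And>x. x \<in> X \<Longrightarrow> (\<Sum>i\<in>A. t i * c i x) = 0"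
    using homogeneous_system[OF X A, of c, OF cS] by blast
  have "(\<Sum>i\<in>A. (t i * b i) * v i) = (\<Sum>i\<in>A. t i * ((\<Sum>x\<in>X. c i x * x) + w i))"
    using * by (intro sum.cong) (auto simp: mult.assoc)
  also have "\<dots> = (\<Sum>i\<in>A. \<Sum>x\<in>X. t i * c i x * x) + (\<Sum>i\<in>A. t i * w i)"
    by (simp add: distrib_left sum.distrib sum_distrib_left mult.assoc)
  also have "(\<Sum>i\<in>A. \<Sum>x\<in>X. t i * c i x * x) = (\<Sum>x\<in>X. (\<Sum>i\<in>A. t i * c i x) * x)"
    by (subst sum.swap) (simp add: sum_distrib_right)
  also have "\<dots> = 0" using t by simp
  finally have "(\<Sum>i\<in>A. (t i * b i) * v i) = (\<Sum>i\<in>A. t i * w i)" by simp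
  moreover have "(\<Sum>i\<in>A. t i * w i) \<in> B" using t * B by (intro submod_sum) (auto simp: submod_def)
  ultimately show ?thesis using t * mult_S no_zero_div_S
    by (intro exI[of _ "\<lambda>i. t i * b i"]) (auto, blast)
qed

text \<open>The powers of \<open>h\<close> are dependent, and the lowest nonvanishing coefficient of a dependency is a
  multiple of \<open>h\<close>.\<close>

lemma nonzerodivisor_divides_scalar:
  assumes X: "finite X" and B: "ideal B" and span: "\<And>g. g \<in> sat (sspan X + B)"
    and h: "\<And>g. h * g \<in> B \<Longrightarrow> g \<in> B"
  obtains b w where "b \<in> S" "b \<noteq> 0" "b - h * w \<in> B"
proof -
  have "\<exists>r. (\<forall>i\<in>{..card X}. r i \<in> S) \<and> (\<exists>i\<in>{..card X}. r i \<noteq> 0) \<and> (\<Sum>i\<in>{..card X}. r i * h ^ i) \<in> B"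
    by (rule rank_le[OF X]) (auto simp: span submod_ideal B)
  then obtain r where r: "\<And>i. i \<le> card X \<Longrightarrow> r i \<in> S" "\<exists>i\<le>card X. r i \<noteq> 0" "(\<Sum>i\<le>card X. r i * h ^ i) \<in> B" by auto
  define k where "k = (LEAST i. i \<le> card X \<and> r i \<noteq> 0)"
  have k: "k \<le> card X" "r k \<noteq> 0" using LeastI_ex[of "\<lambda>i. i \<le> card X \<and> r i \<noteq> 0"] r unfolding k_def by auto
  have least: "r i = 0" if "i < k" for i using not_less_Least[of i "\<lambda>i. i \<le> card X \<and> r i \<noteq> 0"] that k unfolding k_def by auto
  have "(\<Sum>i\<le>card X. r i * h ^ i) = (\<Sum>i\<in>{k..card X}. r i * h ^ i)"
    using least by (intro sum.mono_neutral_right) auto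
  also have "\<dots> = r k * h ^ k + (\<Sum>i\<in>{Suc k..card X}. r i * h ^ i)"
    using k by (simp add: sum.atLeast_Suc_atMost)
  also have "(\<Sum>i\<in>{Suc k..card X}. r i * h ^ i) = h ^ k * (h * (\<Sum>i\<in>{Suc k..card X}. r i * h ^ (i - Suc k)))"
    unfolding sum_distrib_left
  proof (intro sum.cong refl)
    fix i assume "i \<in> {Suc k..card X}"
    then have "h ^ i = h ^ k * (h * h ^ (i - Suc k))"
      by (metis atLeastAtMost_iff le_add_diff_inverse power_Suc power_add add_Suc_shift)
    then show "r i * h ^ i = h ^ k * (h * (r i * h ^ (i - Suc k)))" by (simp add: ac_simps)
  qed
  finally have "h ^ k * (r k - h * - (\<Sum>i\<in>{Suc k..card X}. r i * h ^ (i - Suc k))) \<in> B"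
    using r(3) by (simp add: algebra_simps)
  moreover have "g \<in> B" if "h ^ n * g \<in> B" for n g using that by (induction n) (auto simp: h mult.assoc)
  ultimately show ?thesis using that k r by blast
qed

end

section \<open>Polynomials on the torus\<close>

abbreviation lookup where "lookup \<equiv> Poly_Mapping.lookup"
abbreviation keys where "keys \<equiv> Poly_Mapping.keys"
abbreviation single where "single \<equiv> Poly_Mapping.single"

lemma mpoly_eq_sum: "(f :: 'n mpoly) = (\<Sum>m\<in>keys f. single m (lookup f m))"
  by (rule poly_mapping_eqI)
    (auto simp: lookup_sum lookup_single when_def in_keys_iff if_distrib cong: if_cong)

lemma mpoly_induct [case_names zero single add]:
  fixes f :: "'n mpoly"
  assumes "P 0" "\<And>m c. P (single m c)" "\<And>f g. P f \<Longrightarrow> P g \<Longrightarrow> P (f + g)"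
  shows "P f"
proof -
  have "P (\<Sum>m\<in>A. single m (lookup f m))" for A
    by (induction A rule: infinite_finite_induct) (auto simp: assms)
  then show ?thesis by (subst mpoly_eq_sum)
qed

text \<open>Invariant fields and translations both act on monomials by scalars, so both are
  instances: an additive \<open>\<phi>\<close> gives a derivation, a multiplicative one respects
  products. Neither enlarges the support.\<close>

definition diag :: "(('n \<Rightarrow>\<^sub>0 nat) \<Rightarrow> complex) \<Rightarrow> 'n mpoly \<Rightarrow> 'n mpoly" where
  "diag \<phi> f = Poly_Mapping.mapp (\<lambda>m c. \<phi> m * c) f"

lemma lookup_diag [simp]: "lookup (diag \<phi> f) m = \<phi> m * lookup f m"
  by (simp add: diag_def lookup_mapp when_def in_keys_iff)

lemma keys_diag: "keys (diag \<phi> f) \<subseteq> keys f"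
  by (auto simp: in_keys_iff)

lemma diag_zero [simp]: "diag \<phi> 0 = 0"
  and diag_add: "diag \<phi> (f + g) = diag \<phi> f + diag \<phi> g"
  and diag_minus: "diag \<phi> (f - g) = diag \<phi> f - diag \<phi> g"
  and diag_single: "diag \<phi> (single m c) = single m (\<phi> m * c)"
  and diag_diag: "diag \<phi> (diag \<psi> f) = diag \<psi> (diag \<phi> f)"
  by (auto intro!: poly_mapping_eqI simp: lookup_add lookup_minus lookup_single when_def algebra_simps)

lemma diag_mult_additive:
  assumes "\<And>m n. \<phi> (m + n) = \<phi> m + \<phi> n"
  shows "diag \<phi> (f * g) = diag \<phi> f * g + f * diag \<phi> g"
proof (induction f rule: mpoly_induct)
  case (single m c)
  show ?case
    by (induction g rule: mpoly_induct)
      (auto simp: diag_single diag_add mult_single distrib_left assms algebra_simps single_add)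
qed (auto simp: diag_add algebra_simps)

lemma diag_mult_multiplicative:
  assumes "\<And>m n. \<phi> (m + n) = \<phi> m * \<phi> n"
  shows "diag \<phi> (f * g) = diag \<phi> f * diag \<phi> g"
proof (induction f rule: mpoly_induct)
  case (single m c)
  show ?case
    by (induction g rule: mpoly_induct)
      (auto simp: diag_single diag_add mult_single distrib_left assms algebra_simps)
qed (auto simp: diag_add algebra_simps)

text \<open>The eigenvalue of the field \<open>b\<close> on the monomial with exponent
  \<open>m\<close>.\<close>

definition lin :: "complex ^ 'n::finite \<Rightarrow> ('n \<Rightarrow>\<^sub>0 nat) \<Rightarrow> complex" where
  "lin b m = (\<Sum>i\<in>UNIV. b $ i * of_nat (lookup m i))"

definition monom_eval :: "complex ^ 'n::finite \<Rightarrow> ('n \<Rightarrow>\<^sub>0 nat) \<Rightarrow> complex" where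
  "monom_eval x m = (\<Prod>i\<in>UNIV. (x $ i) ^ lookup m i)"

definition translate :: "complex ^ 'n::finite \<Rightarrow> 'n mpoly \<Rightarrow> 'n mpoly" where
  "translate x = diag (monom_eval x)"

lemma lin_add: "lin b (m + n) = lin b m + lin b n"
  by (simp add: lin_def lookup_add sum.distrib algebra_simps)

lemma monom_eval_add: "monom_eval x (m + n) = monom_eval x m * monom_eval x n"
  by (simp add: monom_eval_def lookup_add power_add prod.distrib)

lemma monom_eval_zero [simp]: "monom_eval x 0 = 1"
  by (simp add: monom_eval_def)

lemma monom_eval_mult: "monom_eval (x * y) m = monom_eval x m * monom_eval y m"
  by (simp add: monom_eval_def power_mult_distrib prod.distrib)

lemma monom_eval_one [simp]: "monom_eval 1 m = 1"
  by (simp add: monom_eval_def)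

lemma monom_eval_single: "monom_eval x (single i k) = (x $ i) ^ k"
proof -
  have "monom_eval x (single i k) = (\<Prod>j\<in>UNIV. if j = i then (x $ i) ^ k else 1)"
    unfolding monom_eval_def by (intro prod.cong) (auto simp: lookup_single when_def)
  then show ?thesis by simp
qed

lemma lin_axis: "lin (axis j 1) m = of_nat (lookup m j)"
proof -
  have "lin (axis j 1) m = (\<Sum>i\<in>UNIV. if i = j then of_nat (lookup m i) else 0)"
    unfolding lin_def by (intro sum.cong) (auto simp: axis_def)
  then show ?thesis by simp
qed

lemma invariant_field_eq: "invariant_field a P = diag (lin a) P"
proof -
  have 1: "mconst (a $ i) * mvar i * mpderiv i P = (\<Sum>m\<in>keys P. single m (a $ i * of_nat (lookup m i) * lookup P m))" for i
    unfolding mpderiv_def sum_distrib_left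
  proof (intro sum.cong refl)
    fix m assume "m \<in> keys P"
    show "mconst (a $ i) * mvar i * single (m - single i 1) (of_nat (lookup m i) * lookup P m) =
         single m (a $ i * of_nat (lookup m i) * lookup P m)"
    proof (cases "lookup m i = 0")
      case False
      then have "single i 1 + (m - single i 1) = m"
        by (intro poly_mapping_eqI) (auto simp: lookup_add lookup_minus lookup_single when_def)
      then show ?thesis by (simp add: mconst_def mvar_def mult_single mult.assoc)
    qed simp
  qed
  show ?thesis unfolding invariant_field_def 1
    by (rule poly_mapping_eqI)
      (auto simp: lookup_sum lookup_single when_def in_keys_iff lin_def sum_distrib_right if_distrib cong: if_cong intro!: sum.cong)
qed

lemma invariant_field_mult: "invariant_field a (f * g) = invariant_field a f * g + f * invariant_field a g"
  and invariant_field_add: "invariant_field a (f + g) = invariant_field a f + invariant_field a g"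
  and invariant_field_diff: "invariant_field a (f - g) = invariant_field a f - invariant_field a g"
  by (simp_all add: invariant_field_eq diag_mult_additive lin_add diag_add diag_minus)

lemma lookup_invariant_field_funpow: "lookup ((invariant_field a ^^ k) P) m = lin a m ^ k * lookup P m"
  by (induction k) (auto simp: invariant_field_eq)

lemma translate_mult: "translate x (f * g) = translate x f * translate x g"
  and translate_add: "translate x (f + g) = translate x f + translate x g"
  and translate_zero: "translate x 0 = 0"
  by (simp_all add: translate_def diag_mult_multiplicative monom_eval_add diag_add)

lemma translate_one: "translate x 1 = 1"
  by (simp add: translate_def diag_single monom_eval_def flip: single_one)

lemma translate_translate: "translate x (translate y f) = translate (x * y) f"
  by (rule poly_mapping_eqI) (simp add: translate_def monom_eval_mult)

lemma translate_by_one: "translate 1 f = f"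
  by (rule poly_mapping_eqI) (simp add: translate_def)

lemma translate_invariant_field:
  "translate x (invariant_field a f) = invariant_field a (translate x f)"
  by (simp add: translate_def invariant_field_eq diag_diag)

lemma translate_invariant_field_funpow:
  "translate x ((invariant_field a ^^ k) f) = (invariant_field a ^^ k) (translate x f)"
  by (induction k) (auto simp: translate_invariant_field)

section \<open>Evaluation, trajectories and common nonvanishing points\<close>

lemma meval_eq_sum: "finite A \<Longrightarrow> keys P \<subseteq> A \<Longrightarrow> meval P x = (\<Sum>m\<in>A. lookup P m * monom_eval x m)"
  unfolding meval_def monom_eval_def by (intro sum.mono_neutral_left) (auto simp: in_keys_iff)

lemma meval_single: "meval (single m c) x = c * monom_eval x m"
  by (subst meval_eq_sum[of "{m}"]) auto

lemma meval_zero [simp]: "meval 0 x = 0"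
  by (simp add: meval_def)

lemma meval_add: "meval (f + g) x = meval f x + meval g x"
proof -
  have "keys (f + g) \<subseteq> keys f \<union> keys g" by (rule keys_add)
  then show ?thesis
    by (simp add: meval_eq_sum[of "keys f \<union> keys g"] lookup_add distrib_right sum.distrib)
qed

lemma meval_mult: "meval (f * g) x = meval f x * meval g x"
proof (induction f rule: mpoly_induct)
  case (single m c)
  show ?case
    by (induction g rule: mpoly_induct)
      (auto simp: meval_single meval_add mult_single distrib_left monom_eval_add)
qed (auto simp: meval_add distrib_right)

lemma meval_one [simp]: "meval 1 x = 1"
  using meval_single[of 0 1 x] by simp

lemma meval_uminus: "meval (- f) x = - meval f x"
  using meval_add[of f "- f" x] by (simp add: eq_neg_iff_add_eq_0 add.commute)

lemma meval_diff: "meval (f - g) x = meval f x - meval g x"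
  using meval_add[of f "- g" x] by (simp add: meval_uminus)

lemma meval_translate: "meval (translate s f) x = meval f (s * x)"
  unfolding translate_def by (subst (1 2) meval_eq_sum[of "keys f"])
    (auto simp: keys_diag[THEN subsetD] monom_eval_mult mult_ac)

text \<open>Along the trajectory the monomial \<open>m\<close> is multiplied by
  \<open>exp (t * lin a m)\<close>. Expanding the exponentials, the Taylor coefficients are
  multiples of the values at \<open>p\<close> assumed to vanish.\<close>

lemma meval_trajectory_eq_zero:
  assumes "\<And>k. meval ((invariant_field a ^^ k) P) p = 0"
  shows "meval P (trajectory a p t) = 0"
proof -
  have key: "keys ((invariant_field a ^^ k) P) \<subseteq> keys P" for k
    by (auto simp: in_keys_iff lookup_invariant_field_funpow)
  have 0: "(\<Sum>m\<in>keys P. lookup P m * monom_eval p m * lin a m ^ k) = 0" for k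
    using assms[of k] unfolding meval_eq_sum[OF finite_keys key] lookup_invariant_field_funpow
    by (simp add: mult_ac)
  have "(\<lambda>k. \<Sum>m\<in>keys P. lookup P m * monom_eval p m * ((t * lin a m) ^ k /\<^sub>R fact k)) sums
    (\<Sum>m\<in>keys P. lookup P m * monom_eval p m * exp (t * lin a m))"
    by (intro sums_sum sums_mult exp_converges)
  moreover have "(\<Sum>m\<in>keys P. lookup P m * monom_eval p m * ((t * lin a m) ^ k /\<^sub>R fact k)) = 0" for k
  proof -
    have "(\<Sum>m\<in>keys P. lookup P m * monom_eval p m * ((t * lin a m) ^ k /\<^sub>R fact k)) =
      (t ^ k /\<^sub>R fact k) * (\<Sum>m\<in>keys P. lookup P m * monom_eval p m * lin a m ^ k)"
      unfolding sum_distrib_left by (intro sum.cong) (auto simp: power_mult_distrib scaleR_conv_of_real)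
    then show ?thesis by (simp add: 0)
  qed
  ultimately have "(\<Sum>m\<in>keys P. lookup P m * monom_eval p m * exp (t * lin a m)) = 0"
    by (simp add: sums_iff)
  moreover have "monom_eval (trajectory a p t) m = monom_eval p m * exp (t * lin a m)" for m
  proof -
    have "monom_eval (trajectory a p t) m = (\<Prod>i\<in>UNIV. exp (t * (a $ i * of_nat (lookup m i))) * p $ i ^ lookup m i)"
      unfolding monom_eval_def trajectory_def
      by (intro prod.cong) (auto simp: power_mult_distrib exp_of_nat_mult[symmetric] mult_ac)
    then show ?thesis by (simp add: prod.distrib exp_sum lin_def sum_distrib_left monom_eval_def)
  qed
  ultimately show ?thesis by (simp add: meval_eq_sum[OF finite_keys order_refl] mult.assoc)
qed

text \<open>Uniqueness of base \<open>M\<close> digits, which makes the Kronecker substitution below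
  injective on exponents.\<close>

lemma sum_digits_inj:
  fixes a b :: "nat \<Rightarrow> nat"
  assumes "(\<Sum>i<n. a i * M ^ i) = (\<Sum>i<n. b i * M ^ i)" "\<And>i. i < n \<Longrightarrow> a i < M" "\<And>i. i < n \<Longrightarrow> b i < M" "i < n"
  shows "a i = b i"
  using assms
proof (induction n arbitrary: a b i)
  case (Suc n)
  have eq: "(\<Sum>i<Suc n. c i * M ^ i) = c 0 + M * (\<Sum>i<n. c (Suc i) * M ^ i)" for c :: "nat \<Rightarrow> nat"
    by (subst sum.lessThan_Suc_shift) (simp add: sum_distrib_left mult_ac)
  have *: "a 0 + M * (\<Sum>i<n. a (Suc i) * M ^ i) = b 0 + M * (\<Sum>i<n. b (Suc i) * M ^ i)"
    using Suc.prems(1) unfolding eq .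
  have lt: "a 0 < M" "b 0 < M" using Suc.prems by auto
  have "a 0 = b 0" using arg_cong[OF *, of "\<lambda>x. x mod M"] lt by simp
  moreover have "(\<Sum>i<n. a (Suc i) * M ^ i) = (\<Sum>i<n. b (Suc i) * M ^ i)" using * \<open>a 0 = b 0\<close> lt by auto
  ultimately show ?case using Suc.IH[of "\<lambda>i. a (Suc i)" "\<lambda>i. b (Suc i)"] Suc.prems
    by (cases i) auto
qed simp

text \<open>Kronecker substitution: for large \<open>M\<close>, the curve \<open>t \<mapsto> (t ^ M ^ \<iota> i)\<^sub>i\<close> separates the monomials
  of a given polynomial.\<close>

lemma exists_common_nonzero:
  fixes F :: "('n::finite) mpoly set"
  assumes "finite F" "0 \<notin> F"
  obtains x where "x \<in> carrier torus" "\<And>f. f \<in> F \<Longrightarrow> meval f x \<noteq> 0"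
proof -
  obtain \<iota> :: "'n \<Rightarrow> nat" where \<iota>: "bij_betw \<iota> UNIV {..<CARD('n)}"
    using ex_bij_betw_finite_nat[OF finite[of "UNIV :: 'n set"]] by (metis atLeast0LessThan)
  define E where "E = (\<Union>f\<in>F. \<Union>m\<in>keys f. range (lookup m))"
  have "finite E" unfolding E_def using assms by auto
  then obtain M where M: "\<And>e. e \<in> E \<Longrightarrow> e < M" by (meson finite_nat_set_iff_bounded)
  define w where "w m = (\<Sum>i\<in>UNIV. lookup m i * M ^ \<iota> i)" for m :: "'n \<Rightarrow>\<^sub>0 nat"
  have w_alt: "w m = (\<Sum>k<CARD('n). lookup m (inv_into UNIV \<iota> k) * M ^ k)" for m
    unfolding w_def by (rule sum.reindex_bij_witness[of _ "inv_into UNIV \<iota>" \<iota>])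
      (use \<iota> in \<open>auto simp: bij_betw_def f_inv_into_f\<close>)
  have winj: "m = m'" if "f \<in> F" "m \<in> keys f" "m' \<in> keys f" "w m = w m'" for f m m'
  proof (rule poly_mapping_eqI)
    fix i
    have "\<iota> i < CARD('n)" using \<iota> by (auto simp: bij_betw_def)
    moreover have "lookup m j < M" for j by (rule M, unfold E_def, use that(1,2) in blast)
    moreover have "lookup m' j < M" for j by (rule M, unfold E_def, use that(1,3) in blast)
    ultimately have "lookup m (inv_into UNIV \<iota> (\<iota> i)) = lookup m' (inv_into UNIV \<iota> (\<iota> i))"
      by (intro sum_digits_inj[OF that(4)[unfolded w_alt]])
    then show "lookup m i = lookup m' i" using \<iota> by (simp add: bij_betw_def)
  qed
  define \<kappa> where "\<kappa> f = (\<Sum>m\<in>keys f. Polynomial.monom (lookup f m) (w m))" for f :: "'n mpoly"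
  have \<kappa>0: "\<kappa> f \<noteq> 0" if f: "f \<in> F" for f
  proof -
    have "f \<noteq> 0" using f assms by auto
    then obtain m where m: "m \<in> keys f" by (metis keys_eq_empty equals0I)
    have "Polynomial.coeff (\<kappa> f) (w m) = (\<Sum>m'\<in>keys f. if m' = m then lookup f m' else 0)"
      unfolding \<kappa>_def coeff_sum by (intro sum.cong) (use winj[OF f _ m] in auto)
    also have "\<dots> \<noteq> 0" using m by (simp add: in_keys_iff)
    finally show ?thesis by auto
  qed
  \<comment> \<open>The extra linear factor forces \<open>t\<close> to be nonzero, so that the point
    lies on the torus.\<close>
  define p where "p = Polynomial.monom 1 1 * (\<Prod>f\<in>F. \<kappa> f)"
  have "p \<noteq> 0" unfolding p_def using assms \<kappa>0 by (auto simp: Polynomial.monom_eq_0_iff)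
  then have "finite {t. poly p t = 0}" by (rule poly_roots_finite)
  then obtain t where t: "poly p t \<noteq> 0" using ex_new_if_finite[OF infinite_UNIV_char_0] by blast
  define x :: "complex ^ 'n" where "x = (\<chi> i. t ^ (M ^ \<iota> i))"
  have ev: "meval f x = poly (\<kappa> f) t" for f
  proof -
    have "monom_eval x m = t ^ w m" for m
      by (simp add: monom_eval_def x_def w_def power_sum mult.commute flip: power_mult)
    then show ?thesis by (simp add: meval_eq_sum[OF finite_keys order_refl] \<kappa>_def poly_sum poly_monom)
  qed
  have "t \<noteq> 0" using t by (auto simp: p_def poly_monom)
  then have "x \<in> carrier torus" by (simp add: torus_def x_def)
  moreover have "meval f x \<noteq> 0" if "f \<in> F" for f using t assms that unfolding ev p_def
    by (auto simp: poly_prod)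
  ultimately show ?thesis using that by blast
qed

text \<open>Nonzero factors have a common point of nonvanishing, where the product does not vanish
  either.\<close>

lemma mpoly_mult_eq_0_iff: "f * g = 0 \<longleftrightarrow> f = 0 \<or> g = 0" for f g :: "('n::finite) mpoly"
proof (cases "f = 0 \<or> g = 0")
  case False
  obtain x where "\<And>h. h \<in> {f, g} \<Longrightarrow> meval h x \<noteq> 0"
    by (rule exists_common_nonzero[of "{f, g}"]) (use False in auto)
  then have "meval (f * g) x \<noteq> 0" by (simp add: meval_mult)
  then show ?thesis using False by auto
qed auto

text \<open>\<open>box_polys B 0\<close> is the polynomial ring in the variables \<open>B\<close>, which serves as the ring of scalars.\<close>

definition box_polys :: "'n set \<Rightarrow> nat \<Rightarrow> 'n mpoly set" where
  "box_polys B N = {f. \<forall>m\<in>keys f. \<forall>i. i \<notin> B \<longrightarrow> lookup m i \<le> N}"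

lemma box_polys_mult: "f \<in> box_polys B M \<Longrightarrow> g \<in> box_polys B N \<Longrightarrow> f * g \<in> box_polys B (M + N)"
  unfolding box_polys_def using keys_mult[of f g] by (fastforce simp: lookup_add intro: add_mono)

lemma box_polys_add: "f \<in> box_polys B N \<Longrightarrow> g \<in> box_polys B N \<Longrightarrow> f + g \<in> box_polys B N"
  unfolding box_polys_def using keys_add[of f g] by blast

lemma box_polys_uminus: "f \<in> box_polys B N \<Longrightarrow> - f \<in> box_polys B N"
  unfolding box_polys_def by (auto simp: in_keys_iff)

lemma box_polys_zero: "0 \<in> box_polys B N" and box_polys_one: "1 \<in> box_polys B N"
  by (auto simp: box_polys_def lookup_one when_def in_keys_iff)

lemma box_polys_mono: "M \<le> N \<Longrightarrow> A \<subseteq> B \<Longrightarrow> box_polys A M \<subseteq> box_polys B N"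
  unfolding box_polys_def by (auto intro: order_trans)

lemma box_polys_single: "(\<And>i. i \<notin> B \<Longrightarrow> lookup m i \<le> N) \<Longrightarrow> single m c \<in> box_polys B N"
  by (auto simp: box_polys_def in_keys_iff lookup_single when_def split: if_splits)

lemma box_polys_diag: "f \<in> box_polys B N \<Longrightarrow> diag \<phi> f \<in> box_polys B N"
  unfolding box_polys_def using keys_diag by blast

lemma box_polys_diag_iff: assumes "\<And>m. \<phi> m \<noteq> 0" shows "diag \<phi> f \<in> box_polys B N \<longleftrightarrow> f \<in> box_polys B N"
proof -
  have "keys (diag \<phi> f) = keys f" using assms by (auto simp: in_keys_iff)
  then show ?thesis by (simp add: box_polys_def)
qed

lemma box_polys_sum: "(\<And>i. i \<in> A \<Longrightarrow> f i \<in> box_polys B N) \<Longrightarrow> sum f A \<in> box_polys B N"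
  by (induction A rule: infinite_finite_induct) (auto simp: box_polys_zero box_polys_add)

interpretation coords: subdomain "box_polys (B :: ('n::finite) set) 0" for B
  by unfold_locales (use box_polys_mult[of _ B 0 _ 0] in
    \<open>auto simp: box_polys_zero box_polys_one box_polys_add box_polys_uminus mpoly_mult_eq_0_iff\<close>)

lemma box_polys_submod: "coords.submod B (box_polys B N)"
  using box_polys_mult[of _ B 0 _ N] by (auto simp: coords.submod_def box_polys_zero box_polys_add)

text \<open>Exponents of monomials spanning \<open>box_polys B N\<close> over the scalars. Their
  number is where the codimension \<open>card (- B)\<close> enters.\<close>

definition box_monomials :: "'n set \<Rightarrow> nat \<Rightarrow> ('n \<Rightarrow>\<^sub>0 nat) set" where
  "box_monomials B N = {m. \<forall>i. if i \<in> B then lookup m i = 0 else lookup m i \<le> N}"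

lemma card_box_monomials:
  fixes B :: "('n::finite) set"
  shows "finite (box_monomials B N)" "card (box_monomials B N) \<le> (N + 1) ^ card (- B)"
proof -
  let ?T = "(- B) \<rightarrow>\<^sub>E {..N}"
  have inj: "inj_on (\<lambda>m. restrict (lookup m) (- B)) (box_monomials B N)"
  proof (rule inj_onI, rule poly_mapping_eqI)
    fix m m' :: "'n \<Rightarrow>\<^sub>0 nat" and i
    assume *: "m \<in> box_monomials B N" "m' \<in> box_monomials B N" "restrict (lookup m) (- B) = restrict (lookup m') (- B)"
    show "lookup m i = lookup m' i"
      using *(1,2) fun_cong[OF *(3), of i] by (cases "i \<in> B") (simp_all add: box_monomials_def)
  qed
  have sub: "(\<lambda>m. restrict (lookup m) (- B)) ` box_monomials B N \<subseteq> ?T"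
    by (auto simp: box_monomials_def)
  have fin: "finite ?T" by (intro finite_PiE) auto
  show "finite (box_monomials B N)" using inj_on_finite[OF inj sub fin] .
  show "card (box_monomials B N) \<le> (N + 1) ^ card (- B)"
    using card_inj_on_le[OF inj sub fin] by (simp add: card_PiE)
qed

definition restrict_exp :: "'n::finite set \<Rightarrow> ('n \<Rightarrow>\<^sub>0 nat) \<Rightarrow> ('n \<Rightarrow>\<^sub>0 nat)" where
  "restrict_exp B m = Abs_poly_mapping (\<lambda>i. if i \<in> B then lookup m i else 0)"

lemma lookup_restrict_exp: "lookup (restrict_exp B m) i = (if i \<in> B then lookup m i else 0)"
  by (simp add: restrict_exp_def)

lemma restrict_exp_split: "restrict_exp B m + restrict_exp (- B) m = m"
  by (rule poly_mapping_eqI) (simp add: lookup_add lookup_restrict_exp)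

text \<open>Grouping monomials by their part outside \<open>B\<close> collects the scalar
  coefficients \<open>r e\<close>.\<close>

lemma box_polys_subset_sspan:
  fixes B :: "('n::finite) set"
  shows "box_polys B N \<subseteq> coords.sspan B ((\<lambda>m. single m 1) ` box_monomials B N)"
proof
  fix f assume f: "f \<in> box_polys B N"
  define r where "r e = (\<Sum>m\<in>{m\<in>keys f. restrict_exp (- B) m = e}. single (restrict_exp B m) (lookup f m))" for e
  have rS: "r e \<in> box_polys B 0" for e unfolding r_def
    by (intro box_polys_sum box_polys_single) (auto simp: lookup_restrict_exp)
  have "f = (\<Sum>m\<in>keys f. single (restrict_exp B m) (lookup f m) * single (restrict_exp (- B) m) 1)"
    by (subst mpoly_eq_sum) (simp add: mult_single restrict_exp_split)
  also have "\<dots> = (\<Sum>e\<in>box_monomials B N. \<Sum>m\<in>{m\<in>keys f. restrict_exp (- B) m = e}.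
      single (restrict_exp B m) (lookup f m) * single (restrict_exp (- B) m) 1)"
    by (rule sum.group[symmetric, OF finite_keys card_box_monomials(1)])
      (use f in \<open>auto simp: box_monomials_def box_polys_def lookup_restrict_exp\<close>)
  also have "\<dots> = (\<Sum>e\<in>box_monomials B N. r e * single e 1)"
    by (simp add: r_def sum_distrib_right)
  \<comment> \<open>\<open>sspan\<close> is indexed by ring elements, so the coefficients are
    carried from exponents to monomials along an injection.\<close>
  also have "\<dots> = (\<Sum>x\<in>(\<lambda>m. single m 1) ` box_monomials B N. r (inv_into (box_monomials B N) (\<lambda>m. single m 1) x) * x)"
  proof -
    have inj: "inj_on (\<lambda>m. single m (1::complex)) (box_monomials B N)"
      by (rule inj_onI) (metis lookup_single_eq lookup_single_not_eq one_neq_zero)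
    show ?thesis by (subst sum.reindex[OF inj]) (auto simp: inv_into_f_f[OF inj])
  qed
  finally show "f \<in> coords.sspan B ((\<lambda>m. single m 1) ` box_monomials B N)"
    unfolding coords.sspan_def using rS
    by (intro CollectI exI[of _ "\<lambda>x. r (inv_into (box_monomials B N) (\<lambda>m. single m 1) x)"]) auto
qed

section \<open>Algebraically independent coordinates\<close>

text \<open>Algebraic independence of the coordinates in \<open>B\<close> modulo \<open>P\<close>:
  no nonzero scalar lies in \<open>P\<close>.\<close>

definition indep_coords :: "('n::finite) set \<Rightarrow> 'n mpoly set \<Rightarrow> bool" where
  "indep_coords B P \<longleftrightarrow> box_polys B 0 \<inter> P \<subseteq> {0}"

lemma mvar_power: "mvar j ^ k = single (single j k) 1"
  by (induction k) (auto simp: mvar_def mult_single single_add[symmetric])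

text \<open>Sorting the monomials by their exponent at \<open>j\<close> turns \<open>f\<close> into
  a polynomial in one variable over the scalars. The leading coefficient \<open>b E\<close> allows
  pseudo-division by \<open>f\<close>.\<close>

lemma univariate_decomposition:
  fixes f :: "('n::finite) mpoly"
  assumes f: "f \<in> box_polys (insert j B) 0" "f \<noteq> 0" and j: "j \<notin> B"
  obtains b E where "\<And>i. b i \<in> box_polys B 0" "f = (\<Sum>i\<le>E. b i * mvar j ^ i)" "b E \<noteq> 0"
    "\<And>i. (\<And>m. m \<in> keys f \<Longrightarrow> lookup m j \<noteq> i) \<Longrightarrow> b i = 0"
    "E = Max ((\<lambda>m. lookup m j) ` keys f)"
proof -
  define E where "E = Max ((\<lambda>m. lookup m j) ` keys f)"
  have ne: "keys f \<noteq> {}" using f by simp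
  then have "E \<in> (\<lambda>m. lookup m j) ` keys f" unfolding E_def by (intro Max_in) auto
  then obtain m0 where m0: "m0 \<in> keys f" "lookup m0 j = E" by auto
  define b where "b i = (\<Sum>m\<in>{m\<in>keys f. lookup m j = i}. single (restrict_exp (- {j}) m) (lookup f m))" for i
  have split: "restrict_exp (- {j}) m + single j (lookup m j) = m" for m
    by (rule poly_mapping_eqI) (auto simp: lookup_add lookup_restrict_exp lookup_single when_def)
  have "b i \<in> box_polys B 0" for i unfolding b_def
    using f(1) by (intro box_polys_sum box_polys_single) (auto simp: lookup_restrict_exp box_polys_def)
  moreover have "f = (\<Sum>i\<le>E. b i * mvar j ^ i)"
  proof -
    have "(\<Sum>i\<le>E. b i * mvar j ^ i) = (\<Sum>i\<le>E. \<Sum>m\<in>{m\<in>keys f. lookup m j = i}. single m (lookup f m))"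
      unfolding b_def sum_distrib_right mvar_power mult_single
      by (intro sum.cong refl) (auto simp: split)
    also have "\<dots> = (\<Sum>m\<in>keys f. single m (lookup f m))"
      by (rule sum.group) (auto simp: E_def)
    finally show ?thesis using mpoly_eq_sum[of f] by simp
  qed
  moreover have "b E \<noteq> 0"
  proof -
    \<comment> \<open>Among monomials with exponent \<open>E\<close> at \<open>j\<close> the
      remaining exponents determine the monomial, so nothing cancels.\<close>
    have "lookup (b E) (restrict_exp (- {j}) m0) = (\<Sum>m\<in>{m\<in>keys f. lookup m j = E}. if m = m0 then lookup f m0 else 0)"
      unfolding b_def lookup_sum
    proof (intro sum.cong refl)
      fix m assume "m \<in> {m \<in> keys f. lookup m j = E}"
      then have "restrict_exp (- {j}) m = restrict_exp (- {j}) m0 \<longleftrightarrow> m = m0"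
        using split m0(2) by (metis (mono_tags, lifting) mem_Collect_eq)
      then show "lookup (single (restrict_exp (- {j}) m) (lookup f m)) (restrict_exp (- {j}) m0) =
         (if m = m0 then lookup f m0 else 0)" by (auto simp: lookup_single when_def)
    qed
    also have "\<dots> = lookup f m0" using m0 by simp
    finally show ?thesis using m0 by (auto simp: in_keys_iff)
  qed
  moreover have "b i = 0" if "\<And>m. m \<in> keys f \<Longrightarrow> lookup m j \<noteq> i" for i
    unfolding b_def using that by (intro sum.neutral) auto
  ultimately show ?thesis using that E_def by blast
qed

lemma ideal_prod_congruence:
  assumes "ideal I" "finite A" "\<And>j. j \<in> A \<Longrightarrow> u j - v j \<in> I"
  shows "prod u A - prod v A \<in> I"
  using assms(2,3)
proof (induction A rule: finite_induct)
  case empty show ?case using assms by (simp add: ideal_zero)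
next
  case (insert a A)
  have "prod u (insert a A) - prod v (insert a A) = u a * (prod u A - prod v A) + (u a - v a) * prod v A"
    using insert by (simp add: algebra_simps)
  moreover have "u a * (prod u A - prod v A) \<in> I" "(u a - v a) * prod v A \<in> I"
    using insert assms(1) by (auto intro: ideal_mult ideal_mult_right)
  ultimately show ?case using ideal_add[OF assms(1)] by metis
qed

lemma single_restrict_exp: "single (restrict_exp A m) 1 = (\<Prod>j\<in>A. mvar j ^ lookup m j)"
proof -
  have 1: "(\<Prod>j\<in>A. single (a j) 1) = single (\<Sum>j\<in>A. a j) (1::complex)" for a :: "'a \<Rightarrow> 'a \<Rightarrow>\<^sub>0 nat"
    by (induction A rule: infinite_finite_induct) (auto simp: mult_single)
  have "(\<Sum>j\<in>A. single j (lookup m j)) = restrict_exp A m"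
    by (rule poly_mapping_eqI) (auto simp: lookup_sum lookup_single when_def lookup_restrict_exp)
  then show ?thesis by (simp add: mvar_power 1)
qed

text \<open>Each variable outside \<open>B\<close> satisfies an equation over the scalars modulo
  \<open>I\<close>. After inverting the nonzero scalars, bounded powers of each variable therefore
  suffice, and the quotient is finite-dimensional.\<close>

lemma algebraic_imp_torsion_span:
  fixes I :: "('n::finite) mpoly set"
  assumes I: "ideal I" and alg: "\<And>j. j \<notin> B \<Longrightarrow> \<exists>f\<in>I. f \<in> box_polys (insert j B) 0 \<and> f \<noteq> 0"
  obtains N where "\<And>g. g \<in> coords.sat B (box_polys B N + I)"
proof -
  have "\<exists>E. \<forall>e. mvar j ^ e \<in> coords.sat B ((box_polys (insert j B) 0 \<inter> box_polys B E) + I)" if j: "j \<notin> B" for j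
  proof -
    obtain f where f: "f \<in> I" "f \<in> box_polys (insert j B) 0" "f \<noteq> 0" using alg[OF j] by blast
    obtain b E where b: "\<And>i. b i \<in> box_polys B 0" "f = (\<Sum>i\<le>E. b i * mvar j ^ i)" "b E \<noteq> 0"
      by (rule univariate_decomposition[OF f(2,3) j]) blast
    \<comment> \<open>Polynomials of degree at most \<open>E\<close> in the single variable
      \<open>j\<close> over the scalars.\<close>
    define Z where "Z = box_polys (insert j B) 0 \<inter> box_polys B E"
    have "coords.submod B (box_polys (insert j B) 0)"
      using box_polys_submod[of "insert j B" 0] box_polys_mono[OF order_refl subset_insertI[of B j], of 0]
      unfolding coords.submod_def by blast
    then have Zs: "coords.submod B Z" using box_polys_submod[of B E] by (auto simp: Z_def coords.submod_def)
    have sub: "coords.submod B (coords.sat B (Z + I))"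
      by (intro coords.submod_sat coords.submod_plus Zs coords.submod_ideal I)
    have Isub: "I \<subseteq> coords.sat B (Z + I)"
      using coords.sat_superset[of "Z + I" B] set_zero_plus2[of Z I] Zs by (auto simp: coords.submod_def)
    have Zsub: "Z \<subseteq> coords.sat B (Z + I)"
      using coords.sat_superset[of "Z + I" B] set_zero_plus2[of I Z] I by (auto simp: ideal_zero add.commute)
    have "mvar j ^ e \<in> coords.sat B (Z + I)" for e
    proof (induction e rule: less_induct)
      case (less e)
      show ?case
      proof (cases "e \<le> E")
        case True
        then have "mvar j ^ e \<in> Z" unfolding Z_def mvar_power
          by (auto intro!: box_polys_single simp: lookup_single when_def split: if_splits)
        then show ?thesis using Zsub by blast
      next
        case False
        \<comment> \<open>A shifted copy of the relation expresses \<open>b E * mvar j ^ e\<close>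
          through lower powers modulo \<open>I\<close>.\<close>
        have "mvar j ^ (e - E) * f = (\<Sum>i\<le>E. b i * mvar j ^ (i + (e - E)))"
          unfolding b(2) sum_distrib_left by (intro sum.cong) (auto simp: power_add mult_ac)
        also have "\<dots> = (\<Sum>i<E. b i * mvar j ^ (i + (e - E))) + b E * mvar j ^ e"
          using False by (simp add: lessThan_Suc_atMost[symmetric])
        finally have "b E * mvar j ^ e = mvar j ^ (e - E) * f + (\<Sum>i<E. - b i * mvar j ^ (i + (e - E)))"
          by (simp add: sum_negf)
        moreover have "mvar j ^ (e - E) * f \<in> coords.sat B (Z + I)" using Isub I f by (auto intro: ideal_mult)
        moreover have "(\<Sum>i<E. - b i * mvar j ^ (i + (e - E))) \<in> coords.sat B (Z + I)"
        proof (rule coords.submod_sum[OF sub])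
          fix i assume "i \<in> {..<E}"
          then have "mvar j ^ (i + (e - E)) \<in> coords.sat B (Z + I)" using False by (intro less) auto
          then show "- b i * mvar j ^ (i + (e - E)) \<in> coords.sat B (Z + I)"
            using sub box_polys_uminus[OF b(1)[of i]] unfolding coords.submod_def by blast
        qed
        ultimately have "b E * mvar j ^ e \<in> coords.sat B (Z + I)" using sub unfolding coords.submod_def by simp
        then show ?thesis by (rule coords.sat_cancel[OF b(1) b(3)])
      qed
    qed
    then show ?thesis unfolding Z_def by blast
  qed
  then obtain E where E: "\<And>j e. j \<notin> B \<Longrightarrow> mvar j ^ e \<in> coords.sat B ((box_polys (insert j B) 0 \<inter> box_polys B (E j)) + I)"
    by metis
  define N where "N = Max (range E)"
  have EN: "E j \<le> N" for j unfolding N_def by (intro Max_ge) auto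
  have sub: "coords.submod B (coords.sat B (box_polys B N + I))"
    by (intro coords.submod_sat coords.submod_plus box_polys_submod coords.submod_ideal I)
  have mon: "single (restrict_exp (- B) m) 1 \<in> coords.sat B (box_polys B N + I)" for m
  proof -
    have "\<exists>b z. b \<in> box_polys B 0 \<and> b \<noteq> 0 \<and> z \<in> box_polys (insert j B) 0 \<and> z \<in> box_polys B N \<and> b * mvar j ^ lookup m j - z \<in> I"
      if j: "j \<notin> B" for j
    proof -
      obtain b where b: "b \<in> box_polys B 0" "b \<noteq> 0"
        "b * mvar j ^ lookup m j \<in> (box_polys (insert j B) 0 \<inter> box_polys B (E j)) + I"
        using E[OF j, of "lookup m j"] unfolding coords.sat_def by blast
      from b(3) obtain z w where "b * mvar j ^ lookup m j = z + w" "z \<in> box_polys (insert j B) 0 \<inter> box_polys B (E j)" "w \<in> I"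
        by (rule set_plus_elim)
      then show ?thesis using b box_polys_mono[OF EN order_refl, of B j] by (intro exI[of _ b] exI[of _ z]) auto
    qed
    then obtain b z where bz: "\<And>j. j \<notin> B \<Longrightarrow> b j \<in> box_polys B 0 \<and> b j \<noteq> 0"
      "\<And>j. j \<notin> B \<Longrightarrow> z j \<in> box_polys (insert j B) 0 \<and> z j \<in> box_polys B N"
      "\<And>j. j \<notin> B \<Longrightarrow> b j * mvar j ^ lookup m j - z j \<in> I" by metis
    \<comment> \<open>Different factors involve different variables outside \<open>B\<close>, so the
      product stays in the box of side \<open>N\<close>; the degree bounds do not add up.\<close>
    have z: "prod z A \<in> box_polys (A \<union> B) 0 \<inter> box_polys B N" if "finite A" "A \<subseteq> - B" for A
      using that
    proof (induction A rule: finite_induct)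
      case empty show ?case by (simp add: box_polys_one)
    next
      case (insert j A)
      have "z j \<in> box_polys (insert j B) 0" "z j \<in> box_polys B N" using bz insert by auto
      moreover have "prod z A \<in> box_polys (A \<union> B) 0" "prod z A \<in> box_polys B N" using insert by auto
      ultimately have "z j * prod z A \<in> box_polys (insert j A \<union> B) 0 \<inter> box_polys B N"
        using keys_mult[of "z j" "prod z A"] \<open>j \<notin> A\<close> unfolding box_polys_def
        by (fastforce simp: lookup_add)
      then show ?case using insert by simp
    qed
    have "(\<Prod>j\<in>- B. b j * mvar j ^ lookup m j) - prod z (- B) \<in> I"
      by (rule ideal_prod_congruence) (auto simp: I bz)
    moreover have "prod z (- B) \<in> box_polys B N" using z[of "- B"] by auto
    ultimately have "prod z (- B) + ((\<Prod>j\<in>- B. b j * mvar j ^ lookup m j) - prod z (- B)) \<in> box_polys B N + I" by blast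
    then have "prod b (- B) * single (restrict_exp (- B) m) 1 \<in> box_polys B N + I"
      by (simp add: prod.distrib single_restrict_exp)
    moreover have "prod b (- B) \<in> box_polys B 0 \<and> prod b (- B) \<noteq> 0" by (intro coords.prod_S) (auto simp: bz)
    ultimately show ?thesis by (auto intro: coords.satI)
  qed
  have "g \<in> coords.sat B (box_polys B N + I)" for g
  proof (induction g rule: mpoly_induct)
    case zero show ?case using sub by (simp add: coords.submod_def)
  next
    case (add f g) then show ?case using sub by (simp add: coords.submod_def)
  next
    case (single m c)
    have "single m c = single (restrict_exp B m) c * single (restrict_exp (- B) m) 1"
      by (simp add: mult_single restrict_exp_split)
    moreover have "single (restrict_exp B m) c \<in> box_polys B 0"
      by (intro box_polys_single) (simp add: lookup_restrict_exp)
    ultimately show ?case using sub mon[of m] by (auto simp: coords.submod_def)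
  qed
  then show ?thesis using that by blast
qed

text \<open>Over the fraction field the quotient is finite-dimensional, so a nonzerodivisor is a
  unit there; \<open>w\<close> is an inverse of \<open>h\<close> up to the scalar
  \<open>b\<close>.\<close>

lemma algebraic_nonzerodivisor:
  fixes I :: "('n::finite) mpoly set"
  assumes I: "ideal I" and alg: "\<And>j. j \<notin> B \<Longrightarrow> \<exists>f\<in>I. f \<in> box_polys (insert j B) 0 \<and> f \<noteq> 0"
    and h: "\<And>g. h * g \<in> I \<Longrightarrow> g \<in> I"
  obtains b w where "b \<in> box_polys B 0" "b \<noteq> 0" "b - h * w \<in> I"
proof -
  obtain N where N: "\<And>g. g \<in> coords.sat B (box_polys B N + I)"
    using algebraic_imp_torsion_span[OF I alg] by blast
  have "box_polys B N + I \<subseteq> coords.sspan B ((\<lambda>m. single m 1) ` box_monomials B N) + I"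
    by (intro set_plus_mono2 box_polys_subset_sspan order_refl)
  then have "g \<in> coords.sat B (coords.sspan B ((\<lambda>m. single m 1) ` box_monomials B N) + I)" for g
    using N coords.sat_mono by blast
  moreover have "finite ((\<lambda>m. single m (1::complex)) ` box_monomials B N)"
    by (intro finite_imageI card_box_monomials)
  ultimately obtain b w where "b \<in> box_polys B 0" "b \<noteq> 0" "b - h * w \<in> I"
    using coords.nonzerodivisor_divides_scalar[OF _ I _ h] by metis
  then show ?thesis by (rule that)
qed

text \<open>An element \<open>g\<close> of \<open>P\<close> outside \<open>Q\<close> is a
  nonzerodivisor modulo \<open>Q\<close>, hence divides a nonzero scalar modulo \<open>Q\<close>.
  That scalar lies in \<open>P\<close>, against the independence of \<open>B\<close>.\<close>

lemma prime_subset_eq: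
  fixes P Q :: "('n::finite) mpoly set"
  assumes P: "prime_ideal P" and Q: "prime_ideal Q" and "Q \<subseteq> P" and B: "indep_coords B P"
    and alg: "\<And>j. j \<notin> B \<Longrightarrow> \<not> indep_coords (insert j B) Q"
  shows "P = Q"
proof (rule ccontr)
  assume "P \<noteq> Q"
  then obtain g where g: "g \<in> P" "g \<notin> Q" using \<open>Q \<subseteq> P\<close> by blast
  obtain b w where b: "b \<in> box_polys B 0" "b \<noteq> 0" "b - g * w \<in> Q"
  proof (rule algebraic_nonzerodivisor)
    show "ideal Q" by (rule prime_ideal_ideal[OF Q])
    show "\<exists>f\<in>Q. f \<in> box_polys (insert j B) 0 \<and> f \<noteq> 0" if "j \<notin> B" for j
      using alg[OF that] by (auto simp: indep_coords_def)
    show "g * h \<in> Q \<Longrightarrow> h \<in> Q" for h using g prime_ideal_mult_iff[OF Q] by blast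
  qed blast
  have "b - g * w \<in> P" "g * w \<in> P" using b g \<open>Q \<subseteq> P\<close> P by (auto simp: prime_ideal_mult_iff)
  then have "b \<in> P" using ideal_add[OF prime_ideal_ideal[OF P]] by (metis diff_add_cancel)
  then show False using b B by (auto simp: indep_coords_def)
qed

text \<open>For prime \<open>P\<close> this is the transcendence degree of the fraction field of the
  quotient: the coordinates generate that field, so a transcendence basis can be chosen among
  them.\<close>

definition trdeg :: "('n::finite) mpoly set \<Rightarrow> nat" where
  "trdeg P = Max (card ` {B. indep_coords B P})"

lemma indep_coords_empty:
  fixes P :: "('n::finite) mpoly set"
  assumes "prime_ideal P" shows "indep_coords {} P"
proof -
  have "f = 0" if f: "f \<in> box_polys {} 0" "f \<in> P" for f
  proof (rule ccontr)
    assume nz: "f \<noteq> 0"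
    have "m = 0" if "m \<in> keys f" for m using f(1) that by (intro poly_mapping_eqI) (auto simp: box_polys_def)
    then have "keys f \<subseteq> {0}" by blast
    then have fk: "keys f = {0}" using nz by (simp add: subset_singleton_iff)
    have feq: "f = single 0 (lookup f 0)" using mpoly_eq_sum[of f] unfolding fk by simp
    have "lookup f 0 \<noteq> 0" using fk by (metis in_keys_iff singletonI)
    then have "single 0 (inverse (lookup f 0)) * single 0 (lookup f 0) = 1" by (simp add: mult_single)
    then have "single 0 (inverse (lookup f 0)) * f = 1" using feq by metis
    moreover have "single 0 (inverse (lookup f 0)) * f \<in> P" using f assms by (simp add: prime_ideal_mult_iff)
    ultimately show False using prime_ideal_one[OF assms] by simp
  qed
  then show ?thesis by (auto simp: indep_coords_def)
qed

lemma trdeg_ge: "indep_coords B P \<Longrightarrow> card B \<le> trdeg P"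
  unfolding trdeg_def by (intro Max_ge) auto

lemma trdeg_witness:
  assumes "prime_ideal P" obtains B where "indep_coords B P" "card B = trdeg P"
proof -
  have "trdeg P \<in> card ` {B. indep_coords B P}"
    unfolding trdeg_def using indep_coords_empty[OF assms] by (intro Max_in) auto
  then show ?thesis using that by auto
qed

lemma trdeg_witness_maximal:
  assumes "indep_coords B P" "card B = trdeg P" "j \<notin> B" shows "\<not> indep_coords (insert j B) P"
  using trdeg_ge[of "insert j B" P] assms by auto

lemma indep_coords_antimono: "Q \<subseteq> P \<Longrightarrow> indep_coords B P \<Longrightarrow> indep_coords B Q"
  by (auto simp: indep_coords_def)

lemma trdeg_mono:
  assumes "prime_ideal P" "Q \<subseteq> P" shows "trdeg P \<le> trdeg Q"
  using trdeg_witness[OF assms(1)] trdeg_ge indep_coords_antimono[OF assms(2)] by metis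

text \<open>If the degrees agreed, a largest independent set for \<open>P\<close> would also be
  largest for \<open>Q\<close>, and \<open>prime_subset_eq\<close> would apply.\<close>

lemma trdeg_strict:
  assumes P: "prime_ideal P" and Q: "prime_ideal Q" and sub: "Q \<subset> P"
  shows "trdeg P < trdeg Q"
proof (rule ccontr)
  assume "\<not> ?thesis"
  then have eq: "trdeg P = trdeg Q" using trdeg_mono[OF P, of Q] sub by (simp add: psubset_eq)
  obtain B where B: "indep_coords B P" "card B = trdeg P" by (rule trdeg_witness[OF P])
  have "P = Q"
    by (rule prime_subset_eq[OF P Q _ B(1) trdeg_witness_maximal])
      (use sub B eq indep_coords_antimono[of Q P] in auto)
  then show False using sub by simp
qed

lemma trdeg_le:
  fixes P :: "('n::finite) mpoly set"
  assumes "prime_ideal P" shows "trdeg P \<le> CARD('n)"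
  using trdeg_witness[OF assms] by (metis card_mono finite subset_UNIV)

lemma trdeg_less:
  fixes P :: "('n::finite) mpoly set"
  assumes "prime_ideal P" "f \<in> P" "f \<noteq> 0" shows "trdeg P < CARD('n)"
proof -
  obtain B where B: "indep_coords B P" "card B = trdeg P" by (rule trdeg_witness[OF assms(1)])
  have "B \<noteq> UNIV" using B assms by (auto simp: indep_coords_def box_polys_def)
  then have "card B < card (UNIV :: 'n set)" by (intro psubset_card_mono) auto
  then show ?thesis using B by simp
qed

text \<open>A relation for \<open>x\<^sub>j\<close> of least degree is separable, since the characteristic is zero.\<close>

lemma separable_relation:
  fixes P :: "('n::finite) mpoly set"
  assumes P: "prime_ideal P" and B: "indep_coords B P" and j: "j \<notin> B"
    and alg: "\<not> indep_coords (insert j B) P" and xj: "mvar j \<notin> P"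
  obtains q where "q \<in> P" "q \<in> box_polys (insert j B) 0" "invariant_field (axis j 1) q \<notin> P"
proof -
  define M where "M = {f. f \<in> P \<and> f \<in> box_polys (insert j B) 0 \<and> f \<noteq> 0}"
  define deg where "deg f = Max ((\<lambda>m. lookup m j) ` keys f)" for f :: "'n mpoly"
  have "\<exists>f. f \<in> M" using alg by (auto simp: M_def indep_coords_def)
  then obtain q where q: "q \<in> M" and qmin: "\<And>f. f \<in> M \<Longrightarrow> deg q \<le> deg f"
    using ex_has_least_nat[of "\<lambda>f. f \<in> M" _ deg] by blast
  have qP: "q \<in> P" "q \<in> box_polys (insert j B) 0" "q \<noteq> 0" using q by (auto simp: M_def)
  have "invariant_field (axis j 1) q \<notin> P"
  proof
    assume D: "invariant_field (axis j 1) q \<in> P"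
    \<comment> \<open>In this combination of \<open>q\<close> and its derivative the terms of top
      degree in \<open>j\<close> cancel. Minimality makes it zero, so all monomials of
      \<open>q\<close> have the same exponent at \<open>j\<close>.\<close>
    define f where "f = diag (\<lambda>m. of_nat (deg q) - of_nat (lookup m j)) q"
    have const: "single 0 c * g = diag (\<lambda>_. c) g" for c and g :: "'n mpoly"
      by (induction g rule: mpoly_induct) (auto simp: diag_add diag_single mult_single distrib_left)
    have "f = single 0 (of_nat (deg q)) * q - invariant_field (axis j 1) q"
      unfolding const by (rule poly_mapping_eqI)
        (simp add: f_def invariant_field_eq lookup_minus lin_axis algebra_simps)
    then have fP: "f \<in> P" using D qP P by (auto intro!: ideal_diff ideal_mult prime_ideal_ideal)
    have fb: "f \<in> box_polys (insert j B) 0" unfolding f_def by (rule box_polys_diag[OF qP(2)])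
    have degq: "lookup m j \<le> deg q" if "m \<in> keys q" for m unfolding deg_def using that by auto
    have "f = 0"
    proof (rule ccontr)
      assume "f \<noteq> 0"
      then have "deg q \<le> deg f" using fP fb by (intro qmin) (auto simp: M_def)
      moreover have "deg f \<in> (\<lambda>m. lookup m j) ` keys f" unfolding deg_def using \<open>f \<noteq> 0\<close> by (intro Max_in) auto
      then obtain m where m: "m \<in> keys f" "deg f = lookup m j" by auto
      then have "m \<in> keys q" "lookup m j \<noteq> deg q" by (auto simp: f_def in_keys_iff)
      ultimately show False using degq[of m] m by auto
    qed
    then have all: "lookup m j = deg q" if "m \<in> keys q" for m
    proof -
      have "lookup f m = 0" using \<open>f = 0\<close> by simp
      then show ?thesis using that by (simp add: f_def in_keys_iff)
    qed
    \<comment> \<open>So \<open>q\<close> is a scalar times a power of the variable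
      \<open>j\<close>. By primality the scalar lies in \<open>P\<close>, which independence
      forbids.\<close>
    obtain b E where b: "\<And>i. b i \<in> box_polys B 0" "q = (\<Sum>i\<le>E. b i * mvar j ^ i)" "b E \<noteq> 0"
      "\<And>i. (\<And>m. m \<in> keys q \<Longrightarrow> lookup m j \<noteq> i) \<Longrightarrow> b i = 0" "E = Max ((\<lambda>m. lookup m j) ` keys q)"
      by (rule univariate_decomposition[OF qP(2,3) j]) blast
    have "E = deg q" using b(5) by (simp add: deg_def)
    have "b i = 0" if "i \<noteq> E" for i by (rule b(4)) (use all \<open>E = deg q\<close> that in metis)
    then have "(\<Sum>i\<le>E. b i * mvar j ^ i) = (\<Sum>i\<le>E. if i = E then b E * mvar j ^ E else 0)"
      by (intro sum.cong) auto
    then have "q = b E * mvar j ^ E" using b(2) by simp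
    then have "b E * mvar j ^ E \<in> P" using qP by simp
    then have "b E \<in> P" using xj prime_ideal_mult_iff[OF P] prime_ideal_power_iff[OF P] by blast
    then show False using B b(1)[of E] b(3) unfolding indep_coords_def by blast
  qed
  then show ?thesis using that qP by blast
qed

section \<open>Derivations and filtrations\<close>

locale commuting_derivations =
  fixes D :: "'i \<Rightarrow> 'a::comm_ring_1 \<Rightarrow> 'a" and J :: "'i set" and P :: "'a set"
  assumes D_add: "D i (f + g) = D i f + D i g"
    and D_mult: "D i (f * g) = D i f * g + f * D i g"
    and prime: "prime_ideal P"
    and of_nat_notin: "of_nat (Suc k) \<notin> P"
begin

text \<open>Membership in \<open>filt w m\<close> is vanishing along \<open>P\<close> to order \<open>m\<close>, a derivation \<open>D i\<close> counting
  with weight \<open>w i\<close>.\<close>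

definition filt :: "('i \<Rightarrow> nat) \<Rightarrow> nat \<Rightarrow> 'a set" where
  "filt w m = {f. \<forall>u\<in>lists J. sum_list (map w u) < m \<longrightarrow> fold D u f \<in> P}"

lemma D_zero: "D i 0 = 0"
  using D_add[of i 0 0] by simp

lemma D_uminus: "D i (- f) = - D i f"
  using D_add[of i f "- f"] by (simp add: D_zero eq_neg_iff_add_eq_0 add.commute)

lemma D_diff: "D i (f - g) = D i f - D i g"
  using D_add[of i f "- g"] by (simp add: D_uminus)

lemma fold_D_zero: "fold D u 0 = 0"
  by (induction u) (auto simp: D_zero)

lemma fold_D_add: "fold D u (f + g) = fold D u f + fold D u g"
  by (induction u arbitrary: f g) (auto simp: D_add)

lemma fold_D_diff: "fold D u (f - g) = fold D u f - fold D u g"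
  by (induction u arbitrary: f g) (auto simp: D_diff)

lemma fold_D_sum: "fold D u (sum f A) = (\<Sum>x\<in>A. fold D u (f x))"
  by (induction A rule: infinite_finite_induct) (auto simp: fold_D_zero fold_D_add)

lemma P_ideal: "ideal P"
  by (rule prime_ideal_ideal[OF prime])

text \<open>Peels off the derivation applied first, so that the Leibniz rule can be used by
  induction on the order. For \<open>w i \<ge> m\<close> the subtraction gives 0 and the condition
  on \<open>D i f\<close> is void.\<close>

lemma filt_iff: "f \<in> filt w m \<longleftrightarrow> (0 < m \<longrightarrow> f \<in> P) \<and> (\<forall>i\<in>J. D i f \<in> filt w (m - w i))"
proof
  assume f: "f \<in> filt w m"
  have "f \<in> P" if "0 < m"
    using f that bspec[of "lists J" "\<lambda>u. sum_list (map w u) < m \<longrightarrow> fold D u f \<in> P" "[]"] by (simp add: filt_def)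
  moreover have "D i f \<in> filt w (m - w i)" if "i \<in> J" for i
    unfolding filt_def
  proof (intro CollectI ballI impI)
    fix u assume "u \<in> lists J" "sum_list (map w u) < m - w i"
    then have "i # u \<in> lists J" "sum_list (map w (i # u)) < m" using that by auto
    then have "fold D (i # u) f \<in> P" using f unfolding filt_def by blast
    then show "fold D u (D i f) \<in> P" by simp
  qed
  ultimately show "(0 < m \<longrightarrow> f \<in> P) \<and> (\<forall>i\<in>J. D i f \<in> filt w (m - w i))" by blast
next
  assume *: "(0 < m \<longrightarrow> f \<in> P) \<and> (\<forall>i\<in>J. D i f \<in> filt w (m - w i))"
  show "f \<in> filt w m" unfolding filt_def
  proof (intro CollectI ballI impI)
    fix u assume u: "u \<in> lists J" "sum_list (map w u) < m"
    show "fold D u f \<in> P"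
    proof (cases u)
      case Nil then show ?thesis using * u by auto
    next
      case (Cons i v)
      then have "D i f \<in> filt w (m - w i)" "v \<in> lists J" "sum_list (map w v) < m - w i" using * u by auto
      then show ?thesis by (simp add: Cons filt_def)
    qed
  qed
qed

lemma filt_0: "filt w 0 = UNIV"
  by (auto simp: filt_def)

lemma filt_antimono:
  assumes "m \<le> m'" shows "filt w m' \<subseteq> filt w m"
proof
  fix f assume f: "f \<in> filt w m'"
  show "f \<in> filt w m" unfolding filt_def
  proof (intro CollectI ballI impI)
    fix u assume "u \<in> lists J" "sum_list (map w u) < m"
    moreover from this assms have "sum_list (map w u) < m'" by linarith
    ultimately show "fold D u f \<in> P" using f by (simp add: filt_def)
  qed
qed

lemma filt_zero: "0 \<in> filt w m"
  by (auto simp: filt_def fold_D_zero ideal_zero P_ideal)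

lemma filt_add: "f \<in> filt w m \<Longrightarrow> g \<in> filt w m \<Longrightarrow> f + g \<in> filt w m"
  by (auto simp: filt_def fold_D_add ideal_add P_ideal)

lemma filt_diff: "f \<in> filt w m \<Longrightarrow> g \<in> filt w m \<Longrightarrow> f - g \<in> filt w m"
  by (auto simp: filt_def fold_D_diff ideal_diff P_ideal)

text \<open>Leibniz rule and induction on the total order, which drops because the weights are
  positive.\<close>

lemma filt_mult:
  assumes w: "\<And>i. i \<in> J \<Longrightarrow> w i \<ge> 1"
  shows "f \<in> filt w m \<Longrightarrow> g \<in> filt w l \<Longrightarrow> f * g \<in> filt w (m + l)"
proof (induction "m + l" arbitrary: m l f g rule: less_induct)
  case less
  show ?case unfolding filt_iff[of "f * g"]
  proof (intro conjI impI ballI)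
    assume "0 < m + l"
    then have "f \<in> P \<or> g \<in> P" using less.prems filt_iff[of f w m] filt_iff[of g w l] by auto
    then show "f * g \<in> P" using prime_ideal_mult_iff[OF prime] by blast
  next
    fix i assume i: "i \<in> J"
    show "D i (f * g) \<in> filt w (m + l - w i)"
    proof (cases "m + l = 0")
      case False
      have Df: "D i f \<in> filt w (m - w i)" and Dg: "D i g \<in> filt w (l - w i)"
        using less.prems i filt_iff by blast+
      \<comment> \<open>Because of truncated subtraction \<open>(m - w i) + l\<close> can exceed
        \<open>m + l - w i\<close>. The order of the undifferentiated factor is lowered so that the
        sum is exact.\<close>
      have g': "g \<in> filt w ((m + l - w i) - (m - w i))" and f': "f \<in> filt w ((m + l - w i) - (l - w i))"

        by (rule filt_antimono[THEN subsetD, OF _ less.prems(2)], arith)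
          (rule filt_antimono[THEN subsetD, OF _ less.prems(1)], arith)
      have "D i f * g \<in> filt w ((m - w i) + ((m + l - w i) - (m - w i)))"
        by (rule less.hyps[OF _ Df g']) (use w[OF i] False in auto)
      moreover have "f * D i g \<in> filt w (((m + l - w i) - (l - w i)) + (l - w i))"
        by (rule less.hyps[OF _ f' Dg]) (use w[OF i] False in auto)
      moreover have "(m - w i) + ((m + l - w i) - (m - w i)) = m + l - w i" "((m + l - w i) - (l - w i)) + (l - w i) = m + l - w i"
        by arith+
      ultimately show ?thesis unfolding D_mult by (metis filt_add)
    qed (simp add: filt_0)
  qed
qed

text \<open>\<open>h * D i f\<close> is \<open>D i (h * f) - D i h * f\<close>, of order
  \<open>m - w i\<close> by induction; the same induction then cancels \<open>h\<close>.\<close>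

lemma filt_prime:
  assumes w: "\<And>i. i \<in> J \<Longrightarrow> w i \<ge> 1" and h: "h \<notin> P"
  shows "h * f \<in> filt w m \<Longrightarrow> f \<in> filt w m"
proof (induction m arbitrary: f rule: less_induct)
  case (less m)
  show ?case unfolding filt_iff[of f]
  proof (intro conjI impI ballI)
    assume "0 < m" then show "f \<in> P" using less.prems h filt_iff[of "h * f"] prime_ideal_mult_iff[OF prime] by blast
  next
    fix i assume i: "i \<in> J"
    show "D i f \<in> filt w (m - w i)"
    proof (cases "m = 0")
      case False
      then have lt: "m - w i < m" using w[OF i] by auto
      have "f \<in> filt w (m - w i)"
        using less.IH[OF lt] less.prems filt_antimono[of "m - w i" m w] by auto
      then have "D i h * f \<in> filt w (m - w i)"
        using filt_mult[where w=w and f="D i h" and m=0 and g=f and l="m - w i"] w by (simp add: filt_0)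
      moreover have "D i (h * f) \<in> filt w (m - w i)" using less.prems i filt_iff by blast
      ultimately have "D i (h * f) - D i h * f \<in> filt w (m - w i)" by (intro filt_diff)
      then have "h * D i f \<in> filt w (m - w i)" by (simp add: D_mult)
      then show ?thesis by (rule less.IH[OF lt])
    qed (simp add: filt_0)
  qed
qed

lemma gen_power_subset_filt:
  assumes w: "\<And>i. i \<in> J \<Longrightarrow> w i \<ge> 1" and F: "F \<subseteq> filt w T"
  shows "gen_power F s \<subseteq> filt w (s * T)"
proof (induction s)
  case (Suc s)
  show ?case
  proof
    fix x assume "x \<in> gen_power F (Suc s)"
    then show "x \<in> filt w (Suc s * T)" unfolding gen_power.simps
    proof (induction rule: additive_span.induct)
      case (add x a)
      then obtain f g where "x = f * g" "f \<in> F" "g \<in> gen_power F s" by blast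
      then have "x \<in> filt w (T + s * T)" using F Suc by (auto intro!: filt_mult w)
      then show ?case using add by (auto intro: filt_add)
    qed (rule filt_zero)
  qed
qed (simp add: filt_0)

end

text \<open>The \<open>g i\<close> act as local parameters along \<open>P\<close> dual to the
  \<open>D i\<close>: their matrix of derivatives modulo \<open>P\<close> is diagonal with nonzero
  diagonal.\<close>

locale diagonal_derivations = commuting_derivations +
  fixes g :: "'a \<Rightarrow> 'b::comm_ring_1"
  assumes g_in: "i \<in> J \<Longrightarrow> g i \<in> P"
    and diagonal: "i \<in> J \<Longrightarrow> j \<in> J \<Longrightarrow> D i (g j) \<in> P \<longleftrightarrow> i \<noteq> j"
begin

definition mon where "mon M = (\<Prod>i\<in>#M. g i)"

abbreviation ord where "ord \<equiv> filt (\<lambda>_. 1)"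

lemma P_subset_ord: "f \<in> P \<Longrightarrow> f \<in> ord 1"
  by (auto simp: filt_def sum_list_triv)

lemma ord_mult: "f \<in> ord m \<Longrightarrow> h \<in> ord l \<Longrightarrow> f * h \<in> ord (m + l)"
  by (rule filt_mult) auto

lemma ord_mult_any: "h \<in> ord l \<Longrightarrow> f * h \<in> ord l"
  using ord_mult[of f 0 h l] by (simp add: filt_0)

lemma mon_in_ord: "set_mset M \<subseteq> J \<Longrightarrow> mon M \<in> ord (size M)"
proof (induction M)
  case (add i M)
  then show ?case using ord_mult[OF P_subset_ord[OF g_in[of i]], of "mon M" "size M"] by (simp add: mon_def)
qed (simp add: mon_def filt_0)

text \<open>To leading order \<open>D i\<close> acts as a multiple of the formal partial derivative,
  since the off-diagonal derivatives lie in \<open>P\<close> and raise the order of their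
  terms.\<close>

lemma D_mon:
  assumes "i \<in> J" "set_mset M \<subseteq> J"
  shows "D i (mon M) - of_nat (count M i) * D i (g i) * mon (M - {#i#}) \<in> ord (size M)"
  using assms(2)
proof (induction M)
  case (add j N)
  define e where "e = D i (mon N) - of_nat (count N i) * D i (g i) * mon (N - {#i#})"
  have e: "g j * e \<in> ord (Suc (size N))"
    using ord_mult[OF P_subset_ord[OF g_in[of j]], of e "size N"] add by (simp add: e_def)
  have eq: "D i (mon (add_mset j N)) = D i (g j) * mon N + g j * (of_nat (count N i) * D i (g i) * mon (N - {#i#})) + g j * e"
    by (simp add: mon_def D_mult e_def algebra_simps)
  have g_mon: "g j * (of_nat (count N i) * D i (g i) * mon (N - {#i#})) = of_nat (count N i) * D i (g i) * mon (add_mset j (N - {#i#}))"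
    by (simp add: mon_def algebra_simps)
  show ?case
  proof (cases "i = j")
    case True
    have "of_nat (count N i) * D i (g i) * mon (add_mset j (N - {#i#})) = of_nat (count N i) * D i (g i) * mon N"
      using True by (cases "i \<in># N") (auto simp: not_in_iff)
    then have "D i (mon (add_mset j N)) - of_nat (count (add_mset j N) i) * D i (g i) * mon (add_mset j N - {#i#}) = g j * e"
      unfolding eq g_mon using True by (simp add: algebra_simps)
    then show ?thesis using e by simp
  next
    case False
    have "of_nat (count N i) * D i (g i) * mon (add_mset j (N - {#i#})) = of_nat (count N i) * D i (g i) * mon (add_mset j N - {#i#})"
      using False by (cases "i \<in># N") (auto simp: not_in_iff add_mset_commute insert_DiffM2 multiset_eq_iff)
    then have "D i (mon (add_mset j N)) - of_nat (count (add_mset j N) i) * D i (g i) * mon (add_mset j N - {#i#}) = D i (g j) * mon N + g j * e"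
      unfolding eq g_mon using False by simp
    moreover have "D i (g j) * mon N \<in> ord (Suc (size N))"
      using ord_mult[OF P_subset_ord mon_in_ord, of "D i (g j)" N] diagonal[of i j] add.prems assms(1) False by simp
    ultimately show ?thesis using e by (auto intro: filt_add)
  qed
qed (simp add: mon_def D_zero filt_0)

lemma fold_D_mon_high:
  assumes "u \<in> lists J" "set_mset M \<subseteq> J" "length u < size M"
  shows "fold D u (r * mon M) \<in> P"
  using ord_mult_any[OF mon_in_ord[OF assms(2)], of r] assms by (simp add: filt_def sum_list_triv)

text \<open>A word as long as the monomial sees leading terms alone. If its letters match
  \<open>M\<close>, what remains is \<open>r\<close> times diagonal derivatives and multiplicities;
  the latter avoid \<open>P\<close> by \<open>of_nat_notin\<close>.\<close>

lemma fold_D_mon: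
  assumes "u \<in> lists J" "set_mset M \<subseteq> J" "size M = length u"
  shows "fold D u (r * mon M) \<in> P \<longleftrightarrow> r \<in> P \<or> mset u \<noteq> M"
  using assms
proof (induction u arbitrary: r M rule: list.induct)
  case Nil then show ?case by (simp add: mon_def)
next
  case (Cons i u)
  have i: "i \<in> J" and u: "u \<in> lists J" using Cons.prems(1) by auto
  define r' where "r' = r * (of_nat (count M i) * D i (g i))"
  define e where "e = D i (mon M) - of_nat (count M i) * D i (g i) * mon (M - {#i#})"
  have "D i r * mon M \<in> ord (size M)" by (intro ord_mult_any mon_in_ord Cons.prems)
  moreover have "r * e \<in> ord (size M)" unfolding e_def by (intro ord_mult_any D_mon i Cons.prems)
  ultimately have "D i r * mon M + r * e \<in> ord (size M)" by (rule filt_add)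
  then have small: "fold D u (D i r * mon M + r * e) \<in> P"
    using u Cons.prems by (simp add: filt_def sum_list_triv)
  have "D i (r * mon M) = (D i r * mon M + r * e) + r' * mon (M - {#i#})"
    by (simp add: D_mult e_def r'_def algebra_simps)
  then have "fold D (i # u) (r * mon M) \<in> P \<longleftrightarrow> fold D u (r' * mon (M - {#i#})) \<in> P"
    using ideal_add_cancel[OF P_ideal small] by (simp add: fold_D_add)
  also have "\<dots> \<longleftrightarrow> r \<in> P \<or> mset (i # u) \<noteq> M"
  proof (cases "i \<in># M")
    case True
    then obtain k where k: "count M i = Suc k"
      using gr0_implies_Suc[of "count M i"] by auto
    have "r' \<in> P \<longleftrightarrow> r \<in> P" unfolding r'_def k prime_ideal_mult_iff[OF prime]
      using of_nat_notin[of k] diagonal[OF i i] by auto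
    moreover have "fold D u (r' * mon (M - {#i#})) \<in> P \<longleftrightarrow> r' \<in> P \<or> mset u \<noteq> M - {#i#}"
      using Cons.prems True by (intro Cons.IH) (auto dest: in_diffD simp: size_Diff_singleton)
    ultimately show ?thesis using True by (metis add_mset_remove_trivial insert_DiffM mset.simps(2))
  next
    case False
    then have "r' = 0" "mset (i # u) \<noteq> M" by (auto simp: r'_def not_in_iff)
    then show ?thesis by (simp add: fold_D_zero ideal_zero P_ideal)
  qed
  finally show ?case .
qed

text \<open>Take a nonzero coefficient with \<open>M\<close> of least size and a word
  \<open>u\<close> spelling \<open>M\<close>. Modulo \<open>P\<close> it kills all other terms:
  larger monomials by order, those of equal size by mismatch. The weight bound ensures that
  \<open>u\<close> is among the words tested by \<open>filt w m\<close>.\<close>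

lemma mon_independent:
  assumes fin: "finite \<M>" and M: "\<And>M. M \<in> \<M> \<Longrightarrow> set_mset M \<subseteq> J \<and> sum_mset (image_mset w M) < m"
    and r: "\<And>M. M \<in> \<M> \<Longrightarrow> r M \<in> P \<Longrightarrow> r M = 0"
    and sum: "(\<Sum>M\<in>\<M>. r M * mon M) \<in> filt w m"
  shows "\<forall>M\<in>\<M>. r M = 0"
proof (rule ccontr)
  assume "\<not> ?thesis"
  then obtain M where M0: "M \<in> \<M>" "r M \<noteq> 0" and least: "\<And>N. N \<in> \<M> \<Longrightarrow> r N \<noteq> 0 \<Longrightarrow> size M \<le> size N"
    using ex_has_least_nat[of "\<lambda>M. M \<in> \<M> \<and> r M \<noteq> 0" _ size] by blast
  obtain u where u: "mset u = M" using ex_mset by blast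
  have uJ: "u \<in> lists J" using M[OF M0(1)] u by auto
  have "sum_list (map w u) < m" using M[OF M0(1)] u by (metis mset_map sum_mset_sum_list)
  then have "fold D u (\<Sum>M\<in>\<M>. r M * mon M) \<in> P" using sum uJ by (auto simp: filt_def)
  then have "fold D u (r M * mon M) + (\<Sum>N\<in>\<M>-{M}. fold D u (r N * mon N)) \<in> P"
    unfolding fold_D_sum sum.remove[OF fin M0(1), of "\<lambda>M. fold D u (r M * mon M)"] .
  moreover have "(\<Sum>N\<in>\<M>-{M}. fold D u (r N * mon N)) \<in> P"
  proof (rule ideal_sum[OF P_ideal])
    fix N assume N: "N \<in> \<M> - {M}"
    show "fold D u (r N * mon N) \<in> P"
    proof (cases "r N = 0")
      case True then show ?thesis by (simp add: fold_D_zero ideal_zero P_ideal)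
    next
      case False
      then have "size M \<le> size N" using N least by auto
      then consider "length u < size N" | "size N = length u" using u by fastforce
      then show ?thesis
      proof cases
        case 1 then show ?thesis using fold_D_mon_high[OF uJ] M N by auto
      next
        case 2 then show ?thesis using fold_D_mon[OF uJ] M N u by auto
      qed
    qed
  qed
  ultimately have "fold D u (r M * mon M) \<in> P" using ideal_add_cancel[OF P_ideal] by (metis add.commute)
  then have "r M \<in> P" using fold_D_mon[OF uJ, of M "r M"] M[OF M0(1)] u by auto
  then show False using r M0 by blast
qed

end

text \<open>The separable relations form a system that is diagonal for the coordinate fields \<open>x\<^sub>i \<partial>/\<partial>x\<^sub>i\<close>.
  Elimination allows one of these fields to be exchanged for \<open>a\<close>, which is not tangent to \<open>P\<close>.\<close>

lemma diagonal_system: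
  fixes P :: "('n::finite) mpoly set"
  assumes P: "prime_ideal P" and B: "indep_coords B P" "B \<noteq> UNIV"
    and alg: "\<And>j. j \<notin> B \<Longrightarrow> \<not> indep_coords (insert j B) P" and xj: "\<And>j. mvar j \<notin> P"
    and f: "f \<in> P" "invariant_field a f \<notin> P"
  obtains k g where "k \<notin> B" "\<And>j. j \<notin> B \<Longrightarrow> g j \<in> P"
    "\<And>i j. i \<notin> B \<Longrightarrow> j \<notin> B \<Longrightarrow> invariant_field (if i = k then a else axis i 1) (g j) \<in> P \<longleftrightarrow> i \<noteq> j"
proof -
  have I: "ideal P" by (rule prime_ideal_ideal[OF P])
  obtain q where q: "\<And>j. j \<notin> B \<Longrightarrow> q j \<in> P" "\<And>j. j \<notin> B \<Longrightarrow> q j \<in> box_polys (insert j B) 0"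
    "\<And>j. j \<notin> B \<Longrightarrow> invariant_field (axis j 1) (q j) \<notin> P"
  proof -
    have "\<forall>j. \<exists>q. j \<notin> B \<longrightarrow> q \<in> P \<and> q \<in> box_polys (insert j B) 0 \<and> invariant_field (axis j 1) q \<notin> P"
    proof
      fix j
      show "\<exists>q. j \<notin> B \<longrightarrow> q \<in> P \<and> q \<in> box_polys (insert j B) 0 \<and> invariant_field (axis j 1) q \<notin> P"
        using separable_relation[OF P B(1), of j] alg[of j] xj[of j] by blast
    qed
    then obtain q where "\<And>j. j \<notin> B \<Longrightarrow> q j \<in> P \<and> q j \<in> box_polys (insert j B) 0 \<and> invariant_field (axis j 1) (q j) \<notin> P"
      by metis
    then show ?thesis using that by blast
  qed
  \<comment> \<open>Outside \<open>B\<close> the relation \<open>q j\<close> involves the variable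
    \<open>j\<close> alone, so the other coordinate fields kill it.\<close>
  have q0: "invariant_field (axis i 1) (q j) = 0" if "i \<notin> B" "j \<notin> B" "i \<noteq> j" for i j
    using q(2)[OF that(2)] that by (intro poly_mapping_eqI) (auto simp: invariant_field_eq lin_axis box_polys_def in_keys_iff)
  have D: "invariant_field b (x * y - x' * y') \<in> P \<longleftrightarrow> x * invariant_field b y - x' * invariant_field b y' \<in> P"
    if "y \<in> P" "y' \<in> P" for b x y x' y'
  proof -
    have "invariant_field b (x * y - x' * y') = (invariant_field b x * y - invariant_field b x' * y') +
      (x * invariant_field b y - x' * invariant_field b y')"
      by (simp add: invariant_field_mult invariant_field_diff)
    moreover have "invariant_field b x * y - invariant_field b x' * y' \<in> P"
      using that I by (intro ideal_diff ideal_mult)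
    ultimately show ?thesis using ideal_add_cancel[OF I] by metis
  qed
  show ?thesis
  proof (cases "\<exists>k. k \<notin> B \<and> invariant_field a (q k) \<notin> P")
    case True
    then obtain k where k: "k \<notin> B" "invariant_field a (q k) \<notin> P" by blast
    \<comment> \<open>The field \<open>a\<close> takes the place of the one for \<open>k\<close>;
      cross-multiplication with \<open>q k\<close> makes \<open>a\<close> kill the other
      relations.\<close>
    define g where "g j = (if j = k then q k else invariant_field a (q k) * q j - invariant_field a (q j) * q k)" for j
    show ?thesis
    proof (rule that[OF k(1), of g])
      show "g j \<in> P" if "j \<notin> B" for j unfolding g_def using q that k I by (auto intro!: ideal_diff ideal_mult)
      fix i j assume ij: "i \<notin> B" "j \<notin> B"
      show "invariant_field (if i = k then a else axis i 1) (g j) \<in> P \<longleftrightarrow> i \<noteq> j"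
      proof (cases "j = k")
        case True then show ?thesis using k q0[of i k] ij I by (auto simp: g_def ideal_zero)
      next
        case False
        have *: "invariant_field b (g j) \<in> P \<longleftrightarrow> invariant_field a (q k) * invariant_field b (q j) - invariant_field a (q j) * invariant_field b (q k) \<in> P" for b
          unfolding g_def using False D[OF q(1) q(1), OF ij(2) k(1)] by simp
        show ?thesis
        proof (cases "i = k")
          case True then show ?thesis using False I by (simp add: * mult.commute ideal_zero)
        next
          case False
          then have "invariant_field (axis i 1) (q k) = 0" using q0 ij k by blast
          then show ?thesis using False k q(3)[OF ij(2)] q0[OF ij] I
            by (cases "i = j") (auto simp: * prime_ideal_mult_iff[OF P] ideal_zero)
        qed
      qed
    qed
  next
    case False
    then have aq: "invariant_field a (q j) \<in> P" if "j \<notin> B" for j using that by blast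
    \<comment> \<open>If \<open>a\<close> maps every relation into \<open>P\<close>, any
      \<open>k\<close> will do. Correcting \<open>f\<close> by the relations gives an element
      \<open>h\<close> whose coordinate derivatives lie in \<open>P\<close>, and \<open>h\<close>
      replaces \<open>q k\<close>.\<close>
    obtain k where k: "k \<notin> B" using B(2) by blast
    have "\<exists>h. h \<in> P \<and> invariant_field a h \<notin> P \<and> (\<forall>j\<in>A. invariant_field (axis j 1) h \<in> P)" if "finite A" "A \<subseteq> - B" for A
      using that
    proof (induction A rule: finite_induct)
      case empty show ?case using f by blast
    next
      case (insert j A)
      then obtain h where h: "h \<in> P" "invariant_field a h \<notin> P" "\<And>j. j \<in> A \<Longrightarrow> invariant_field (axis j 1) h \<in> P" by auto
      have j: "j \<notin> B" using insert by auto
      define h' where "h' = invariant_field (axis j 1) (q j) * h - invariant_field (axis j 1) h * q j"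
      have *: "invariant_field b h' \<in> P \<longleftrightarrow> invariant_field (axis j 1) (q j) * invariant_field b h - invariant_field (axis j 1) h * invariant_field b (q j) \<in> P" for b
        unfolding h'_def by (rule D[OF h(1) q(1)[OF j]])
      have "h' \<in> P" unfolding h'_def using q(1)[OF j] h(1) I by (intro ideal_diff ideal_mult)
      moreover have "invariant_field a h' \<notin> P"
      proof
        assume "invariant_field a h' \<in> P"
        moreover have "invariant_field (axis j 1) h * invariant_field a (q j) \<in> P" using aq[OF j] I by (intro ideal_mult)
        ultimately have "invariant_field (axis j 1) (q j) * invariant_field a h \<in> P"
          unfolding * using ideal_add[OF I] by (metis diff_add_cancel)
        then show False using h q(3)[OF j] by (simp add: prime_ideal_mult_iff[OF P])
      qed
      moreover have "invariant_field (axis i 1) h' \<in> P" if "i \<in> insert j A" for i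
      proof (cases "i = j")
        case True then show ?thesis using I by (simp add: * mult.commute ideal_zero)
      next
        case False
        then have "invariant_field (axis i 1) (q j) = 0" "invariant_field (axis i 1) h \<in> P" using that insert q0[of i j] j h by auto
        then show ?thesis using I by (simp add: * ideal_mult)
      qed
      ultimately show ?case by blast
    qed
    from this[of "- B"] obtain h where h: "h \<in> P" "invariant_field a h \<notin> P" "\<And>j. j \<notin> B \<Longrightarrow> invariant_field (axis j 1) h \<in> P" by auto
    show ?thesis
    proof (rule that[OF k, of "\<lambda>j. if j = k then h else q j"])
      show "(if j = k then h else q j) \<in> P" if "j \<notin> B" for j using h(1) q(1)[OF that] by simp
      show "invariant_field (if i = k then a else axis i 1) (if j = k then h else q j) \<in> P \<longleftrightarrow> i \<noteq> j"
        if "i \<notin> B" "j \<notin> B" for i j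
      proof (cases "j = k")
        case True then show ?thesis using h(2) h(3)[OF that(1)] by auto
      next
        case False
        then show ?thesis using q(3)[OF that(2)] aq[OF that(2)] q0[OF that] ideal_zero[OF I] by (cases "i = k") auto
      qed
    qed
  qed
qed

section \<open>A Bezout inequality for thick components\<close>

lemma (in subdomain) power_S: "x \<in> S \<Longrightarrow> x \<noteq> 0 \<Longrightarrow> x ^ n \<in> S \<and> x ^ n \<noteq> 0"
  using prod_S[of "{..<n}" "\<lambda>_. x"] by simp

lemma of_nat_notin_prime:
  fixes P :: "('n::finite) mpoly set"
  assumes "prime_ideal P" shows "of_nat (Suc k) \<notin> P"
proof
  assume "of_nat (Suc k) \<in> P"
  then have "single 0 (inverse (of_nat (Suc k))) * of_nat (Suc k) \<in> P"
    using prime_ideal_mult_iff[OF assms] by blast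
  moreover have "single 0 (inverse (of_nat (Suc k))) * of_nat (Suc k) = (1 :: 'n mpoly)"
    unfolding single_of_nat[symmetric] mult_single by (simp del: of_nat_Suc single_of_nat)
  ultimately show False using prime_ideal_one[OF assms] by simp
qed

lemma ideal_INT: "(\<And>i. i \<in> A \<Longrightarrow> ideal (f i)) \<Longrightarrow> ideal (\<Inter>i\<in>A. f i)"
  by (simp add: ideal_def)

text \<open>\<open>\<P>\<close> will consist of translates of one prime, which share the basis
  \<open>B\<close>. \<open>isolated\<close> is minimality over \<open>F\<close> in the form given by
  \<open>minimal_prime\<close>; \<open>order\<close> is the thickness \<open>T\<close> in the
  direction \<open>a\<close>.\<close>

locale thick_components =
  fixes \<P> :: "('n::finite) mpoly set set" and F :: "'n mpoly set" and B :: "'n set"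
    and d T :: nat and a :: "complex ^ 'n"
  assumes fin: "finite \<P>" and prime: "P \<in> \<P> \<Longrightarrow> prime_ideal P"
    and incomparable: "P \<in> \<P> \<Longrightarrow> Q \<in> \<P> \<Longrightarrow> P \<subseteq> Q \<Longrightarrow> P = Q"
    and indep: "P \<in> \<P> \<Longrightarrow> indep_coords B P" and B: "B \<noteq> UNIV"
    and maximal: "P \<in> \<P> \<Longrightarrow> j \<notin> B \<Longrightarrow> \<not> indep_coords (insert j B) P"
    and mvar_notin: "P \<in> \<P> \<Longrightarrow> mvar j \<notin> P"
    and transversal: "P \<in> \<P> \<Longrightarrow> \<exists>f\<in>P. invariant_field a f \<notin> P"
    and degree: "F \<subseteq> box_polys {} d"
    and order: "P \<in> \<P> \<Longrightarrow> f \<in> F \<Longrightarrow> k < T \<Longrightarrow> (invariant_field a ^^ k) f \<in> P"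
    and isolated: "P \<in> \<P> \<Longrightarrow> g \<in> P \<Longrightarrow> \<exists>h m. h \<notin> P \<and> h * g ^ m \<in> gen_power F 1"
begin

text \<open>The contraction of the \<open>s\<close>-th power of the ideal of \<open>F\<close> from
  the local ring at \<open>P\<close>.\<close>

definition sat_power :: "nat \<Rightarrow> 'n mpoly set \<Rightarrow> 'n mpoly set" where
  "sat_power s P = {g. \<exists>h. h \<notin> P \<and> h * g \<in> gen_power F s}"

definition common :: "nat \<Rightarrow> 'n mpoly set" where
  "common s = (\<Inter>P\<in>\<P>. sat_power s P)"

lemma ideal_sat_power:
  assumes "P \<in> \<P>" shows "ideal (sat_power s P)"
  unfolding ideal_def
proof (intro conjI ballI allI)
  note I = ideal_gen_power[of F s] and p = prime_ideal_mult_iff[OF prime[OF assms]]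
  show "0 \<in> sat_power s P" unfolding sat_power_def
    using prime_ideal_one[OF prime[OF assms]] ideal_zero[OF I] by (intro CollectI exI[of _ 1]) auto
  fix x y assume "x \<in> sat_power s P" "y \<in> sat_power s P"
  then obtain h k where *: "h \<notin> P" "h * x \<in> gen_power F s" "k \<notin> P" "k * y \<in> gen_power F s"
    by (auto simp: sat_power_def)
  have "(h * k) * (x + y) = k * (h * x) + h * (k * y)" by (simp add: algebra_simps)
  also have "\<dots> \<in> gen_power F s" by (rule ideal_add[OF I ideal_mult[OF I *(2)] ideal_mult[OF I *(4)]])
  finally show "x + y \<in> sat_power s P" unfolding sat_power_def using *(1,3) p[of h k] by blast
next
  note I = ideal_gen_power[of F s]
  fix r x assume "x \<in> sat_power s P"
  then obtain h where *: "h \<notin> P" "h * x \<in> gen_power F s" by (auto simp: sat_power_def)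
  then have "h * (r * x) \<in> gen_power F s" using ideal_mult[OF I *(2), of r] by (simp add: mult.left_commute)
  then show "r * x \<in> sat_power s P" unfolding sat_power_def using * by blast
qed

lemma sat_power_cancel:
  assumes "P \<in> \<P>" "h \<notin> P" "h * g \<in> sat_power s P" shows "g \<in> sat_power s P"
proof -
  obtain k where "k \<notin> P" "k * (h * g) \<in> gen_power F s" using assms(3) by (auto simp: sat_power_def)
  then have "(k * h) * g \<in> gen_power F s" "k * h \<notin> P"
    using assms prime_ideal_mult_iff[OF prime[OF assms(1)]] by (auto simp: mult.assoc)
  then show ?thesis unfolding sat_power_def by blast
qed

lemma gen_power_subset_sat_power:
  assumes "P \<in> \<P>" shows "gen_power F s \<subseteq> sat_power s P"
proof
  fix x assume "x \<in> gen_power F s"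
  then have "1 * x \<in> gen_power F s" by simp
  then show "x \<in> sat_power s P" unfolding sat_power_def using prime_ideal_one[OF prime[OF assms]] by blast
qed

lemma power_in_sat_power:
  assumes "P \<in> \<P>" "q \<in> P" obtains m where "q ^ m \<in> sat_power s P"
proof -
  obtain h m where h: "h \<notin> P" "h * q ^ m \<in> gen_power F 1" using isolated[OF assms] by blast
  have "h ^ s * (q ^ (m * s)) = (h * q ^ m) ^ s" by (simp add: power_mult_distrib power_mult)
  also have "\<dots> \<in> gen_power F s" by (rule gen_power_power[OF h(2)])
  finally have "h ^ s * q ^ (m * s) \<in> gen_power F s" .
  moreover have "h ^ s \<notin> P" using h(1) prime_ideal_power_iff[OF prime[OF assms(1)]] by blast
  ultimately show ?thesis using that unfolding sat_power_def by blast
qed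

lemma ideal_common: "ideal (common s)"
  unfolding common_def by (rule ideal_INT) (rule ideal_sat_power)

lemma gen_power_subset_common: "gen_power F s \<subseteq> common s"
  using gen_power_subset_sat_power unfolding common_def by blast

lemma common_cancel: "(\<And>P. P \<in> \<P> \<Longrightarrow> h \<notin> P) \<Longrightarrow> h * g \<in> common s \<Longrightarrow> g \<in> common s"
  using sat_power_cancel unfolding common_def by blast

text \<open>A relation modulo each member has a power in its \<open>sat_power\<close>; the product
  of these powers is a relation for all members at once.\<close>

lemma common_algebraic:
  assumes j: "j \<notin> B" shows "\<exists>f\<in>common s. f \<in> box_polys (insert j B) 0 \<and> f \<noteq> 0"
proof -
  have "\<exists>q. q \<in> sat_power s P \<and> q \<in> box_polys (insert j B) 0 \<and> q \<noteq> 0" if P: "P \<in> \<P>" for P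
  proof -
    obtain q where q: "q \<in> P" "q \<in> box_polys (insert j B) 0" "q \<noteq> 0"
      using maximal[OF P j] by (auto simp: indep_coords_def)
    obtain m where "q ^ m \<in> sat_power s P" by (rule power_in_sat_power[OF P q(1)])
    then show ?thesis using coords.power_S[OF q(2,3)] by blast
  qed
  then obtain q where q: "\<And>P. P \<in> \<P> \<Longrightarrow> q P \<in> sat_power s P" "\<And>P. P \<in> \<P> \<Longrightarrow> q P \<in> box_polys (insert j B) 0 \<and> q P \<noteq> 0"
    by metis
  have "prod q \<P> \<in> common s" unfolding common_def
  proof
    fix P assume P: "P \<in> \<P>"
    then have "prod q \<P> = q P * prod q (\<P> - {P})" using fin by (simp add: prod.remove)
    then show "prod q \<P> \<in> sat_power s P" using q(1)[OF P] ideal_mult_right[OF ideal_sat_power[OF P]] by simp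
  qed
  moreover have "prod q \<P> \<in> box_polys (insert j B) 0 \<and> prod q \<P> \<noteq> 0"
    by (rule coords.prod_S[OF fin q(2)])
  ultimately show ?thesis by blast
qed

section \<open>Upper bound for the rank modulo the localized powers\<close>

lemma submod_gen_common: "coords.submod B (gen_power F t + common s)"
  by (intro coords.submod_plus coords.submod_ideal ideal_gen_power ideal_common)

lemma submod_box_gen_common: "coords.submod B (box_polys B N + (gen_power F t + common s))"
  by (intro coords.submod_plus submod_gen_common box_polys_submod)

text \<open>Prime avoidance merges the multipliers of \<open>g\<close> at the various members into
  one \<open>h\<close> outside all of them. Modulo \<open>common s\<close> this \<open>h\<close> is
  invertible up to a scalar.\<close>

lemma common_one_subset:
  assumes g: "g \<in> common 1" shows "g \<in> coords.sat B (gen_power F 1 + common s)"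
proof -
  define A where "A = {h. h * g \<in> gen_power F 1}"
  have I: "ideal (gen_power F 1)" by (rule ideal_gen_power)
  have A: "ideal A" unfolding ideal_def
  proof (intro conjI ballI allI)
    show "0 \<in> A" using ideal_zero[OF I] by (simp add: A_def)
    show "x + y \<in> A" if "x \<in> A" "y \<in> A" for x y using that ideal_add[OF I] by (simp only: A_def mem_Collect_eq distrib_right)
    show "r * x \<in> A" if "x \<in> A" for r x using that ideal_mult[OF I] by (simp only: A_def mem_Collect_eq mult.assoc)
  qed
  have "\<not> A \<subseteq> P" if "P \<in> \<P>" for P using g that unfolding common_def sat_power_def A_def by blast
  then obtain h where h: "h \<in> A" "\<And>P. P \<in> \<P> \<Longrightarrow> h \<notin> P"
    using prime_avoidance[OF fin prime incomparable A] by blast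
  obtain b w where b: "b \<in> box_polys B 0" "b \<noteq> 0" "b - h * w \<in> common s"
  proof (rule algebraic_nonzerodivisor[OF ideal_common])
    show "\<exists>f\<in>common s. f \<in> box_polys (insert j B) 0 \<and> f \<noteq> 0" if "j \<notin> B" for j
      using that by (rule common_algebraic)
    show "g \<in> common s" if "h * g \<in> common s" for g using common_cancel[OF h(2) that] .
  qed
  have "b * g = w * (h * g) + g * (b - h * w)" by (simp add: algebra_simps)
  moreover have "w * (h * g) \<in> gen_power F 1" using h(1) I by (simp only: A_def mem_Collect_eq ideal_mult)
  moreover have "g * (b - h * w) \<in> common s" by (rule ideal_mult[OF ideal_common b(3)])
  ultimately have "b * g \<in> gen_power F 1 + common s" by (metis set_plus_intro)
  then show ?thesis by (rule coords.satI[OF b(1,2)])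
qed

text \<open>Refines a spanning statement by expanding its summand \<open>N\<close> further.\<close>

lemma sat_step:
  assumes "\<And>g. g \<in> coords.sat B (M + N)" "N \<subseteq> coords.sat B (M' + N')" "M \<subseteq> M'"
    and M': "coords.submod B M'" and N': "coords.submod B N'"
  shows "g \<in> coords.sat B (M' + N')"
proof -
  have s: "coords.submod B (coords.sat B (M' + N'))" by (intro coords.submod_sat coords.submod_plus M' N')
  have "M' \<subseteq> M' + N'" using N' set_zero_plus2[of N' M'] by (auto simp: coords.submod_def add.commute)
  then have "M \<subseteq> coords.sat B (M' + N')" using assms(3) coords.sat_superset[of "M' + N'" B] by blast
  then have "M + N \<subseteq> coords.sat B (M' + N')" using assms(2) s unfolding coords.submod_def
    by (auto elim!: set_plus_elim)
  then have "coords.sat B (M + N) \<subseteq> coords.sat B (M' + N')" using coords.sat_mono coords.sat_sat by blast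
  then show ?thesis using assms(1) by blast
qed

text \<open>It matters that \<open>E\<close> does not depend on \<open>s\<close>: the bound for \<open>|\<P>| T\<close> comes from comparing
  leading coefficients as \<open>s \<longrightarrow> \<infinity>\<close>.\<close>

lemma uniform_span:
  obtains E where "\<And>s t g. g \<in> coords.sat B (box_polys B (E + d * t) + (gen_power F (Suc t) + common s))"
proof -
  obtain E where E: "\<And>g. g \<in> coords.sat B (box_polys B E + common 1)"
    using algebraic_imp_torsion_span[OF ideal_common common_algebraic] by blast
  have base: "g \<in> coords.sat B (box_polys B E + (gen_power F 1 + common s))" for g s
  proof (rule sat_step[OF E])
    have "common 1 \<subseteq> coords.sat B (gen_power F 1 + common s)" using common_one_subset by blast
    also have "\<dots> \<subseteq> coords.sat B (box_polys B E + (gen_power F 1 + common s))"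
      by (intro coords.sat_mono set_zero_plus2 box_polys_zero)
    finally show "common 1 \<subseteq> coords.sat B (box_polys B E + (gen_power F 1 + common s))" .
  qed (rule order_refl box_polys_submod submod_gen_common)+
  \<comment> \<open>For a generator \<open>f * g\<close> of the next power, the expansion of
    \<open>g\<close> is multiplied by \<open>f\<close>, which raises the box by exactly
    \<open>d\<close>.\<close>
  have step: "g \<in> coords.sat B (box_polys B (E + d * t) + (gen_power F (Suc t) + common s))"
    if "g \<in> gen_power F t" for g t s using that
  proof (induction t arbitrary: g)
    case 0 then show ?case using base by simp
  next
    case (Suc t)
    let ?N = "coords.sat B (box_polys B (E + d * Suc t) + (gen_power F (Suc (Suc t)) + common s))"
    have sub: "coords.submod B ?N" by (intro coords.submod_sat submod_box_gen_common)
    from Suc.prems[unfolded gen_power.simps] show ?case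
    proof (induction rule: additive_span.induct)
      case zero show ?case using sub unfolding coords.submod_def by blast
    next
      case (add x c)
      then obtain f g where x: "x = f * g" "f \<in> F" "g \<in> gen_power F t" by blast
      obtain b where b: "b \<in> box_polys B 0" "b \<noteq> 0" "b * g \<in> box_polys B (E + d * t) + (gen_power F (Suc t) + common s)"
        using Suc.IH[OF x(3)] unfolding coords.sat_def by blast
      obtain y v u where yuv: "b * g = y + (v + u)" "y \<in> box_polys B (E + d * t)" "v \<in> gen_power F (Suc t)" "u \<in> common s"
        using b(3) by (auto elim!: set_plus_elim simp del: gen_power.simps)
      have "f \<in> box_polys B d" using degree x(2) box_polys_mono[of d d "{}" B] by auto
      then have "f * y \<in> box_polys B (d + (E + d * t))" using yuv by (intro box_polys_mult)
      then have 1: "f * y \<in> box_polys B (E + d * Suc t)" by (simp add: algebra_simps)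
      have 2: "f * v \<in> gen_power F (Suc (Suc t))" by (rule gen_power_SucI[OF x(2) yuv(3)])
      have 3: "f * u \<in> common s" by (rule ideal_mult[OF ideal_common yuv(4)])
      have "b * x = f * y + (f * v + f * u)"
        using arg_cong[OF yuv(1), of "\<lambda>z. f * z"] by (simp add: x(1) algebra_simps)
      also have "\<dots> \<in> box_polys B (E + d * Suc t) + (gen_power F (Suc (Suc t)) + common s)"
        by (intro set_plus_intro 1 2 3)
      finally have "x \<in> ?N" by (rule coords.satI[OF b(1,2)])
      then show ?case using add.IH sub unfolding coords.submod_def by blast
    qed
  qed
  \<comment> \<open>Repeatedly expanding the remaining power of \<open>F\<close> keeps the initial
    \<open>E\<close>, which was obtained from \<open>common 1\<close> before \<open>s\<close> was
    chosen.\<close>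
  have "g \<in> coords.sat B (box_polys B (E + d * t) + (gen_power F (Suc t) + common s))" for g t s
  proof (induction t arbitrary: g)
    case 0 then show ?case using base by simp
  next
    case (Suc t)
    let ?N = "coords.sat B (box_polys B (E + d * Suc t) + (gen_power F (Suc (Suc t)) + common s))"
    have sub: "coords.submod B ?N" by (intro coords.submod_sat submod_box_gen_common)
    show ?case
    proof (rule sat_step[OF Suc.IH])
      have "common s \<subseteq> gen_power F (Suc (Suc t)) + common s"
        by (intro set_zero_plus2 ideal_zero ideal_gen_power)
      also have "\<dots> \<subseteq> box_polys B (E + d * Suc t) + \<dots>"
        by (intro set_zero_plus2 box_polys_zero)
      finally have "common s \<subseteq> ?N" using coords.sat_superset by blast
      moreover have "gen_power F (Suc t) \<subseteq> ?N" using step by blast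
      ultimately show "gen_power F (Suc t) + common s \<subseteq> ?N"
        using sub unfolding coords.submod_def by (blast elim!: set_plus_elim)
    qed (rule box_polys_submod submod_gen_common | rule box_polys_mono, simp, simp)+
  qed
  then show ?thesis using that by blast
qed

text \<open>With \<open>s = Suc t\<close> the remainder in \<open>uniform_span\<close> falls into
  \<open>common s\<close>, so the monomials of a box span the quotient over the fraction field and
  \<open>rank_le\<close> applies.\<close>

lemma rank_common_le:
  obtains E where "\<And>s A (v :: 'i \<Rightarrow> 'n mpoly). finite A \<Longrightarrow> s > 0 \<Longrightarrow>
    (\<And>r. (\<And>i. i \<in> A \<Longrightarrow> r i \<in> box_polys B 0) \<Longrightarrow> (\<Sum>i\<in>A. r i * v i) \<in> common s \<Longrightarrow> \<forall>i\<in>A. r i = 0) \<Longrightarrow>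
    card A \<le> (E + d * s + 1) ^ card (- B)"
proof -
  obtain E where E: "\<And>s t g. g \<in> coords.sat B (box_polys B (E + d * t) + (gen_power F (Suc t) + common s))"
    by (rule uniform_span) blast
  have bound: "card A \<le> (E + d * s + 1) ^ card (- B)"
    if A: "finite A" and s: "s > 0" and
      ind: "\<And>r. (\<And>i. i \<in> A \<Longrightarrow> r i \<in> box_polys B 0) \<Longrightarrow> (\<Sum>i\<in>A. r i * v i) \<in> common s \<Longrightarrow> \<forall>i\<in>A. r i = 0"
    for s and A :: "'i set" and v :: "'i \<Rightarrow> 'n mpoly"
  proof (rule ccontr)
    assume neg: "\<not> ?thesis"
    define X :: "'n mpoly set" where "X = (\<lambda>m. single m 1) ` box_monomials B (E + d * s)"
    have X: "finite X" "card X \<le> (E + d * s + 1) ^ card (- B)"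
      unfolding X_def using card_box_monomials[of B "E + d * s"] by (auto intro: le_trans[OF card_image_le])
    obtain t where t: "s = Suc t" using s gr0_implies_Suc by blast
    have "box_polys B (E + d * t) \<subseteq> box_polys B (E + d * s)" by (intro box_polys_mono) (auto simp: t)
    then have 1: "box_polys B (E + d * t) \<subseteq> coords.sspan B X" unfolding X_def using box_polys_subset_sspan by blast
    have 2: "gen_power F (Suc t) + common s \<subseteq> common s"
      using gen_power_subset_common[of s] ideal_add[OF ideal_common] unfolding t by (blast elim!: set_plus_elim)
    have "g \<in> coords.sat B (coords.sspan B X + common s)" for g
      using E[of g t s] coords.sat_mono[OF set_plus_mono2[OF 1 2]] by blast
    then have "\<exists>r. (\<forall>i\<in>A. r i \<in> box_polys B 0) \<and> (\<exists>i\<in>A. r i \<noteq> 0) \<and> (\<Sum>i\<in>A. r i * v i) \<in> common s"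
      using X(2) neg by (intro coords.rank_le[OF X(1) A _ coords.submod_ideal[OF ideal_common]]) linarith
    then obtain r where "\<forall>i\<in>A. r i \<in> box_polys B 0" "\<exists>i\<in>A. r i \<noteq> 0" "(\<Sum>i\<in>A. r i * v i) \<in> common s"
      by blast
    then show False using ind[of r] by blast
  qed
  show ?thesis
  proof (rule that)
    fix s and A :: "'i set" and v :: "'i \<Rightarrow> 'n mpoly"
    assume "finite A" "s > 0"
      "\<And>r. (\<And>i. i \<in> A \<Longrightarrow> r i \<in> box_polys B 0) \<Longrightarrow> (\<Sum>i\<in>A. r i * v i) \<in> common s \<Longrightarrow> \<forall>i\<in>A. r i = 0"
    then show "card A \<le> (E + d * s + 1) ^ card (- B)" by (rule bound)
  qed
qed

text \<open>The direction \<open>a\<close> gets weight 1 and the others weight \<open>T\<close>, so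
  that \<open>F\<close> has order \<open>T\<close>. Monomials with exponent below
  \<open>T * s\<close> at \<open>k\<close> and below \<open>s\<close> elsewhere have weight less
  than \<open>card (- B) * s * T\<close>; there are \<open>T * s ^ card (- B)\<close> of
  them.\<close>

lemma independent_family:
  assumes P: "P \<in> \<P>" and s: "s > 0" and T: "T > 0"
  shows "\<exists>A (v :: 'n multiset \<Rightarrow> 'n mpoly). finite A \<and> card A = T * s ^ card (- B) \<and>
    (\<forall>r. (\<forall>M\<in>A. r M \<in> box_polys B 0) \<and> (\<Sum>M\<in>A. r M * v M) \<in> sat_power (card (- B) * s) P \<longrightarrow> (\<forall>M\<in>A. r M = 0))"
proof -
  obtain f where f: "f \<in> P" "invariant_field a f \<notin> P" using transversal[OF P] by blast
  obtain k g where k: "k \<notin> B" and g: "\<And>j. j \<notin> B \<Longrightarrow> g j \<in> P"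
    "\<And>i j. i \<notin> B \<Longrightarrow> j \<notin> B \<Longrightarrow> invariant_field (if i = k then a else axis i 1) (g j) \<in> P \<longleftrightarrow> i \<noteq> j"
    by (rule diagonal_system[OF prime[OF P] indep[OF P] B maximal[OF P] mvar_notin[OF P] f]) blast+
  define D where "D i = invariant_field (if i = k then a else axis i 1)" for i
  interpret diagonal_derivations D "- B" P g
    by unfold_locales (use g prime[OF P] of_nat_notin_prime[OF prime[OF P]] in
      \<open>auto simp only: D_def invariant_field_add invariant_field_mult Compl_iff\<close>)
  define w where "w i = (if i = k then 1 else T)" for i
  have w1: "w i \<ge> 1" for i using T by (auto simp: w_def)
  have "F \<subseteq> filt w T" unfolding filt_def
  proof (intro subsetI CollectI ballI impI)
    fix f u assume f: "f \<in> F" and u: "sum_list (map w u) < T"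
    \<comment> \<open>Any other letter has weight \<open>T\<close> already, so just the iterates of
      the field \<open>a\<close> are tested, and \<open>order\<close> covers them.\<close>
    have "i = k" if "i \<in> set u" for i
    proof (rule ccontr)
      assume "i \<noteq> k"
      then have "T \<in> set (map w u)" using that by (force simp: w_def)
      then have "T \<le> sum_list (map w u)" by (intro member_le_sum_list) simp_all
      then show False using u by simp
    qed
    then have u': "u = replicate (length u) k" by (simp add: replicate_length_same)
    have "sum_list (map w u) = length u" by (subst u') (simp add: w_def sum_list_replicate)
    moreover have "fold D u f = (invariant_field a ^^ length u) f"
      by (subst u') (simp add: fold_replicate D_def)
    ultimately show "fold D u f \<in> P" using order[OF P f] u by simp
  qed
  then have "gen_power F n \<subseteq> filt w (n * T)" for n by (intro gen_power_subset_filt w1)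
  then have sub: "sat_power n P \<subseteq> filt w (n * T)" for n
    unfolding sat_power_def using filt_prime[of w] w1 by blast
  define A0 where "A0 = PiE (- B) (\<lambda>i. {..<if i = k then T * s else s})"
  define ms where "ms \<alpha> = (\<Sum>i\<in>- B. replicate_mset (\<alpha> i) i)" for \<alpha> :: "'n \<Rightarrow> nat"
  have cnt: "count (ms \<alpha>) i = \<alpha> i" if "i \<notin> B" for \<alpha> i
    using that by (simp add: ms_def count_sum)
  have inj: "inj_on ms A0"
  proof (rule inj_onI)
    fix \<alpha> \<beta> assume *: "\<alpha> \<in> A0" "\<beta> \<in> A0" "ms \<alpha> = ms \<beta>"
    show "\<alpha> = \<beta>" using *(1,2) unfolding A0_def by (rule PiE_ext) (metis Compl_iff cnt *(3))
  qed
  have fin0: "finite A0" unfolding A0_def by (intro finite_PiE) auto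
  have "card A0 = (\<Prod>i\<in>- B. if i = k then T * s else s)" unfolding A0_def by (simp add: card_PiE if_distrib cong: if_cong)
  also have "\<dots> = T * s * (\<Prod>i\<in>- B - {k}. s)" using k by (subst prod.remove[of _ k]) (auto intro!: prod.cong)
  also have "\<dots> = T * s ^ card (- B)"
  proof -
    have "card (- B) = Suc (card (- B - {k}))" using k by (intro card.remove) auto
    then show ?thesis by simp
  qed
  finally have card0: "card A0 = T * s ^ card (- B)" .
  have wt: "set_mset M \<subseteq> - B \<and> sum_mset (image_mset w M) < card (- B) * s * T" if M: "M \<in> ms ` A0" for M
  proof -
    obtain \<alpha> where \<alpha>: "\<alpha> \<in> A0" "M = ms \<alpha>" using M by blast
    have "set_mset M \<subseteq> - B" unfolding \<alpha> ms_def by (auto simp: set_mset_sum split: if_splits)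
    moreover have "sum_mset (image_mset w M) = (\<Sum>i\<in>- B. \<alpha> i * w i)"
    proof -
      have "sum_mset (image_mset w (\<Sum>i\<in>A. replicate_mset (\<alpha> i) i)) = (\<Sum>i\<in>A. \<alpha> i * w i)" for A
        by (induction A rule: infinite_finite_induct) auto
      then show ?thesis by (simp add: \<alpha> ms_def)
    qed
    moreover have "(\<Sum>i\<in>- B. \<alpha> i * w i) < (\<Sum>i\<in>- B. s * T)"
    proof (rule sum_strict_mono)
      fix i assume "i \<in> - B"
      then have "\<alpha> i < (if i = k then T * s else s)" using \<alpha>(1) by (auto simp: A0_def PiE_iff)
      then show "\<alpha> i * w i < s * T" using T by (auto simp: w_def mult.commute split: if_splits)
    qed (use k in auto)
    ultimately show ?thesis by (simp add: mult.assoc)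
  qed
  have "\<forall>M\<in>ms ` A0. r M = 0" if r: "\<forall>M\<in>ms ` A0. r M \<in> box_polys B 0"
    and sum: "(\<Sum>M\<in>ms ` A0. r M * mon M) \<in> sat_power (card (- B) * s) P" for r
  proof (rule mon_independent[OF _ wt])
    show "(\<Sum>M\<in>ms ` A0. r M * mon M) \<in> filt w (card (- B) * s * T)" using sum sub by blast
    show "r M = 0" if "M \<in> ms ` A0" "r M \<in> P" for M using that r indep[OF P] by (auto simp: indep_coords_def)
  qed (use fin0 in auto)
  moreover have "card (ms ` A0) = T * s ^ card (- B)" using card0 card_image[OF inj] by simp
  ultimately show ?thesis using fin0 by (intro exI[of _ "ms ` A0"] exI[of _ mon]) blast
qed

text \<open>As in the Chinese remainder theorem: suitable powers of elements of \<open>Q\<close>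
  outside \<open>P\<close> are multiplied over all \<open>Q\<close>. The factor
  \<open>\<theta>\<close> can be cancelled at \<open>P\<close> and is zero modulo
  \<open>sat_power s Q\<close> at the others.\<close>

lemma separating_elements:
  assumes P: "P \<in> \<P>"
  obtains \<theta> where "\<theta> \<notin> P" "\<And>Q. Q \<in> \<P> \<Longrightarrow> Q \<noteq> P \<Longrightarrow> \<theta> \<in> sat_power s Q"
proof -
  have "\<exists>t. t \<notin> P \<and> t \<in> sat_power s Q" if Q: "Q \<in> \<P>" "Q \<noteq> P" for Q
  proof -
    obtain q where q: "q \<in> Q" "q \<notin> P" using incomparable[OF Q(1) P] Q(2) by blast
    obtain m where "q ^ m \<in> sat_power s Q" by (rule power_in_sat_power[OF Q(1) q(1)])
    then show ?thesis using q(2) prime_ideal_power_iff[OF prime[OF P]] by blast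
  qed
  then obtain t where t: "\<And>Q. Q \<in> \<P> \<Longrightarrow> Q \<noteq> P \<Longrightarrow> t Q \<notin> P \<and> t Q \<in> sat_power s Q" by metis
  define \<theta> where "\<theta> = prod t (\<P> - {P})"
  have "\<theta> \<notin> P" unfolding \<theta>_def using t fin by (subst prime_ideal_prod_iff[OF prime[OF P]]) auto
  moreover have "\<theta> \<in> sat_power s Q" if Q: "Q \<in> \<P>" "Q \<noteq> P" for Q
  proof -
    have "\<theta> = t Q * prod t (\<P> - {P} - {Q})" unfolding \<theta>_def using fin Q by (subst prod.remove[of _ Q]) auto
    then show ?thesis using t[OF Q] ideal_mult_right[OF ideal_sat_power[OF Q(1)]] by simp
  qed
  ultimately show ?thesis using that by blast
qed

text \<open>Multiplied by separating elements, the families at the various members become jointly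
  independent modulo \<open>common (c * s)\<close>. The rank bound limits their total size, and the
  limit removes \<open>E\<close>.\<close>

lemma bezout_bound:
  assumes T: "T > 0"
  shows "real (card \<P> * T) \<le> (real d * real (card (- B))) ^ card (- B)"
proof -
  define c where "c = card (- B)"
  have c: "c > 0" unfolding c_def using B by (simp add: card_gt_0_iff) (metis Compl_UNIV_eq double_compl)
  obtain E where E: "\<And>s A (v :: 'n mpoly set \<times> 'n multiset \<Rightarrow> 'n mpoly). finite A \<Longrightarrow> s > 0 \<Longrightarrow>
    (\<And>r. (\<And>i. i \<in> A \<Longrightarrow> r i \<in> box_polys B 0) \<Longrightarrow> (\<Sum>i\<in>A. r i * v i) \<in> common s \<Longrightarrow> \<forall>i\<in>A. r i = 0) \<Longrightarrow>
    card A \<le> (E + d * s + 1) ^ c" unfolding c_def by (rule rank_common_le) blast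
  have main: "card \<P> * (T * s ^ c) \<le> (E + d * (c * s) + 1) ^ c" if s: "s > 0" for s
  proof -
    have "\<forall>P\<in>\<P>. \<exists>A (v :: 'n multiset \<Rightarrow> 'n mpoly). finite A \<and> card A = T * s ^ c \<and>
      (\<forall>r. (\<forall>M\<in>A. r M \<in> box_polys B 0) \<and> (\<Sum>M\<in>A. r M * v M) \<in> sat_power (c * s) P \<longrightarrow> (\<forall>M\<in>A. r M = 0))"
      unfolding c_def by (intro ballI independent_family s T)
    then obtain A where "\<forall>P\<in>\<P>. \<exists>(v :: 'n multiset \<Rightarrow> 'n mpoly). finite (A P) \<and> card (A P) = T * s ^ c \<and>
      (\<forall>r. (\<forall>M\<in>A P. r M \<in> box_polys B 0) \<and> (\<Sum>M\<in>A P. r M * v M) \<in> sat_power (c * s) P \<longrightarrow> (\<forall>M\<in>A P. r M = 0))"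
      by (rule bchoice[THEN exE])
    then obtain v where Av: "\<forall>P\<in>\<P>. finite (A P) \<and> card (A P) = T * s ^ c \<and>
      (\<forall>r. (\<forall>M\<in>A P. r M \<in> box_polys B 0) \<and> (\<Sum>M\<in>A P. r M * v P M) \<in> sat_power (c * s) P \<longrightarrow> (\<forall>M\<in>A P. r M = 0))"
      by (rule bchoice[THEN exE])
    have "\<forall>P\<in>\<P>. \<exists>\<theta>. \<theta> \<notin> P \<and> (\<forall>Q\<in>\<P>. Q \<noteq> P \<longrightarrow> \<theta> \<in> sat_power (c * s) Q)"
      using separating_elements by metis
    then obtain \<theta> where \<theta>: "\<forall>P\<in>\<P>. \<theta> P \<notin> P \<and> (\<forall>Q\<in>\<P>. Q \<noteq> P \<longrightarrow> \<theta> P \<in> sat_power (c * s) Q)"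
      by (rule bchoice[THEN exE])
    have finA: "\<forall>P\<in>\<P>. finite (A P)" using Av by blast
    have "card (Sigma \<P> A) \<le> (E + d * (c * s) + 1) ^ c"
    \<comment> \<open>\<open>independent_family\<close> gives independence at level
      \<open>c * s\<close>, which puts the factor \<open>c\<close> next to \<open>d\<close> in the
      final bound.\<close>
    proof (rule E[where v = "\<lambda>(P, M). \<theta> P * v P M"])
      show "finite (Sigma \<P> A)" using fin finA by blast
      show "0 < c * s" using c s by simp
      fix r :: "'n mpoly set \<times> 'n multiset \<Rightarrow> 'n mpoly"
      assume r: "\<And>i. i \<in> Sigma \<P> A \<Longrightarrow> r i \<in> box_polys B 0"
        and sum: "(\<Sum>i\<in>Sigma \<P> A. r i * (case i of (P, M) \<Rightarrow> \<theta> P * v P M)) \<in> common (c * s)"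
      have eq: "(\<Sum>i\<in>Sigma \<P> A. r i * (case i of (P, M) \<Rightarrow> \<theta> P * v P M)) = (\<Sum>P\<in>\<P>. \<theta> P * (\<Sum>M\<in>A P. r (P, M) * v P M))"
        unfolding sum_distrib_left by (subst sum.Sigma[OF fin finA]) (auto intro!: sum.cong simp: mult_ac)
      have "r (P, M) = 0" if P: "P \<in> \<P>" and M: "M \<in> A P" for P M
      proof -
        have I: "ideal (sat_power (c * s) P)" by (rule ideal_sat_power[OF P])
        have rest: "(\<Sum>Q\<in>\<P> - {P}. \<theta> Q * (\<Sum>M\<in>A Q. r (Q, M) * v Q M)) \<in> sat_power (c * s) P"
          using \<theta> P by (intro ideal_sum[OF I] ideal_mult_right[OF I]) auto
        have "(\<Sum>P\<in>\<P>. \<theta> P * (\<Sum>M\<in>A P. r (P, M) * v P M)) \<in> sat_power (c * s) P"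
          using sum P unfolding eq common_def by blast
        then have "(\<Sum>Q\<in>\<P> - {P}. \<theta> Q * (\<Sum>M\<in>A Q. r (Q, M) * v Q M)) + \<theta> P * (\<Sum>M\<in>A P. r (P, M) * v P M) \<in> sat_power (c * s) P"
          by (subst (asm) sum.remove[OF fin P]) (simp only: add.commute)
        then have "\<theta> P * (\<Sum>M\<in>A P. r (P, M) * v P M) \<in> sat_power (c * s) P"
          by (simp only: ideal_add_cancel[OF I rest])
        then have in_sat: "(\<Sum>M\<in>A P. r (P, M) * v P M) \<in> sat_power (c * s) P"
          using sat_power_cancel[OF P] \<theta> P by blast
        have coeffs: "\<forall>M\<in>A P. r (P, M) \<in> box_polys B 0" using r P by blast
        have "\<forall>r. (\<forall>M\<in>A P. r M \<in> box_polys B 0) \<and> (\<Sum>M\<in>A P. r M * v P M) \<in> sat_power (c * s) P \<longrightarrow> (\<forall>M\<in>A P. r M = 0)"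
          using Av P by blast
        from spec[OF this, of "\<lambda>M. r (P, M)"] show ?thesis using M in_sat coeffs by simp
      qed
      then show "\<forall>i\<in>Sigma \<P> A. r i = 0" by auto
    qed
    moreover have "card (Sigma \<P> A) = card \<P> * (T * s ^ c)" using fin Av by (subst card_SigmaI) auto
    ultimately show ?thesis by simp
  qed
  \<comment> \<open>The inequality \<open>main\<close> is divided by the power of
    \<open>Suc s\<close>, which is never zero.\<close>
  have "(\<lambda>s. (real (E + 1) * inverse (real (Suc s)) + real d * real c) ^ c) \<longlonglongrightarrow> (real (E + 1) * 0 + real d * real c) ^ c"
    by (intro tendsto_intros LIMSEQ_inverse_real_of_nat)
  moreover have "real (card \<P> * T) \<le> (real (E + 1) * inverse (real (Suc s)) + real d * real c) ^ c" for s
  proof -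
    have "real (card \<P> * T) * real (Suc s) ^ c \<le> real ((E + d * (c * Suc s) + 1) ^ c)"
      using main[of "Suc s"] by (metis of_nat_le_iff of_nat_mult of_nat_power zero_less_Suc mult.assoc)
    also have "real ((E + d * (c * Suc s) + 1) ^ c) = (real (E + 1) * inverse (real (Suc s)) + real d * real c) ^ c * real (Suc s) ^ c"
      by (simp add: power_mult_distrib[symmetric] field_simps)
    finally show ?thesis by (simp add: mult_le_cancel_right)
  qed
  ultimately have "real (card \<P> * T) \<le> (real (E + 1) * 0 + real d * real c) ^ c"
    by (intro LIMSEQ_le_const) auto
  then show ?thesis by (simp add: c_def)
qed

end

section \<open>Zariski closed subsets of the torus\<close>

lemma torus_simps [simp]:
  "x \<in> carrier torus \<longleftrightarrow> (\<forall>i. x $ i \<noteq> 0)" "x \<otimes>\<^bsub>torus\<^esub> y = x * y" "\<one>\<^bsub>torus\<^esub> = 1"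
  by (simp_all add: torus_def)

definition torus_inv :: "complex ^ 'n \<Rightarrow> complex ^ 'n" where
  "torus_inv x = (\<chi> i. inverse (x $ i))"

lemma torus_inv: "x \<in> carrier torus \<Longrightarrow> torus_inv x \<in> carrier torus"
  "x \<in> carrier torus \<Longrightarrow> torus_inv x * x = 1" "x \<in> carrier torus \<Longrightarrow> x * torus_inv x = 1"
  by (simp_all add: torus_inv_def vec_eq_iff)

interpretation torus: comm_group "torus :: (complex ^ 'n) monoid"
  by (rule comm_group_torus)

definition vanishing_ideal :: "(complex ^ 'n::finite) set \<Rightarrow> 'n mpoly set" where
  "vanishing_ideal Z = {f. \<forall>x\<in>Z. meval f x = 0}"

lemma ideal_vanishing: "ideal (vanishing_ideal Z)"
  by (auto simp: ideal_def vanishing_ideal_def meval_add meval_mult)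

lemma prime_vanishing_point: "prime_ideal (vanishing_ideal {x})"
  using ideal_vanishing[of "{x}"] by (auto simp: prime_ideal_def vanishing_ideal_def meval_mult)

lemma zariski_closed_Int_zeros:
  assumes "zariski_closed Z" shows "zariski_closed (Z \<inter> {x. meval f x = 0})"
proof -
  obtain F where "Z = {x \<in> carrier torus. \<forall>f\<in>F. meval f x = 0}" using assms by (auto simp: zariski_closed_def)
  then show ?thesis unfolding zariski_closed_def by (intro exI[of _ "insert f F"]) auto
qed

lemma prime_vanishing_irreducible:
  assumes "irreducible_closed Z" shows "prime_ideal (vanishing_ideal Z)"
  unfolding prime_ideal_def
proof (intro conjI allI impI ideal_vanishing)
  show "1 \<notin> vanishing_ideal Z" using assms by (auto simp: irreducible_closed_def vanishing_ideal_def)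
  fix f g assume fg: "f * g \<in> vanishing_ideal Z"
  have cl: "zariski_closed Z" using assms by (simp add: irreducible_closed_def)
  have "Z = (Z \<inter> {x. meval f x = 0}) \<union> (Z \<inter> {x. meval g x = 0})"
    using fg by (auto simp: vanishing_ideal_def meval_mult)
  then have "Z = Z \<inter> {x. meval f x = 0} \<or> Z = Z \<inter> {x. meval g x = 0}"
    using assms zariski_closed_Int_zeros[OF cl] unfolding irreducible_closed_def by blast
  then show "f \<in> vanishing_ideal Z \<or> g \<in> vanishing_ideal Z" by (auto simp: vanishing_ideal_def)
qed

lemma vanishing_ideal_strict:
  assumes "zariski_closed Z" "zariski_closed W" "Z \<subset> W"
  shows "vanishing_ideal W \<subset> vanishing_ideal Z"
proof -
  obtain x where x: "x \<in> W" "x \<notin> Z" using assms(3) by blast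
  obtain F where F: "Z = {x \<in> carrier torus. \<forall>f\<in>F. meval f x = 0}" using assms(1) unfolding zariski_closed_def by blast
  have "x \<in> carrier torus" using assms(2) x(1) unfolding zariski_closed_def by blast
  then obtain f where "f \<in> F" "meval f x \<noteq> 0" using x(2) F by blast
  then have "f \<in> vanishing_ideal Z" "f \<notin> vanishing_ideal W" using F x(1) by (auto simp: vanishing_ideal_def)
  then show ?thesis using assms(3) by (auto simp: vanishing_ideal_def)
qed

section \<open>Chains of irreducible sets and Krull dimension\<close>

lemma chain_length_le:
  assumes c: "\<forall>i\<le>k. irreducible_closed (c i) \<and> c i \<subseteq> Z" "\<forall>i<k. c i \<subset> c (Suc i)"
  shows "k \<le> trdeg (vanishing_ideal (c k))"
proof -
  have "i \<le> k \<Longrightarrow> i \<le> trdeg (vanishing_ideal (c i))" for i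
  proof (induction i)
    case (Suc i)
    have "irreducible_closed (c i)" "irreducible_closed (c (Suc i))" "c i \<subset> c (Suc i)" using Suc c by auto
    then have "trdeg (vanishing_ideal (c i)) < trdeg (vanishing_ideal (c (Suc i)))"
      by (intro trdeg_strict prime_vanishing_irreducible vanishing_ideal_strict) (auto simp: irreducible_closed_def)
    then show ?case using Suc by simp
  qed simp
  then show ?thesis by simp
qed

text \<open>The vanishing ideal of the top of a chain contains \<open>P\<close>, and its
  transcendence degree bounds the length. An upper bound serves for subgroups because a lower bound
  for \<open>codim\<close> is wanted.\<close>

lemma zariski_dim_le:
  fixes Z :: "(complex ^ 'n::finite) set"
  assumes "P \<subseteq> vanishing_ideal Z"
  shows "zariski_dim Z \<le> trdeg P"
proof -
  let ?K = "{k. \<exists>c :: nat \<Rightarrow> (complex ^ 'n) set. (\<forall>i\<le>k. irreducible_closed (c i) \<and> c i \<subseteq> Z) \<and> (\<forall>i<k. c i \<subset> c (Suc i))}"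
  have "k \<le> trdeg P" if k: "k \<in> ?K" for k
  proof -
    obtain c :: "nat \<Rightarrow> (complex ^ 'n) set" where c: "\<forall>i\<le>k. irreducible_closed (c i) \<and> c i \<subseteq> Z" "\<forall>i<k. c i \<subset> c (Suc i)"
      using k by blast
    have "k \<le> trdeg (vanishing_ideal (c k))" by (rule chain_length_le[OF c])
    also have "c k \<subseteq> Z" "irreducible_closed (c k)" using c by auto
    then have "trdeg (vanishing_ideal (c k)) \<le> trdeg P"
      using assms by (intro trdeg_mono prime_vanishing_irreducible) (auto simp: vanishing_ideal_def)
    finally show ?thesis .
  qed
  \<comment> \<open>On the naturals the supremum of the empty set is 0, so the empty case obeys the
    bound too.\<close>
  moreover have "Sup K \<le> m" if "\<And>k. k \<in> K \<Longrightarrow> k \<le> m" for K and m :: nat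
    using that by (cases "K = {}") (simp add: Sup_nat_def, rule cSup_least)
  ultimately show ?thesis unfolding zariski_dim_def by blast
qed

text \<open>\<open>res\<close> sets the variables outside \<open>J\<close> to 1. Polynomials that do
  not vanish on \<open>Z\<close> stay nonzero under \<open>res\<close>, so two of them have a common
  point of nonvanishing in \<open>Z\<close>.\<close>

lemma irreducible_coordinate_torus:
  fixes J :: "('n::finite) set"
  defines "Z \<equiv> {x \<in> carrier torus. \<forall>i\<in>- J. x $ i = 1}"
  shows "irreducible_closed Z"
  unfolding irreducible_closed_def
proof (intro conjI allI impI)
  have "Z = {x \<in> carrier torus. \<forall>f\<in>(\<lambda>i. mvar i - 1) ` (- J). meval f x = 0}"
    by (auto simp: Z_def meval_diff mvar_def meval_single monom_eval_single)
  then show "zariski_closed Z" unfolding zariski_closed_def by blast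
  have "1 \<in> Z" by (simp add: Z_def)
  then show "Z \<noteq> {}" by blast
  fix A A' assume A: "zariski_closed A" "zariski_closed A'" and ZA: "Z = A \<union> A'"
  show "Z = A \<or> Z = A'"
  proof (rule ccontr)
    assume "\<not> ?thesis"
    then have sub: "A \<subset> Z" "A' \<subset> Z" using ZA by auto
    have "vanishing_ideal Z \<subset> vanishing_ideal A" "vanishing_ideal Z \<subset> vanishing_ideal A'"
      by (rule vanishing_ideal_strict A \<open>zariski_closed Z\<close> sub)+
    then obtain f g where fg: "f \<in> vanishing_ideal A" "f \<notin> vanishing_ideal Z" "g \<in> vanishing_ideal A'" "g \<notin> vanishing_ideal Z"
      by blast
    define \<rho> where "\<rho> x = (\<chi> i. if i \<in> J then x $ i else 1)" for x :: "complex ^ 'n"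
    define res where "res f = (\<Sum>m\<in>keys f. single (restrict_exp J m) (lookup f m))" for f :: "'n mpoly"
    have mono: "monom_eval x (restrict_exp J m) = monom_eval (\<rho> x) m" for x m
      unfolding monom_eval_def by (intro prod.cong) (auto simp: \<rho>_def lookup_restrict_exp)
    have meval_sum: "meval (sum h S) x = (\<Sum>i\<in>S. meval (h i) x)" for h :: "('n \<Rightarrow>\<^sub>0 nat) \<Rightarrow> 'n mpoly" and S x
      by (induction S rule: infinite_finite_induct) (auto simp: meval_add)
    have res: "meval (res f) x = meval f (\<rho> x)" for f x
      using meval_eq_sum[OF finite_keys order_refl, of f "\<rho> x"] by (simp add: res_def meval_sum meval_single mono)
    have nz: "res f \<noteq> 0" if f: "f \<notin> vanishing_ideal Z" for f
    proof -
      obtain x where "x \<in> Z" "meval f x \<noteq> 0" using f by (auto simp: vanishing_ideal_def)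
      moreover have "\<rho> x = x" using \<open>x \<in> Z\<close> by (auto simp: \<rho>_def Z_def vec_eq_iff)
      ultimately have "meval (res f) x \<noteq> 0" by (simp add: res)
      then show ?thesis by auto
    qed
    obtain u where u: "u \<in> carrier torus" "\<And>h. h \<in> {res f, res g} \<Longrightarrow> meval h u \<noteq> 0"
      by (rule exists_common_nonzero[of "{res f, res g}"]) (use nz fg in auto)
    have "\<rho> u \<in> Z" using u(1) by (auto simp: \<rho>_def Z_def)
    then have "meval f (\<rho> u) = 0 \<or> meval g (\<rho> u) = 0" using ZA fg by (auto simp: vanishing_ideal_def)
    then show False using u(2)[of "res f"] u(2)[of "res g"] by (simp add: res)
  qed
qed

text \<open>The flag of coordinate subtori is a chain of the required length. Boundedness of the
  chain lengths makes \<open>Sup\<close> an actual upper bound.\<close>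

lemma zariski_dim_torus: "CARD('n) \<le> zariski_dim (carrier torus :: (complex ^ 'n::finite) set)"
proof -
  let ?n = "CARD('n)"
  let ?K = "{k. \<exists>c :: nat \<Rightarrow> (complex ^ 'n) set. (\<forall>i\<le>k. irreducible_closed (c i) \<and> c i \<subseteq> carrier torus) \<and> (\<forall>i<k. c i \<subset> c (Suc i))}"
  obtain \<iota> :: "'n \<Rightarrow> nat" where \<iota>: "bij_betw \<iota> UNIV {..<?n}"
    using ex_bij_betw_finite_nat[OF finite[of "UNIV :: 'n set"]] by (metis atLeast0LessThan)
  define c where "c k = {x \<in> carrier torus. \<forall>i\<in>- {i. \<iota> i < k}. x $ i = 1}" for k
  have "c k \<subset> c (Suc k)" if k: "k < ?n" for k
  proof -
    obtain i where i: "\<iota> i = k" using \<iota> k by (metis bij_betw_imp_surj_on imageE lessThan_iff)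
    define x :: "complex ^ 'n" where "x = (\<chi> j. if j = i then 2 else 1)"
    have "inj \<iota>" using \<iota> by (simp add: bij_betw_def)
    then have "x \<in> c (Suc k)" "x \<notin> c k" using i by (auto simp: c_def x_def less_Suc_eq)
    moreover have "c k \<subseteq> c (Suc k)" by (auto simp: c_def)
    ultimately show ?thesis by blast
  qed
  moreover have "irreducible_closed (c k)" "c k \<subseteq> carrier torus" for k
    unfolding c_def using irreducible_coordinate_torus by blast+
  ultimately have "?n \<in> ?K" by blast
  moreover have "bdd_above ?K"
  proof (rule bdd_aboveI)
    fix k assume "k \<in> ?K"
    then obtain c :: "nat \<Rightarrow> (complex ^ 'n) set" where c: "\<forall>i\<le>k. irreducible_closed (c i) \<and> c i \<subseteq> carrier torus" "\<forall>i<k. c i \<subset> c (Suc i)"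
      by blast
    have "k \<le> trdeg (vanishing_ideal (c k))" by (rule chain_length_le[OF c])
    also have "\<dots> \<le> ?n" using c(1) by (intro trdeg_le prime_vanishing_irreducible) auto
    finally show "k \<le> ?n" .
  qed
  ultimately show ?thesis unfolding zariski_dim_def by (rule cSup_upper)
qed

section \<open>Translates and stabilizers of prime ideals\<close>

text \<open>For \<open>s\<close> in the torus, its zero set is that of \<open>P\<close> multiplied
  by \<open>s\<close>.\<close>

definition translate_ideal :: "complex ^ 'n::finite \<Rightarrow> 'n mpoly set \<Rightarrow> 'n mpoly set" where
  "translate_ideal s P = {f. translate s f \<in> P}"

lemma translate_inv:
  assumes "s \<in> carrier torus"
  shows "translate s (translate (torus_inv s) f) = f" "translate (torus_inv s) (translate s f) = f"
  using torus_inv[OF assms] by (simp_all add: translate_translate translate_by_one)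

lemma prime_translate_ideal: "prime_ideal P \<Longrightarrow> prime_ideal (translate_ideal s P)"
  unfolding prime_ideal_def ideal_def translate_ideal_def
  by (simp add: translate_mult translate_add translate_zero translate_one)

lemma indep_coords_translate:
  assumes s: "s \<in> carrier torus" shows "indep_coords B (translate_ideal s P) \<longleftrightarrow> indep_coords B P"
proof -
  have nz: "monom_eval s m \<noteq> 0" for m using s by (auto simp: monom_eval_def)
  have box: "translate s f \<in> box_polys B 0 \<longleftrightarrow> f \<in> box_polys B 0" for f
    unfolding translate_def by (rule box_polys_diag_iff) (rule nz)
  have zero: "translate s f = 0 \<longleftrightarrow> f = 0" for f
    using translate_inv(2)[OF s, of f] translate_zero by metis
  show ?thesis
  proof
    assume l: "indep_coords B (translate_ideal s P)"
    show "indep_coords B P" unfolding indep_coords_def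
    proof
      fix f assume f: "f \<in> box_polys B 0 \<inter> P"
      let ?g = "translate (torus_inv s) f"
      have "?g \<in> box_polys B 0" "?g \<in> translate_ideal s P"
        using f box[of ?g] by (auto simp: translate_inv[OF s] translate_ideal_def)
      then have "?g = 0" using l by (auto simp: indep_coords_def)
      then have "translate s ?g = 0" using zero by simp
      then show "f \<in> {0}" by (simp add: translate_inv[OF s])
    qed
  next
    assume "indep_coords B P"
    then show "indep_coords B (translate_ideal s P)"
      unfolding indep_coords_def translate_ideal_def using box zero by blast
  qed
qed

lemma trdeg_translate: "s \<in> carrier torus \<Longrightarrow> trdeg (translate_ideal s P) = trdeg P"
  by (simp add: trdeg_def indep_coords_translate del: torus_simps)

lemma prime_eq_of_trdeg:
  "prime_ideal P \<Longrightarrow> prime_ideal Q \<Longrightarrow> Q \<subseteq> P \<Longrightarrow> trdeg Q \<le> trdeg P \<Longrightarrow> Q = P"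
  using trdeg_strict[of P Q] by force

text \<open>Lets linear forms test membership in \<open>P\<close>: \<open>\<psi>\<close> is
  prescribed on a basis of \<open>P\<close> together with \<open>v\<close>.\<close>

lemma separating_functional:
  fixes P :: "'n mpoly set"
  assumes P: "ideal P" and v: "v \<notin> P"
  obtains \<psi> :: "'n mpoly \<Rightarrow> complex" where "\<And>f g. \<psi> (f + g) = \<psi> f + \<psi> g"
    "\<And>c f. \<psi> (single 0 c * f) = c * \<psi> f" "\<And>f. f \<in> P \<Longrightarrow> \<psi> f = 0" "\<psi> v \<noteq> 0"
proof -
  define sc where "sc = (\<lambda>c (f :: 'n mpoly). single 0 c * f)"
  interpret vs: vector_space_pair sc "(*) :: complex \<Rightarrow> complex \<Rightarrow> complex"
    by unfold_locales (auto simp: sc_def algebra_simps single_add mult_single mult.assoc[symmetric])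
  obtain C where C: "C \<subseteq> P" "vs.vs1.independent C" "P \<subseteq> vs.vs1.span C"
    by (rule vs.vs1.maximal_independent_subset)
  have "sc c f = single 0 c * f" for c f by (simp add: sc_def)
  then have sub: "vs.vs1.subspace P" using P by (simp add: vs.vs1.subspace_def ideal_def)
  have "v \<notin> vs.vs1.span C" using v vs.vs1.span_minimal[OF C(1) sub] by blast
  then have "vs.vs1.independent (insert v C)" by (rule vs.vs1.independent_insertI[OF _ C(2)])
  then obtain \<psi> where l: "Vector_Spaces.linear sc (*) \<psi>" "\<forall>x\<in>insert v C. \<psi> x = (if x = v then 1 else 0)"
    using vs.linear_independent_extend[of "insert v C" "\<lambda>x. if x = v then 1 else 0"] by blast
  interpret l: Vector_Spaces.linear sc "(*)" \<psi> by (rule l(1))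
  have "\<psi> f = 0" if f: "f \<in> P" for f
  proof -
    have "\<psi> x = 0" if "x \<in> C" for x using l(2) C(1) v that by auto
    then show ?thesis using f C(3) l.eq_0_on_span by blast
  qed
  moreover have "\<psi> v \<noteq> 0" using l(2) by simp
  ultimately show ?thesis using that l.add l.scale unfolding sc_def by blast
qed

text \<open>A single inclusion is convenient for closedness. For prime \<open>P\<close> it is an
  equality, because translation preserves the transcendence degree.\<close>

definition stabilizer :: "('n::finite) mpoly set \<Rightarrow> (complex ^ 'n) set" where
  "stabilizer P = {g \<in> carrier torus. P \<subseteq> translate_ideal g P}"

text \<open>For a linear form \<open>\<psi>\<close> killing \<open>P\<close>, the value
  \<open>\<psi> (translate g f)\<close> is a polynomial in \<open>g\<close>, namely
  \<open>\<phi> f \<psi>\<close>. Separating functionals show that these polynomials cut out the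
  stabilizer.\<close>

lemma stabilizer_closed:
  fixes P :: "('n::finite) mpoly set"
  assumes P: "ideal P" shows "zariski_closed (stabilizer P)"
proof -
  define L where "L = {\<psi> :: 'n mpoly \<Rightarrow> complex. (\<forall>f g. \<psi> (f + g) = \<psi> f + \<psi> g) \<and>
    (\<forall>c f. \<psi> (single 0 c * f) = c * \<psi> f) \<and> (\<forall>f\<in>P. \<psi> f = 0)}"
  define \<phi> where "\<phi> f \<psi> = (\<Sum>m\<in>keys f. single m (lookup f m * \<psi> (single m 1)))" for f and \<psi> :: "'n mpoly \<Rightarrow> complex"
  have ev: "meval (\<phi> f \<psi>) g = \<psi> (translate g f)" if l: "\<psi> \<in> L" for f \<psi> g
  proof -
    have l0: "\<psi> 0 = 0" using l ideal_zero[OF P] by (auto simp: L_def)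
    have "lookup (\<phi> f \<psi>) m = lookup f m * \<psi> (single m 1)" for m
      by (auto simp: \<phi>_def lookup_sum lookup_single when_def in_keys_iff)
    then have 1: "meval (\<phi> f \<psi>) g = (\<Sum>m\<in>keys f. lookup f m * \<psi> (single m 1) * monom_eval g m)"
      by (subst meval_eq_sum[of "keys f"]) (auto simp: in_keys_iff)
    have 2: "\<psi> (sum h S) = (\<Sum>m\<in>S. \<psi> (h m))" for h :: "('n \<Rightarrow>\<^sub>0 nat) \<Rightarrow> 'n mpoly" and S
      by (induction S rule: infinite_finite_induct) (use l l0 in \<open>auto simp: L_def\<close>)
    have 3: "translate g f = (\<Sum>m\<in>keys f. single 0 (monom_eval g m * lookup f m) * single m 1)"
      by (rule poly_mapping_eqI)
        (auto simp: translate_def mult_single lookup_sum lookup_single when_def in_keys_iff)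
    have 4: "\<psi> (single 0 c * f) = c * \<psi> f" for c f using l by (simp add: L_def)
    show ?thesis unfolding 1 3 2 4 by (simp add: mult_ac)
  qed
  have "stabilizer P = {g \<in> carrier torus. \<forall>h\<in>{\<phi> f \<psi> | f \<psi>. f \<in> P \<and> \<psi> \<in> L}. meval h g = 0}"
  proof (intro equalityI subsetI)
    fix g assume g: "g \<in> stabilizer P"
    have "meval (\<phi> f \<psi>) g = 0" if "f \<in> P" "\<psi> \<in> L" for f \<psi>
    proof -
      have "translate g f \<in> P" using g that by (auto simp: stabilizer_def translate_ideal_def)
      then have "\<psi> (translate g f) = 0" using that(2) unfolding L_def by blast
      then show ?thesis by (simp only: ev[OF that(2)])
    qed
    then show "g \<in> {g \<in> carrier torus. \<forall>h\<in>{\<phi> f \<psi> | f \<psi>. f \<in> P \<and> \<psi> \<in> L}. meval h g = 0}"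
      using g unfolding stabilizer_def by blast
  next
    fix g assume g: "g \<in> {g \<in> carrier torus. \<forall>h\<in>{\<phi> f \<psi> | f \<psi>. f \<in> P \<and> \<psi> \<in> L}. meval h g = 0}"
    have "translate g f \<in> P" if f: "f \<in> P" for f
    proof (rule ccontr)
      assume "translate g f \<notin> P"
      then obtain \<psi> where "\<And>f g. \<psi> (f + g) = \<psi> f + \<psi> g"
        "\<And>c f. \<psi> (single 0 c * f) = c * \<psi> f" "\<And>f. f \<in> P \<Longrightarrow> \<psi> f = 0" and nz: "\<psi> (translate g f) \<noteq> 0"
        by (rule separating_functional[OF P]) blast
      then have l: "\<psi> \<in> L" by (simp add: L_def)
      then have "meval (\<phi> f \<psi>) g = 0" using g f by blast
      then show False using nz ev[OF l] by simp
    qed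
    then show "g \<in> stabilizer P" using g by (auto simp: stabilizer_def translate_ideal_def)
  qed
  then show ?thesis unfolding zariski_closed_def by blast
qed

lemma stabilizer_subgroup:
  assumes P: "prime_ideal P" shows "algebraic_subgroup (stabilizer P)"
  unfolding algebraic_subgroup_def
proof (intro conjI stabilizer_closed[OF prime_ideal_ideal[OF P]] torus.subgroupI)
  show "stabilizer P \<subseteq> carrier torus" by (auto simp: stabilizer_def)
  have "1 \<in> stabilizer P" by (simp add: stabilizer_def translate_ideal_def translate_by_one)
  then show "stabilizer P \<noteq> {}" by blast
next
  fix g assume g: "g \<in> stabilizer P"
  then have gt: "g \<in> carrier torus" by (simp add: stabilizer_def)
  \<comment> \<open>Nested primes of equal transcendence degree coincide; this yields closure under
    inverses.\<close>
  have eq: "P = translate_ideal g P"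
    by (rule prime_eq_of_trdeg) (use g P prime_translate_ideal trdeg_translate[OF gt] in \<open>auto simp: stabilizer_def\<close>)
  have "translate (torus_inv g) f \<in> P" if "f \<in> P" for f
    using that translate_inv(1)[OF gt, of f] by (subst eq) (simp add: translate_ideal_def)
  then have "torus_inv g \<in> stabilizer P" using torus_inv(1)[OF gt] unfolding stabilizer_def translate_ideal_def by blast
  moreover have "inv\<^bsub>torus\<^esub> g = torus_inv g"
    by (rule torus.inv_equality) (use torus_inv[OF gt] gt in \<open>simp_all del: torus_simps(1)\<close>)
  ultimately show "inv\<^bsub>torus\<^esub> g \<in> stabilizer P" by simp
next
  fix g h assume "g \<in> stabilizer P" "h \<in> stabilizer P"
  then show "g \<otimes>\<^bsub>torus\<^esub> h \<in> stabilizer P"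
    by (auto simp: stabilizer_def translate_ideal_def translate_translate[symmetric])
qed

text \<open>The stabilizer moves \<open>\<gamma>\<close> inside the zero set of \<open>P\<close>, so
  it lies in that set multiplied by the inverse of \<open>\<gamma>\<close>.\<close>

lemma zariski_dim_stabilizer:
  assumes P: "prime_ideal P" and \<gamma>: "\<gamma> \<in> carrier torus" "P \<subseteq> vanishing_ideal {\<gamma>}"
  shows "zariski_dim (stabilizer P) \<le> trdeg P"
proof -
  have "translate_ideal (torus_inv \<gamma>) P \<subseteq> vanishing_ideal (stabilizer P)"
  proof
    fix f assume f: "f \<in> translate_ideal (torus_inv \<gamma>) P"
    define f' where "f' = translate (torus_inv \<gamma>) f"
    have "f' \<in> P" using f by (simp add: f'_def translate_ideal_def)
    have "meval f g = 0" if g: "g \<in> stabilizer P" for g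
    proof -
      have "translate g f' \<in> P" using g \<open>f' \<in> P\<close> by (auto simp: stabilizer_def translate_ideal_def)
      then have "meval (translate g f') \<gamma> = 0" using \<gamma> by (auto simp: vanishing_ideal_def)
      moreover have "meval (translate g f') \<gamma> = meval f (torus_inv \<gamma> * (g * \<gamma>))" by (simp add: f'_def meval_translate)
      moreover have "torus_inv \<gamma> * (g * \<gamma>) = g * (torus_inv \<gamma> * \<gamma>)" by (simp add: mult_ac)
      ultimately show ?thesis using torus_inv(2)[OF \<gamma>(1)] by simp
    qed
    then show "f \<in> vanishing_ideal (stabilizer P)" by (simp add: vanishing_ideal_def)
  qed
  then show ?thesis using zariski_dim_le trdeg_translate[OF torus_inv(1)[OF \<gamma>(1)]] by metis
qed

text \<open>Otherwise the orbit of \<open>\<gamma>\<close>, the whole torus, would lie in the zero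
  set of the nonzero \<open>f\<close>.\<close>

lemma stabilizer_proper:
  assumes \<gamma>: "\<gamma> \<in> carrier torus" "P \<subseteq> vanishing_ideal {\<gamma>}" and f: "f \<in> P" "f \<noteq> 0"
  shows "stabilizer P \<noteq> carrier torus"
proof
  assume eq: "stabilizer P = carrier torus"
  obtain x where x: "x \<in> carrier torus" "\<And>h. h \<in> {f} \<Longrightarrow> meval h x \<noteq> 0"
    by (rule exists_common_nonzero[of "{f}"]) (use f in auto)
  have "x * torus_inv \<gamma> \<in> stabilizer P" unfolding eq using x(1) torus_inv(1)[OF \<gamma>(1)] by auto
  then have "translate (x * torus_inv \<gamma>) f \<in> P" using f by (auto simp: stabilizer_def translate_ideal_def)
  then have "meval f (x * torus_inv \<gamma> * \<gamma>) = 0" using \<gamma>(2) by (auto simp: vanishing_ideal_def meval_translate)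
  then show False using x(2) torus_inv(2)[OF \<gamma>(1)] by (simp add: mult.assoc)
qed

text \<open>Elements with equal translates of \<open>P\<close> differ by an element of the
  stabilizer, so the translate determines the coset.\<close>

lemma number_of_cosets_stabilizer_le:
  assumes P: "prime_ideal P" and S: "finite S" "S \<subseteq> carrier torus"
  shows "number_of_cosets S (stabilizer P) \<le> card ((\<lambda>s. translate_ideal s P) ` S)"
proof -
  let ?H = "stabilizer P"
  have sub: "subgroup ?H torus" using stabilizer_subgroup[OF P] by (simp add: algebraic_subgroup_def)
  have eq: "?H #>\<^bsub>torus\<^esub> s = ?H #>\<^bsub>torus\<^esub> t" if st: "s \<in> S" "t \<in> S" "translate_ideal s P = translate_ideal t P" for s t
  proof -
    have t: "t \<in> carrier torus" and s: "s \<in> carrier torus" using st S by auto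
    have "translate (s * torus_inv t) f \<in> P" if "f \<in> P" for f
    proof -
      have "translate (torus_inv t) f \<in> translate_ideal t P" using that by (simp add: translate_ideal_def translate_inv[OF t])
      then have "translate (torus_inv t) f \<in> translate_ideal s P" using st(3) by simp
      then show ?thesis by (simp add: translate_ideal_def translate_translate)
    qed
    then have "s * torus_inv t \<in> ?H" using s torus_inv(1)[OF t] by (auto simp: stabilizer_def translate_ideal_def)
    moreover have "s = (s * torus_inv t) * t" using torus_inv(2)[OF t] by (simp add: mult.assoc)
    ultimately have "s \<in> ?H #>\<^bsub>torus\<^esub> t" unfolding r_coset_def by auto
    then show ?thesis using torus.repr_independence[OF _ t sub] by blast
  qed
  define rep where "rep = inv_into S (\<lambda>s. translate_ideal s P)"
  have "(\<lambda>s. ?H #>\<^bsub>torus\<^esub> s) ` S \<subseteq> (\<lambda>I. ?H #>\<^bsub>torus\<^esub> rep I) ` ((\<lambda>s. translate_ideal s P) ` S)"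
  proof
    fix K assume "K \<in> (\<lambda>s. ?H #>\<^bsub>torus\<^esub> s) ` S"
    then obtain s where s: "s \<in> S" "K = ?H #>\<^bsub>torus\<^esub> s" by blast
    let ?I = "translate_ideal s P"
    have "rep ?I \<in> S" "translate_ideal (rep ?I) P = ?I"
      unfolding rep_def using inv_into_into[of ?I "\<lambda>s. translate_ideal s P" S]
        f_inv_into_f[of ?I "\<lambda>s. translate_ideal s P" S] s(1) by blast+
    then have "K = ?H #>\<^bsub>torus\<^esub> rep ?I" using eq s by metis
    then show "K \<in> (\<lambda>I. ?H #>\<^bsub>torus\<^esub> rep I) ` ((\<lambda>s. translate_ideal s P) ` S)" using s by blast
  qed
  then show ?thesis unfolding number_of_cosets_def using S(1)
    by (meson card_image_le card_mono finite_imageI le_trans)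
qed

section \<open>The multiplicity estimate\<close>

lemma iterated_product_mult: "x \<in> iterated_product S p \<Longrightarrow> s \<in> S \<Longrightarrow> x * s \<in> iterated_product S (Suc p)"
  by (auto simp: set_mult_def)

lemma iterated_product_subset: "S \<subseteq> carrier torus \<Longrightarrow> iterated_product S p \<subseteq> carrier torus"
  by (induction p) (fastforce simp: set_mult_def)+

lemma iterated_product_mono:
  assumes "1 \<in> S" "p \<le> q" shows "iterated_product S p \<subseteq> iterated_product S q"
  using assms(2)
proof (induction rule: dec_induct)
  case (step q)
  then show ?case using iterated_product_mult[OF _ assms(1), of _ q] by auto
qed simp

lemma one_in_iterated_product: "1 \<in> S \<Longrightarrow> 1 \<in> iterated_product S p"
  using iterated_product_mono[of S 0 p] by auto

lemma total_degree_box: "P \<in> box_polys {} (total_degree P)"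
  unfolding box_polys_def
proof (intro CollectI ballI allI impI)
  fix m i assume m: "m \<in> keys P"
  have "lookup m i \<le> (\<Sum>j\<in>UNIV. lookup m j)" by (intro member_le_sum) auto
  also have "\<dots> \<le> total_degree P" unfolding total_degree_def using m by (intro Max_ge) auto
  finally show "lookup m i \<le> total_degree P" .
qed

text \<open>The contrapositive of the theorem; the exhibited subgroup is the stabilizer of a
  prime.\<close>

lemma multiplicity_estimate:
  fixes \<xi> :: "complex ^ 'n::finite" and P :: "'n mpoly"
  assumes S: "finite S" "S \<subseteq> carrier torus" "1 \<in> S" and T: "T \<ge> 1"
    and ord: "\<And>\<gamma>. \<gamma> \<in> iterated_product S CARD('n) \<Longrightarrow> vanishes_to_order P \<xi> \<gamma> T"
    and nid: "\<And>\<gamma>. \<gamma> \<in> iterated_product S CARD('n) \<Longrightarrow> \<not> vanishes_identically P \<xi> \<gamma>"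
  obtains H where "algebraic_subgroup H" "H \<noteq> carrier torus"
    "real (number_of_cosets S H) \<le> real (total_degree P) ^ codim H * real (CARD('n) * CARD('n) ^ CARD('n)) / real T"
proof -
  let ?n = "CARD('n)"
  let ?S = "iterated_product S"
  \<comment> \<open>\<open>T\<close> divided by the dimension, rounded up: \<open>CARD('n)\<close>
    rounds of \<open>T1 - 1\<close> derivations stay below \<open>T\<close>.\<close>
  define T1 where "T1 = (T - 1) div ?n + 1"
  define G where "G r = {translate \<gamma> ((invariant_field \<xi> ^^ k) P) | \<gamma> k. \<gamma> \<in> ?S r \<and> k \<le> r * (T1 - 1)}" for r
  \<comment> \<open>The point uses \<open>?n - r\<close> factors because the elements of
    \<open>G r\<close> already involve translations by \<open>r\<close> factors.\<close>
  define good where "good r Q \<longleftrightarrow> prime_ideal Q \<and> G r \<subseteq> Q \<and> (\<exists>\<gamma>\<in>?S (?n - r). Q \<subseteq> vanishing_ideal {\<gamma>})" for r Q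
  define \<rho> where "\<rho> r = Max (trdeg ` {Q. good r Q})" for r
  have P0: "P \<noteq> 0"
    using nid[OF one_in_iterated_product[OF S(3)]] by (auto simp: vanishes_identically_def)
  have PG: "P \<in> G r" for r
    unfolding G_def using one_in_iterated_product[OF S(3), of r]
    by (intro CollectI exI[of _ 1] exI[of _ 0]) (simp add: translate_by_one)
  have G_mono: "G r \<subseteq> G q" if "r \<le> q" for r q
  proof
    fix f assume "f \<in> G r"
    then obtain \<gamma> k where "f = translate \<gamma> ((invariant_field \<xi> ^^ k) P)" "\<gamma> \<in> ?S r" "k \<le> r * (T1 - 1)"
      unfolding G_def by blast
    moreover have "\<gamma> \<in> ?S q" using iterated_product_mono[OF S(3) that] \<open>\<gamma> \<in> ?S r\<close> by blast
    moreover have "k \<le> q * (T1 - 1)" using mult_le_mono1[OF that, of "T1 - 1"] \<open>k \<le> r * (T1 - 1)\<close> by linarith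
    ultimately show "f \<in> G q" unfolding G_def by blast
  qed
  have finim: "finite (trdeg ` {Q. good r Q})" for r
    by (rule finite_subset[of _ "{..?n}"]) (auto simp: good_def trdeg_le)
  \<comment> \<open>The point \<open>1\<close> works at every level: by the hypothesis on
    \<open>P\<close> even the largest system \<open>G ?n\<close> vanishes there.\<close>
  have nonempty: "{Q. good r Q} \<noteq> {}" if r: "r \<le> ?n" for r
  proof -
    have "?n * (T1 - 1) < T" unfolding T1_def using T by (simp add: less_eq_Suc_le[symmetric] le_less_trans[OF times_div_less_eq_dividend])
    then have "G ?n \<subseteq> vanishing_ideal {1}"
      using ord by (auto simp: G_def vanishing_ideal_def meval_translate vanishes_to_order_def)
    then have "good r (vanishing_ideal {1})" unfolding good_def
      using G_mono[OF r] prime_vanishing_point one_in_iterated_product[OF S(3)] by blast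
    then show ?thesis by blast
  qed
  have trdeg_le_\<rho>: "trdeg Q \<le> \<rho> r" if "good r Q" for r Q
    unfolding \<rho>_def using that by (intro Max_ge finim) auto
  have \<rho>_attained: "\<exists>Q. good r Q \<and> trdeg Q = \<rho> r" if "r \<le> ?n" for r
  proof -
    have "\<rho> r \<in> trdeg ` {Q. good r Q}" unfolding \<rho>_def using nonempty[OF that] by (intro Max_in finim) auto
    then show ?thesis by auto
  qed
  have \<rho>_less: "\<rho> r < ?n" if r: "r \<le> ?n" for r
  proof -
    obtain Q where Q: "good r Q" "trdeg Q = \<rho> r" using \<rho>_attained[OF r] by blast
    then show ?thesis using trdeg_less[of Q P] PG[of r] P0 by (auto simp: good_def)
  qed
  have good_Suc: "good r Q" if "good (Suc r) Q" for r Q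
    using that G_mono[of r "Suc r"] iterated_product_mono[OF S(3), of "?n - Suc r" "?n - r"]
    unfolding good_def by fastforce
  \<comment> \<open>A drop at each of the \<open>?n\<close> steps would make \<open>\<rho> 0\<close>
    at least \<open>?n\<close>, contradicting \<open>\<rho>_less\<close>.\<close>
  have "\<exists>r<?n. \<rho> r \<le> \<rho> (Suc r)"
  proof (rule ccontr)
    assume "\<not> ?thesis"
    then have dec: "\<rho> (Suc r) < \<rho> r" if "r < ?n" for r using that by auto
    have "r \<le> ?n \<Longrightarrow> \<rho> r + r \<le> \<rho> 0" for r
    proof (induction r)
      case (Suc r) then show ?case using dec[of r] by simp
    qed simp
    from this[of ?n] show False using \<rho>_less[of 0] by simp
  qed
  then obtain r where r: "r < ?n" "\<rho> r \<le> \<rho> (Suc r)" by blast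
  obtain Q where Q: "good (Suc r) Q" "trdeg Q = \<rho> (Suc r)" using \<rho>_attained[of "Suc r"] r(1) by auto
  have Qp: "prime_ideal Q" and GQ: "G (Suc r) \<subseteq> Q" using Q(1) by (auto simp: good_def)
  obtain \<gamma> where \<gamma>: "\<gamma> \<in> ?S (?n - Suc r)" "Q \<subseteq> vanishing_ideal {\<gamma>}" using Q(1) by (auto simp: good_def)
  have \<gamma>t: "\<gamma> \<in> carrier torus" using \<gamma>(1) iterated_product_subset[OF S(2)] by blast
  have PQ: "P \<in> Q" using PG GQ by blast
  obtain B where basis: "indep_coords B Q" "card B = trdeg Q" by (rule trdeg_witness[OF Qp])
  have Bmax: "\<not> indep_coords (insert j B) Q" if "j \<notin> B" for j by (rule trdeg_witness_maximal[OF basis that])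
  define \<P> where "\<P> = (\<lambda>s. translate_ideal s Q) ` S"
  have St: "s \<in> carrier torus" if "s \<in> S" for s using that S(2) by blast
  \<comment> \<open>One more translation and at most \<open>T1 - 1\<close> more derivations lead
    from \<open>G r\<close> into \<open>G (Suc r)\<close>, hence into \<open>Q\<close>.\<close>
  have ord_s: "translate s ((invariant_field \<xi> ^^ k) f) \<in> Q" if s: "s \<in> S" and fG: "f \<in> G r" and k: "k < T1" for s f k
  proof -
    obtain \<delta> l where f: "f = translate \<delta> ((invariant_field \<xi> ^^ l) P)" "\<delta> \<in> ?S r" "l \<le> r * (T1 - 1)"
      using fG unfolding G_def by blast
    have "translate s ((invariant_field \<xi> ^^ k) f) = translate (\<delta> * s) ((invariant_field \<xi> ^^ (k + l)) P)"
      by (simp add: f translate_invariant_field_funpow[symmetric] translate_translate funpow_add mult.commute)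
    moreover have "\<delta> * s \<in> ?S (Suc r)" by (rule iterated_product_mult[OF f(2) s])
    moreover have "k + l \<le> Suc r * (T1 - 1)" using f(3) k by simp
    ultimately have "translate s ((invariant_field \<xi> ^^ k) f) \<in> G (Suc r)" unfolding G_def by blast
    then show ?thesis using GQ by blast
  qed
  \<comment> \<open>A smaller prime \<open>R\<close> is good at level \<open>r\<close> through the
    point \<open>\<gamma> * s\<close>. As \<open>\<rho>\<close> did not drop, its dimension is no
    larger, so the primes agree.\<close>
  have min_s: "R = translate_ideal s Q" if "s \<in> S" "prime_ideal R" "G r \<subseteq> R" "R \<subseteq> translate_ideal s Q" for s R
  proof -
    have "\<gamma> * s \<in> ?S (Suc (?n - Suc r))" by (rule iterated_product_mult[OF \<gamma>(1) that(1)])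
    then have "\<gamma> * s \<in> ?S (?n - r)" using r(1) by (simp only: Suc_diff_Suc)
    moreover have "R \<subseteq> vanishing_ideal {\<gamma> * s}"
      using that(4) \<gamma>(2) by (auto simp: vanishing_ideal_def translate_ideal_def meval_translate mult.commute)
    ultimately have "good r R" using that(2,3) by (auto simp: good_def)
    then have "trdeg R \<le> trdeg (translate_ideal s Q)"
      using trdeg_le_\<rho> r(2) Q(2) trdeg_translate[OF St[OF that(1)]] by (metis le_trans)
    then show ?thesis using prime_eq_of_trdeg that prime_translate_ideal[OF Qp] by blast
  qed
  interpret thick_components \<P> "G r" B "total_degree P" T1 \<xi>
  proof
    show "finite \<P>" using S(1) by (simp add: \<P>_def)
    show "B \<noteq> UNIV" using basis \<rho>_less[of "Suc r"] Q(2) r(1) by auto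
    show "G r \<subseteq> box_polys {} (total_degree P)"
    proof
      fix f assume "f \<in> G r"
      then obtain \<delta> l where "f = translate \<delta> ((invariant_field \<xi> ^^ l) P)" unfolding G_def by blast
      moreover have "(invariant_field \<xi> ^^ l) P \<in> box_polys {} (total_degree P)" for l
        by (induction l) (auto simp: total_degree_box invariant_field_eq box_polys_diag)
      ultimately show "f \<in> box_polys {} (total_degree P)" by (simp add: translate_def box_polys_diag)
    qed
  next
    fix R assume "R \<in> \<P>"
    then obtain s where s: "s \<in> S" "R = translate_ideal s Q" by (auto simp: \<P>_def)
    note st = St[OF s(1)]
    show Rp: "prime_ideal R" using s prime_translate_ideal[OF Qp] by simp
    show "indep_coords B R" using s basis(1) indep_coords_translate[OF st] by simp
    show "\<not> indep_coords (insert j B) R" if "j \<notin> B" for j using s Bmax[OF that] indep_coords_translate[OF st] by simp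
    show "mvar j \<notin> R" for j
    proof
      assume "mvar j \<in> R"
      then have "meval (translate s (mvar j)) \<gamma> = 0" using s \<gamma>(2) by (auto simp: translate_ideal_def vanishing_ideal_def)
      then show False using st \<gamma>t by (simp add: meval_translate mvar_def meval_single monom_eval_single)
    qed
    \<comment> \<open>If \<open>\<xi>\<close> preserved \<open>R\<close>, it would preserve
      \<open>Q\<close>. All iterates of \<open>\<xi>\<close> on \<open>P\<close> would then vanish
      at \<open>\<gamma>\<close>, and \<open>P\<close> would vanish along its trajectory.\<close>
    show "\<exists>f\<in>R. invariant_field \<xi> f \<notin> R"
    proof (rule ccontr)
      assume no: "\<not> ?thesis"
      have "invariant_field \<xi> f \<in> Q" if "f \<in> Q" for f
      proof -
        have "translate (torus_inv s) f \<in> R" using that by (simp add: s translate_ideal_def translate_inv[OF st])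
        then have "invariant_field \<xi> (translate (torus_inv s) f) \<in> R" using no by blast
        then show ?thesis by (simp add: s translate_ideal_def translate_invariant_field translate_inv[OF st])
      qed
      then have "(invariant_field \<xi> ^^ k) P \<in> Q" for k by (induction k) (auto simp: PQ)
      then have "meval ((invariant_field \<xi> ^^ k) P) \<gamma> = 0" for k using \<gamma>(2) by (auto simp: vanishing_ideal_def)
      then have "vanishes_identically P \<xi> \<gamma>" unfolding vanishes_identically_def using meval_trajectory_eq_zero by blast
      moreover have "\<gamma> \<in> ?S ?n" using \<gamma>(1) iterated_product_mono[OF S(3), of "?n - Suc r" ?n] by auto
      ultimately show False using nid by blast
    qed
    show ordR: "(invariant_field \<xi> ^^ k) f \<in> R" if "f \<in> G r" "k < T1" for f k
      using ord_s[OF s(1) that] by (simp add: s translate_ideal_def)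
    have GR: "G r \<subseteq> R" using ordR[of _ 0] by (auto simp: T1_def)
    show "\<exists>h m. h \<notin> R \<and> h * g ^ m \<in> gen_power (G r) 1" if "g \<in> R" for g
      using minimal_prime[OF Rp GR _ that] min_s[OF s(1)] s(2) by metis
    fix R' assume "R' \<in> \<P>" "R \<subseteq> R'"
    then obtain t where t: "t \<in> S" "R' = translate_ideal t Q" by (auto simp: \<P>_def)
    then show "R = R'" using min_s[OF t(1) Rp GR] \<open>R \<subseteq> R'\<close> by simp
  qed
  let ?H = "stabilizer Q" and ?c = "card (- B)"
  have "real (card \<P> * T1) \<le> (real (total_degree P) * real ?c) ^ ?c" by (rule bezout_bound) (simp add: T1_def)
  also have "\<dots> = real (total_degree P) ^ ?c * real ?c ^ ?c" by (simp add: power_mult_distrib)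
  also have "\<dots> \<le> real (total_degree P) ^ codim ?H * real ?n ^ ?n"
  proof (rule mult_mono)
    have "?c = ?n - trdeg Q" using basis(2) card_Diff_subset[of B UNIV] by (simp add: Compl_eq_Diff_UNIV)
    then have c: "?c \<le> codim ?H" "?c > 0" unfolding codim_def
      using zariski_dim_torus[where 'n='n] zariski_dim_stabilizer[OF Qp \<gamma>t \<gamma>(2)] \<rho>_less[of "Suc r"] Q(2) r(1) by auto
    \<comment> \<open>In degree 0 both powers are 0 because the exponents are positive.\<close>
    show "real (total_degree P) ^ ?c \<le> real (total_degree P) ^ codim ?H"
      using c by (cases "total_degree P = 0") (auto intro: power_increasing simp: power_0_left)
    have cn: "?c \<le> ?n" by (rule card_mono) auto
    then have "real ?c ^ ?c \<le> real ?n ^ ?c" by (intro power_mono) auto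
    also have "\<dots> \<le> real ?n ^ ?n" using cn by (intro power_increasing) (auto simp: Suc_leI)
    finally show "real ?c ^ ?c \<le> real ?n ^ ?n" .
  qed auto
  finally have bound: "real (card \<P> * T1) \<le> real (total_degree P) ^ codim ?H * real ?n ^ ?n" .
  \<comment> \<open>Returning from \<open>T1\<close> to \<open>T\<close> costs a factor
    \<open>?n\<close>; together with \<open>?n ^ ?n\<close> from the Bezout bound it forms the
    constant.\<close>
  have "T \<le> ?n * T1"
  proof -
    have "T - 1 = ?n * ((T - 1) div ?n) + (T - 1) mod ?n" by simp
    moreover have "(T - 1) mod ?n < ?n" by simp
    moreover have "?n * T1 = ?n * ((T - 1) div ?n) + ?n" by (simp add: T1_def)
    ultimately show ?thesis by linarith
  qed
  then have "number_of_cosets S ?H * T \<le> card \<P> * (?n * T1)"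
    using number_of_cosets_stabilizer_le[OF Qp S(1,2)] by (intro mult_le_mono) (simp_all add: \<P>_def)
  then have "real (number_of_cosets S ?H) * real T \<le> real ?n * real (card \<P> * T1)"
    by (metis of_nat_le_iff of_nat_mult mult.left_commute)
  also have "\<dots> \<le> real ?n * (real (total_degree P) ^ codim ?H * real ?n ^ ?n)"
    using bound by (intro mult_left_mono) auto
  finally have "real (number_of_cosets S ?H) \<le> real (total_degree P) ^ codim ?H * real (?n * ?n ^ ?n) / real T"
    using T by (simp add: field_simps)
  then show ?thesis using that stabilizer_subgroup[OF Qp] stabilizer_proper[OF \<gamma>t \<gamma>(2) PQ P0] by blast
qed

theorem theorem8:
  shows "\<exists>C :: real. \<forall>(\<xi> :: complex ^ 'n::finite) (\<Sigma> :: (complex ^ 'n) set) (P :: 'n mpoly) (d :: nat) (T :: nat).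
    finite \<Sigma> \<longrightarrow> \<Sigma> \<subseteq> carrier torus \<longrightarrow> \<one>\<^bsub>torus\<^esub> \<in> \<Sigma> \<longrightarrow> total_degree P = d \<longrightarrow> T \<ge> 1 \<longrightarrow>
    (\<forall>H :: (complex ^ 'n) set. algebraic_subgroup H \<and> H \<noteq> carrier torus \<longrightarrow>
       real (number_of_cosets \<Sigma> H) > real d ^ codim H * C / real T) \<longrightarrow>
    (\<forall>\<gamma> \<in> iterated_product \<Sigma> CARD('n). vanishes_to_order P \<xi> \<gamma> T) \<longrightarrow>
    (\<exists>\<gamma> \<in> iterated_product \<Sigma> CARD('n). vanishes_identically P \<xi> \<gamma>)"
proof (intro exI[of _ "real (CARD('n) * CARD('n) ^ CARD('n))"] allI impI, rule ccontr)
  fix \<xi> :: "complex ^ 'n" and \<Sigma> :: "(complex ^ 'n) set" and P :: "'n mpoly" and d T :: nat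
  assume *: "finite \<Sigma>" "\<Sigma> \<subseteq> carrier torus" "\<one>\<^bsub>torus\<^esub> \<in> \<Sigma>" "total_degree P = d" "T \<ge> 1"
    and many: "\<forall>H :: (complex ^ 'n) set. algebraic_subgroup H \<and> H \<noteq> carrier torus \<longrightarrow>
       real (number_of_cosets \<Sigma> H) > real d ^ codim H * real (CARD('n) * CARD('n) ^ CARD('n)) / real T"
    and ord: "\<forall>\<gamma> \<in> iterated_product \<Sigma> CARD('n). vanishes_to_order P \<xi> \<gamma> T"
    and no: "\<not> (\<exists>\<gamma> \<in> iterated_product \<Sigma> CARD('n). vanishes_identically P \<xi> \<gamma>)"
  obtain H :: "(complex ^ 'n) set" where "algebraic_subgroup H" "H \<noteq> carrier torus"
    "real (number_of_cosets \<Sigma> H) \<le> real (total_degree P) ^ codim H * real (CARD('n) * CARD('n) ^ CARD('n)) / real T"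
    by (rule multiplicity_estimate[of \<Sigma> T P \<xi>]) (use * ord no in auto)
  then show False using many *(4) by force
qed

end
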